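(* Let $X\subseteq T^n$ be a rational variety of dimension $d$, and write $\operatorname{Trop}(X)=\bigcup_i P_i$ where the $P_i$ are finitely many $d$-dimensional polyhedra (this is possible by the Bieri–Groves theorem). If for each $P_i$ there exists a torus homomorphism $\pi:T^n\to T^d$ whose restriction to $X$ is birational and for which $P_i$ is $\operatorname{Trop}(\pi)$-horizontal, then $X$ is tropically unirational.
   Context: $K$ is an algebraically closed field with a non-Archimedean valuation $v:K\to\mathbb{R}\cup\{\infty\}$ (possibly trivial). Write $T=K^*$ for the one-dimensional torus over $K$ and $T^n$ for the $n$-dimensional torus. For a non-zero polynomial (or Laurent polynomial) $f=\sum_\alpha c_\alpha x^\alpha$ in $m$ variables over $K$, $\operatorname{Trop}(f):\mathbb{R}^m\to\mathbb{R}$ is the function $\operatorname{Trop}(f)(\xi)=\min_\alpha (v(c_\alpha)+\xi\cdot\alpha)$. It extends to non-zero rational functions by $\operatorname{Trop}(f/h)=\operatorname{Trop}(f)-\operatorname{Trop}(h)$. For a rational map $\varphi=(f_1,\ldots,f_n):T^m\dashrightarrow T^n$ (each $f_i$ a non-zero rational function) set $\operatorname{Trop}(\varphi)=(\operatorname{Trop}(f_1),\ldots,\operatorname{Trop}(f_n)):\mathbb{R}^m\to\mathbb{R}^n$; for a torus homomorphism $\pi$ (a monomial map) $\operatorname{Trop}(\pi)$ is a linear map. For a closed subvariety $X\subseteq T^n$, $\operatorname{Trop}(X)\subseteq\mathbb{R}^n$ is the intersection of the corner loci of $\operatorname{Trop}(f)$ (the sets where the minimum is attained at least twice) over all $f$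 in the ideal of $X$ in $K[x_1^{\pm1},\ldots,x_n^{\pm1}]$. A closed subvariety $X\subseteq T^n$ is called tropically unirational if there exist a natural number $p$ and a dominant rational map $\varphi:T^p\dashrightarrow X$ such that $\operatorname{im}\operatorname{Trop}(\varphi)=\operatorname{Trop}(X)$. A $d$-dimensional polyhedron $P\subseteq\mathbb{R}^n$ is called $A$-horizontal, for a linear map $A:\mathbb{R}^n\to\mathbb{R}^d$, if $\dim AP=d$. *)

theory Defs
  imports
    "HOL-Analysis.Analysis"
    "HOL-Analysis.Finite_Function_Topology"
    "HOL-Computational_Algebra.Fraction_Field"
    "HOL-Computational_Algebra.Polynomial"
    "HOL-Library.Poly_Mapping"
    "HOL-Library.FuncSet"
begin

text \<open>
  The variables are indexed by natural numbers, so that the number of variables can be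
  quantified over; \<open>n\<close> variables means the indices below \<open>n\<close>. An exponent vector is a
  finitely supported function \<open>nat \<Rightarrow>\<^sub>0 int\<close> and a Laurent polynomial a finitely supported
  function from exponent vectors to coefficients, multiplied by convolution.
\<close>

type_synonym 'k laurent_poly = "(nat \<Rightarrow>\<^sub>0 int) \<Rightarrow>\<^sub>0 'k"
type_synonym 'k rational_fun = "((nat \<Rightarrow>\<^sub>0 int) \<Rightarrow>\<^sub>0 'k) fract"
type_synonym 'k point = "nat \<Rightarrow> 'k"

definition nonarch_valuation :: "('k::field \<Rightarrow> ereal) \<Rightarrow> bool" where
  "nonarch_valuation v \<longleftrightarrow>
     (\<forall>a. v a \<noteq> - \<infinity>) \<and>
     (\<forall>a. v a = \<infinity> \<longleftrightarrow> a = 0) \<and>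
     (\<forall>a b. v (a * b) = v a + v b) \<and>
     (\<forall>a b. min (v a) (v b) \<le> v (a + b))"


section \<open>Tori and closed subvarieties\<close>

definition laurent :: "nat \<Rightarrow> ('k::field) laurent_poly set" where
  "laurent n = {f. \<forall>\<alpha>\<in>Poly_Mapping.keys f. Poly_Mapping.keys \<alpha> \<subseteq> {..<n}}"

definition torus :: "nat \<Rightarrow> ('k::field) point set" where
  "torus n = {..<n} \<rightarrow>\<^sub>E (UNIV - {0})"

definition laurent_eval :: "('k::field) laurent_poly \<Rightarrow> 'k point \<Rightarrow> 'k" where
  "laurent_eval f x =
     (\<Sum>\<alpha>\<in>Poly_Mapping.keys f. Poly_Mapping.lookup f \<alpha> *
        (\<Prod>i\<in>Poly_Mapping.keys \<alpha>. x i powi Poly_Mapping.lookup \<alpha> i))"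

definition zero_locus :: "nat \<Rightarrow> ('k::field) laurent_poly set \<Rightarrow> 'k point set" where
  "zero_locus n F = {x \<in> torus n. \<forall>f\<in>F. laurent_eval f x = 0}"

definition vanishing_ideal :: "nat \<Rightarrow> ('k::field) point set \<Rightarrow> 'k laurent_poly set" where
  "vanishing_ideal n S = {f \<in> laurent n. \<forall>x\<in>S. laurent_eval f x = 0}"

definition zariski_closed :: "nat \<Rightarrow> ('k::field) point set \<Rightarrow> bool" where
  "zariski_closed n X \<longleftrightarrow> (\<exists>F \<subseteq> laurent n. X = zero_locus n F)"

definition zariski_closure :: "nat \<Rightarrow> ('k::field) point set \<Rightarrow> 'k point set" where
  "zariski_closure n S = \<Inter> {C. zariski_closed n C \<and> S \<subseteq> C}"

definition zariski_irreducible :: "nat \<Rightarrow> ('k::field) point set \<Rightarrow> bool" where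
  "zariski_irreducible n X \<longleftrightarrow> X \<noteq> {} \<and>
     (\<forall>C D. zariski_closed n C \<and> zariski_closed n D \<and> X \<subseteq> C \<union> D \<longrightarrow> X \<subseteq> C \<or> X \<subseteq> D)"


section \<open>Rational maps\<close>

definition rational_funs :: "nat \<Rightarrow> ('k::field) rational_fun set" where
  "rational_funs m = {Fract f h | f h. f \<in> laurent m \<and> h \<in> laurent m \<and> h \<noteq> 0}"

definition regular_at :: "nat \<Rightarrow> ('k::field) rational_fun \<Rightarrow> 'k point \<Rightarrow> bool" where
  "regular_at m q x \<longleftrightarrow>
     (\<exists>f h. f \<in> laurent m \<and> h \<in> laurent m \<and> q = Fract f h \<and> laurent_eval h x \<noteq> 0)"

text \<open>Where \<open>q\<close> is regular, the value does not depend on the chosen fraction.\<close>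

definition rational_eval :: "nat \<Rightarrow> ('k::field) rational_fun \<Rightarrow> 'k point \<Rightarrow> 'k" where
  "rational_eval m q x =
     (THE y. \<exists>f h. f \<in> laurent m \<and> h \<in> laurent m \<and> q = Fract f h \<and>
        laurent_eval h x \<noteq> 0 \<and> y = laurent_eval f x / laurent_eval h x)"

text \<open>
  A tuple \<open>\<phi>\<close> of rational functions in \<open>m\<close> variables is read as a map from the \<open>m\<close>-torus to
  the \<open>n\<close>-torus; only the components below \<open>n\<close> matter. As the target is a torus, a point belongs
  to the domain only if all components are regular and non-zero there.
\<close>

definition rat_domain :: "nat \<Rightarrow> nat \<Rightarrow> (nat \<Rightarrow> ('k::field) rational_fun) \<Rightarrow> 'k point set" where
  "rat_domain m n \<phi> =
     {x \<in> torus m. \<forall>i<n. regular_at m (\<phi> i) x \<and> rational_eval m (\<phi> i) x \<noteq> 0}"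

definition rat_apply ::
    "nat \<Rightarrow> nat \<Rightarrow> (nat \<Rightarrow> ('k::field) rational_fun) \<Rightarrow> 'k point \<Rightarrow> 'k point" where
  "rat_apply m n \<phi> x = (\<lambda>i\<in>{..<n}. rational_eval m (\<phi> i) x)"

text \<open>
  A rational map from an irreducible closed \<open>X\<close> in the \<open>m\<close>-torus to \<open>Y\<close> in the \<open>n\<close>-torus is given
  by rational functions on the ambient torus whose domain meets \<open>X\<close>; every element of the function
  field of \<open>X\<close> is the restriction of such a function.
\<close>

definition rational_map ::
    "nat \<Rightarrow> ('k::field) point set \<Rightarrow> nat \<Rightarrow> 'k point set \<Rightarrow> (nat \<Rightarrow> 'k rational_fun) \<Rightarrow> bool" where
  "rational_map m X n Y \<phi> \<longleftrightarrow>
     (\<forall>i<n. \<phi> i \<in> rational_funs m \<and> \<phi> i \<noteq> 0) \<and>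
     X \<inter> rat_domain m n \<phi> \<noteq> {} \<and>
     rat_apply m n \<phi> ` (X \<inter> rat_domain m n \<phi>) \<subseteq> Y"

definition dominant_rational_map ::
    "nat \<Rightarrow> ('k::field) point set \<Rightarrow> nat \<Rightarrow> 'k point set \<Rightarrow> (nat \<Rightarrow> 'k rational_fun) \<Rightarrow> bool" where
  "dominant_rational_map m X n Y \<phi> \<longleftrightarrow>
     rational_map m X n Y \<phi> \<and>
     Y \<subseteq> zariski_closure n (rat_apply m n \<phi> ` (X \<inter> rat_domain m n \<phi>))"

text \<open>
  Both maps are dominant, so the compositions are defined on non-empty open subsets, and equality
  of rational maps is agreement at the points where the composition is defined.
\<close>

definition birational_map ::
    "nat \<Rightarrow> ('k::field) point set \<Rightarrow> nat \<Rightarrow> 'k point set \<Rightarrow> (nat \<Rightarrow> 'k rational_fun) \<Rightarrow> bool" where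
  "birational_map m X n Y \<phi> \<longleftrightarrow>
     dominant_rational_map m X n Y \<phi> \<and>
     (\<exists>\<psi>. dominant_rational_map n Y m X \<psi> \<and>
        (\<forall>x \<in> X \<inter> rat_domain m n \<phi>. rat_apply m n \<phi> x \<in> rat_domain n m \<psi> \<longrightarrow>
           rat_apply n m \<psi> (rat_apply m n \<phi> x) = x) \<and>
        (\<forall>y \<in> Y \<inter> rat_domain n m \<psi>. rat_apply n m \<psi> y \<in> rat_domain m n \<phi> \<longrightarrow>
           rat_apply m n \<phi> (rat_apply n m \<psi> y) = y))"

text \<open>
  Birational to the \<open>d\<close>-torus, equivalently to projective \<open>d\<close>-space, of which the torus is a
  dense open subset.
\<close>

definition rational_variety :: "nat \<Rightarrow> nat \<Rightarrow> ('k::field) point set \<Rightarrow> bool" where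
  "rational_variety n d X \<longleftrightarrow>
     zariski_closed n X \<and> zariski_irreducible n X \<and> (\<exists>\<phi>. birational_map d (torus d) n X \<phi>)"

definition torus_hom :: "nat \<Rightarrow> nat \<Rightarrow> (nat \<Rightarrow> ('k::field) rational_fun) \<Rightarrow> bool" where
  "torus_hom n d \<pi> \<longleftrightarrow>
     (\<forall>j<d. \<exists>\<alpha>. Poly_Mapping.keys \<alpha> \<subseteq> {..<n} \<and> \<pi> j = Fract (Poly_Mapping.single \<alpha> 1) 1)"


section \<open>Tropicalization\<close>

text \<open>
  \<open>\<real>\<^sup>n\<close> as a subspace of the vector space of finitely supported real sequences.
\<close>

definition Rn :: "nat \<Rightarrow> (nat \<Rightarrow>\<^sub>0 real) set" where
  "Rn n = {\<xi>. Poly_Mapping.keys \<xi> \<subseteq> {..<n}}"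

definition trop_term ::
    "('k::field \<Rightarrow> ereal) \<Rightarrow> 'k laurent_poly \<Rightarrow> (nat \<Rightarrow>\<^sub>0 real) \<Rightarrow> (nat \<Rightarrow>\<^sub>0 int) \<Rightarrow> real" where
  "trop_term v f \<xi> \<alpha> = real_of_ereal (v (Poly_Mapping.lookup f \<alpha>)) +
     (\<Sum>i\<in>Poly_Mapping.keys \<alpha>. Poly_Mapping.lookup \<xi> i * of_int (Poly_Mapping.lookup \<alpha> i))"

text \<open>Meaningful for \<open>f \<noteq> 0\<close> only; the valuations of the occurring coefficients are then finite.\<close>

definition trop_poly ::
    "('k::field \<Rightarrow> ereal) \<Rightarrow> 'k laurent_poly \<Rightarrow> (nat \<Rightarrow>\<^sub>0 real) \<Rightarrow> real" where
  "trop_poly v f \<xi> = Min (trop_term v f \<xi> ` Poly_Mapping.keys f)"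

definition corner_locus ::
    "('k::field \<Rightarrow> ereal) \<Rightarrow> nat \<Rightarrow> 'k laurent_poly \<Rightarrow> (nat \<Rightarrow>\<^sub>0 real) set" where
  "corner_locus v n f =
     {\<xi> \<in> Rn n. \<exists>\<alpha>\<in>Poly_Mapping.keys f. \<exists>\<beta>\<in>Poly_Mapping.keys f. \<alpha> \<noteq> \<beta> \<and>
        trop_term v f \<xi> \<alpha> = trop_poly v f \<xi> \<and> trop_term v f \<xi> \<beta> = trop_poly v f \<xi>}"

text \<open>The zero polynomial has no tropicalization and imposes no condition.\<close>

definition trop_variety ::
    "('k::field \<Rightarrow> ereal) \<Rightarrow> nat \<Rightarrow> 'k point set \<Rightarrow> (nat \<Rightarrow>\<^sub>0 real) set" where
  "trop_variety v n X =
     {\<xi> \<in> Rn n. \<forall>f \<in> vanishing_ideal n X. f \<noteq> 0 \<longrightarrow> \<xi> \<in> corner_locus v n f}"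

text \<open>For a valuation \<open>v\<close> and \<open>q \<noteq> 0\<close>, the difference does not depend on the chosen fraction.\<close>

definition trop_rational ::
    "('k::field \<Rightarrow> ereal) \<Rightarrow> 'k rational_fun \<Rightarrow> (nat \<Rightarrow>\<^sub>0 real) \<Rightarrow> real" where
  "trop_rational v q \<xi> =
     (THE t. \<exists>f h. f \<noteq> 0 \<and> h \<noteq> 0 \<and> q = Fract f h \<and> t = trop_poly v f \<xi> - trop_poly v h \<xi>)"

definition trop_map ::
    "('k::field \<Rightarrow> ereal) \<Rightarrow> nat \<Rightarrow> (nat \<Rightarrow> 'k rational_fun) \<Rightarrow> (nat \<Rightarrow>\<^sub>0 real) \<Rightarrow> (nat \<Rightarrow>\<^sub>0 real)" where
  "trop_map v n \<phi> \<xi> = Abs_poly_mapping (\<lambda>i. trop_rational v (\<phi> i) \<xi> when i < n)"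

definition tropically_unirational ::
    "('k::field \<Rightarrow> ereal) \<Rightarrow> nat \<Rightarrow> 'k point set \<Rightarrow> bool" where
  "tropically_unirational v n X \<longleftrightarrow>
     (\<exists>p \<phi>. dominant_rational_map p (torus p) n X \<phi> \<and>
        trop_map v n \<phi> ` Rn p = trop_variety v n X)"


section \<open>Polyhedra\<close>

definition polyhedron_in :: "nat \<Rightarrow> (nat \<Rightarrow>\<^sub>0 real) set \<Rightarrow> bool" where
  "polyhedron_in n P \<longleftrightarrow>
     (\<exists>H :: ((nat \<Rightarrow> real) \<times> real) set. finite H \<and>
        P = {\<xi> \<in> Rn n. \<forall>(a, b) \<in> H. (\<Sum>i<n. a i * Poly_Mapping.lookup \<xi> i) \<le> b})"

text \<open>
  The definition of \<^const>\<open>aff_dim\<close>, which the library restricts to Euclidean spaces. The empty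
  set has dimension \<open>-1\<close>.
\<close>

definition affine_dim :: "(nat \<Rightarrow>\<^sub>0 real) set \<Rightarrow> int" where
  "affine_dim P =
     (SOME d :: int. \<exists>B. affine hull B = affine hull P \<and> \<not> affine_dependent B \<and>
        of_nat (card B) = d + 1)"

definition horizontal ::
    "nat \<Rightarrow> ((nat \<Rightarrow>\<^sub>0 real) \<Rightarrow> (nat \<Rightarrow>\<^sub>0 real)) \<Rightarrow> (nat \<Rightarrow>\<^sub>0 real) set \<Rightarrow> bool" where
  "horizontal d A P \<longleftrightarrow> affine_dim (A ` P) = int d"

end

theory Submission
  imports Defs
begin

text \<open>
  Each \<open>\<pi>\<^sub>i\<close> has an inverse \<open>\<psi>\<^sub>i\<close>, a tuple of rational functions with \<open>\<pi>\<^sub>i \<circ> \<psi>\<^sub>i = id\<close> whose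
  algebraic relations are exactly the ideal of \<open>X\<close>. Writing \<open>\<psi>\<^sub>i = f / h\<close> componentwise, the
  polynomials \<open>x\<^sub>l h\<^sub>l(\<pi>\<^sub>i(x)) - f\<^sub>l(\<pi>\<^sub>i(x))\<close> lie in that ideal. At a point \<open>\<xi>\<close> of \<open>P\<^sub>i\<close> with
  \<open>Trop(\<pi>\<^sub>i)(\<xi>)\<close> generic, the minimum in their tropicalization can be attained twice only by one
  term of each of the two parts, which forces \<open>Trop(\<psi>\<^sub>i)(Trop(\<pi>\<^sub>i)(\<xi>)) = \<xi>\<close>; horizontality and
  continuity extend this to all of \<open>P\<^sub>i\<close>. Thus the image of \<open>Trop(\<psi>\<^sub>i)\<close> contains \<open>P\<^sub>i\<close>, and it
  remains to combine the finitely many \<open>\<psi>\<^sub>i\<close> into one map. With \<open>\<alpha>\<^sub>i = \<pi>\<^sub>0 \<circ> \<psi>\<^sub>i\<close> one has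
  \<open>\<psi>\<^sub>0 \<circ> \<alpha>\<^sub>i = \<psi>\<^sub>i\<close>, so \<open>\<psi>\<^sub>0\<close> evaluated at \<open>(\<Sum>i. t\<^sub>i \<alpha>\<^sub>i) / (\<Sum>i. t\<^sub>i)\<close> does it: letting the
  valuations of all \<open>t\<^sub>j\<close> with \<open>j \<noteq> i\<close> tend to infinity recovers \<open>Trop(\<psi>\<^sub>i)\<close>. Conversely,
  tropicalizations of points of \<open>X\<close> over any valued field lie in \<open>Trop(X)\<close>; this is applied to
  the field of rational functions with its Gauss valuations.
\<close>

text \<open>Points of the torus over \<open>K\<close> do not realise all valuation vectors; for the
  trivial valuation they realise only 0. The argument therefore never lifts tropical points to
  points of X over \<open>K\<close>. It works with tuples of rational functions, which are points of
  X over a function field, and varies the weights of the Gauss valuation instead of the point.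

  A union of images need not be the image of one map. What helps is that the source of
  \<open>\<psi>\<^sub>0\<close> is open in affine space: any d-tuple of rational functions may be
  substituted as long as no denominator vanishes, and the result still satisfies the relations of X.
  Once every \<open>\<psi>\<^sub>i\<close> is expressed through \<open>\<psi>\<^sub>0\<close>, the
  tuples \<open>\<alpha>\<^sub>i\<close> may be averaged. Dividing by the sum of the weights makes
  the coefficients of the mean add up to 1, so that a dominant i-th weight yields exactly
  \<open>\<alpha>\<^sub>i\<close> in the limit. Moreover the valuations become constant before the
  limit is reached, so the values of Trop(\<open>\<psi>\<^sub>i\<close>) are attained and not merely
  approached.\<close>

section \<open>Evaluation of Laurent polynomials in field extensions\<close>

definition monom_eval :: "(nat \<Rightarrow> 'l::field) \<Rightarrow> (nat \<Rightarrow>\<^sub>0 int) \<Rightarrow> 'l" where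
  "monom_eval x \<alpha> = (\<Prod>i\<in>Poly_Mapping.keys \<alpha>. x i powi Poly_Mapping.lookup \<alpha> i)"

text \<open>With \<open>c\<close> the identity this is the value at a point of the torus; with
  \<open>c = const_fun\<close> and \<open>x\<close> a tuple of rational functions it is
  substitution. One set of lemmas serves both.\<close>

definition leval :: "('k::field \<Rightarrow> 'l::field) \<Rightarrow> 'k laurent_poly \<Rightarrow> (nat \<Rightarrow> 'l) \<Rightarrow> 'l" where
  "leval c f x = (\<Sum>\<alpha>\<in>Poly_Mapping.keys f. c (Poly_Mapping.lookup f \<alpha>) * monom_eval x \<alpha>)"

definition field_hom :: "('k::field \<Rightarrow> 'l::field) \<Rightarrow> bool" where
  "field_hom c \<longleftrightarrow> c 0 = 0 \<and> c 1 = 1 \<and> (\<forall>a b. c (a + b) = c a + c b) \<and> (\<forall>a b. c (a * b) = c a * c b)"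

definition vars_below :: "nat \<Rightarrow> (nat \<Rightarrow>\<^sub>0 int) set" where
  "vars_below m = {\<alpha>. Poly_Mapping.keys \<alpha> \<subseteq> {..<m}}"

lemma laurent_eval_eq_leval: "laurent_eval f x = leval (\<lambda>a. a) f x"
  by (simp add: laurent_eval_def leval_def monom_eval_def)

lemma field_hom_id: "field_hom (\<lambda>a. a)"
  by (simp add: field_hom_def)

lemma field_hom_diff: "field_hom c \<Longrightarrow> c (a - b) = c a - c b"
  unfolding field_hom_def by (metis add_diff_cancel_right' diff_add_cancel)

lemma field_hom_uminus: "field_hom c \<Longrightarrow> c (- a) = - c a"
  using field_hom_diff[of c 0 a] by (simp add: field_hom_def)

lemma laurent_iff: "f \<in> laurent m \<longleftrightarrow> Poly_Mapping.keys f \<subseteq> vars_below m"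
  by (auto simp: laurent_def vars_below_def)

lemma vars_below_add: "\<alpha> \<in> vars_below m \<Longrightarrow> \<beta> \<in> vars_below m \<Longrightarrow> \<alpha> + \<beta> \<in> vars_below m"
  using Poly_Mapping.keys_add[of \<alpha> \<beta>] by (auto simp: vars_below_def)

lemma vars_below_0 [simp]: "0 \<in> vars_below m"
  by (simp add: vars_below_def)

lemma vars_below_mono: "\<alpha> \<in> vars_below m \<Longrightarrow> m \<le> m' \<Longrightarrow> \<alpha> \<in> vars_below m'"
  by (auto simp: vars_below_def)

lemma laurent_mono: "f \<in> laurent m \<Longrightarrow> m \<le> m' \<Longrightarrow> f \<in> laurent m'"
  by (auto simp: laurent_iff intro: vars_below_mono)

lemma laurent_0 [simp]: "0 \<in> laurent m"
  by (simp add: laurent_iff)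

lemma laurent_single: "\<alpha> \<in> vars_below m \<Longrightarrow> Poly_Mapping.single \<alpha> a \<in> laurent m"
  by (simp add: laurent_iff)

lemma laurent_1 [simp]: "1 \<in> laurent m"
  using laurent_single[of 0 m 1] by simp

lemma laurent_add: "f \<in> laurent m \<Longrightarrow> g \<in> laurent m \<Longrightarrow> f + g \<in> laurent m"
  using Poly_Mapping.keys_add[of f g] by (auto simp: laurent_iff)

lemma laurent_uminus: "f \<in> laurent m \<Longrightarrow> - f \<in> laurent m"
  by (simp add: laurent_iff in_keys_iff subset_iff)

lemma laurent_diff: "f \<in> laurent m \<Longrightarrow> g \<in> laurent m \<Longrightarrow> f - g \<in> laurent m"
  using laurent_add[of f m "- g"] by (simp add: laurent_uminus)

lemma laurent_sum: "(\<And>i. i \<in> I \<Longrightarrow> f i \<in> laurent m) \<Longrightarrow> sum f I \<in> laurent m"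
  by (induction I rule: infinite_finite_induct) (auto intro: laurent_add)

lemma laurent_mult: "f \<in> laurent m \<Longrightarrow> g \<in> laurent m \<Longrightarrow> f * g \<in> laurent m"
  using Poly_Mapping.keys_mult[of f g] unfolding laurent_iff by (blast intro: vars_below_add)

lemma laurent_prod: "(\<And>i. i \<in> I \<Longrightarrow> f i \<in> laurent m) \<Longrightarrow> prod f I \<in> laurent m"
  by (induction I rule: infinite_finite_induct) (auto intro: laurent_mult)

lemma poly_mapping_sum_single:
  "f = (\<Sum>\<alpha>\<in>Poly_Mapping.keys f. Poly_Mapping.single \<alpha> (Poly_Mapping.lookup f \<alpha>))"
  by (rule poly_mapping_eqI) (auto simp: lookup_sum lookup_single when_def in_keys_iff)

lemma monom_eval_superset:
  assumes "finite S" "Poly_Mapping.keys \<alpha> \<subseteq> S"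
  shows "monom_eval x \<alpha> = (\<Prod>i\<in>S. x i powi Poly_Mapping.lookup \<alpha> i)"
  unfolding monom_eval_def
  by (rule prod.mono_neutral_left) (use assms in \<open>auto simp: in_keys_iff\<close>)

lemma monom_eval_below:
  "\<alpha> \<in> vars_below m \<Longrightarrow> monom_eval x \<alpha> = (\<Prod>i<m. x i powi Poly_Mapping.lookup \<alpha> i)"
  by (rule monom_eval_superset) (auto simp: vars_below_def)

lemma monom_eval_0 [simp]: "monom_eval x 0 = 1"
  by (simp add: monom_eval_def)

lemma monom_eval_add:
  assumes "\<And>i. i < m \<Longrightarrow> x i \<noteq> 0" "\<alpha> \<in> vars_below m" "\<beta> \<in> vars_below m"
  shows "monom_eval x (\<alpha> + \<beta>) = monom_eval x \<alpha> * monom_eval x \<beta>"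
  using assms by (simp add: monom_eval_below[of _ m] vars_below_add lookup_add power_int_add
      flip: prod.distrib)

lemma monom_eval_nonzero:
  "\<lbrakk>\<And>i. i < m \<Longrightarrow> x i \<noteq> 0; \<alpha> \<in> vars_below m\<rbrakk> \<Longrightarrow> monom_eval x \<alpha> \<noteq> 0"
  by (simp add: monom_eval_below)

lemma monom_eval_single [simp]: "monom_eval x (Poly_Mapping.single i 1) = x i"
  by (simp add: monom_eval_def)

lemma leval_superset:
  assumes "field_hom c" "finite S" "Poly_Mapping.keys f \<subseteq> S"
  shows "leval c f x = (\<Sum>\<alpha>\<in>S. c (Poly_Mapping.lookup f \<alpha>) * monom_eval x \<alpha>)"
  unfolding leval_def
  by (rule sum.mono_neutral_left) (use assms in \<open>auto simp: in_keys_iff field_hom_def\<close>)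

lemma leval_0 [simp]: "leval c 0 x = 0"
  by (simp add: leval_def)

lemma leval_single: "field_hom c \<Longrightarrow> leval c (Poly_Mapping.single \<alpha> a) x = c a * monom_eval x \<alpha>"
  by (cases "a = 0") (auto simp: leval_def field_hom_def)

lemma leval_1 [simp]: "field_hom c \<Longrightarrow> leval c 1 x = 1"
  using leval_single[of c 0 1 x] by (simp add: field_hom_def)

lemma leval_add:
  assumes "field_hom c"
  shows "leval c (f + g) x = leval c f x + leval c g x"
proof -
  let ?S = "Poly_Mapping.keys f \<union> Poly_Mapping.keys g"
  have "leval c h x = (\<Sum>\<alpha>\<in>?S. c (Poly_Mapping.lookup h \<alpha>) * monom_eval x \<alpha>)"
    if "h \<in> {f, g, f + g}" for h
    using that Poly_Mapping.keys_add[of f g] assms by (intro leval_superset) auto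
  then show ?thesis
    using assms by (simp add: lookup_add field_hom_def distrib_right sum.distrib)
qed

lemma leval_uminus: "field_hom c \<Longrightarrow> leval c (- f) x = - leval c f x"
  using leval_add[of c f "- f" x] by (simp add: minus_unique)

lemma leval_diff: "field_hom c \<Longrightarrow> leval c (f - g) x = leval c f x - leval c g x"
  using leval_add[of c f "- g" x] leval_uminus[of c g x] by simp

lemma leval_sum: "field_hom c \<Longrightarrow> leval c (sum f I) x = (\<Sum>i\<in>I. leval c (f i) x)"
  by (induction I rule: infinite_finite_induct) (auto simp: leval_add)

text \<open>Multiplicativity fails at a zero coordinate, where
  \<open>0 powi (- 1) * 0 powi 1 = 0\<close> but \<open>0 powi 0 = 1\<close>. Hence the
  non-vanishing hypothesis on \<open>x\<close>, here and in what is built on it.\<close>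

lemma leval_mult:
  assumes c: "field_hom c" and x: "\<And>i. i < m \<Longrightarrow> x i \<noteq> 0" and f: "f \<in> laurent m" and g: "g \<in> laurent m"
  shows "leval c (f * g) x = leval c f x * leval c g x"
proof -
  let ?l = "\<lambda>f \<alpha>. Poly_Mapping.single \<alpha> (Poly_Mapping.lookup f \<alpha>)"
  let ?F = "Poly_Mapping.keys f" and ?G = "Poly_Mapping.keys g"
  have "f * g = (\<Sum>\<alpha>\<in>?F. \<Sum>\<beta>\<in>?G. ?l f \<alpha> * ?l g \<beta>)"
    by (subst (1) poly_mapping_sum_single[of f], subst (1) poly_mapping_sum_single[of g])
      (simp add: sum_product)
  then have "leval c (f * g) x = (\<Sum>\<alpha>\<in>?F. \<Sum>\<beta>\<in>?G. leval c (?l f \<alpha> * ?l g \<beta>) x)"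
    using c by (simp add: leval_sum)
  also have "\<dots> = (\<Sum>\<alpha>\<in>?F. \<Sum>\<beta>\<in>?G. (c (Poly_Mapping.lookup f \<alpha>) * monom_eval x \<alpha>) *
      (c (Poly_Mapping.lookup g \<beta>) * monom_eval x \<beta>))"
  proof (intro sum.cong refl)
    fix \<alpha> \<beta> assume "\<alpha> \<in> ?F" "\<beta> \<in> ?G"
    then have "monom_eval x (\<alpha> + \<beta>) = monom_eval x \<alpha> * monom_eval x \<beta>"
      using f g x by (intro monom_eval_add[of m]) (auto simp: laurent_iff)
    then show "leval c (?l f \<alpha> * ?l g \<beta>) x = (c (Poly_Mapping.lookup f \<alpha>) * monom_eval x \<alpha>) *
      (c (Poly_Mapping.lookup g \<beta>) * monom_eval x \<beta>)"
      using c by (simp add: mult_single leval_single) (simp add: field_hom_def mult_ac)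
  qed
  also have "\<dots> = leval c f x * leval c g x"
    by (simp add: leval_def sum_product)
  finally show ?thesis .
qed

lemma leval_prod:
  assumes "field_hom c" "\<And>i. i < m \<Longrightarrow> x i \<noteq> 0" "\<And>i. i \<in> I \<Longrightarrow> f i \<in> laurent m"
  shows "leval c (prod f I) x = (\<Prod>i\<in>I. leval c (f i) x)"
  using assms(3)
  by (induction I rule: infinite_finite_induct)
    (use assms(1,2) in \<open>auto simp: leval_mult[of c m] laurent_prod\<close>)

lemma leval_cong_below:
  assumes "f \<in> laurent m" "\<And>i. i < m \<Longrightarrow> x i = y i"
  shows "leval c f x = leval c f y"
  unfolding leval_def
proof (intro sum.cong refl arg_cong2[of _ _ _ _ "(*)"])
  fix \<alpha> assume "\<alpha> \<in> Poly_Mapping.keys f"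
  then have "\<alpha> \<in> vars_below m"
    using assms(1) by (auto simp: laurent_iff)
  then show "monom_eval x \<alpha> = monom_eval y \<alpha>"
    using assms(2) by (simp add: monom_eval_below)
qed

section \<open>Monomial substitutions\<close>

text \<open>For \<open>\<tau> = frag_extend a\<close>, the additive extension of \<open>a\<close>,
  this is the pullback of \<open>h\<close> along the monomial map with exponents \<open>a j\<close>.
  Coefficients of colliding exponents are added, hence the injectivity in
  \<open>lookup_push\<close>.\<close>

definition push :: "((nat \<Rightarrow>\<^sub>0 int) \<Rightarrow> (nat \<Rightarrow>\<^sub>0 int)) \<Rightarrow> 'k::field laurent_poly \<Rightarrow> 'k laurent_poly" where
  "push \<tau> h = (\<Sum>\<beta>\<in>Poly_Mapping.keys h. Poly_Mapping.single (\<tau> \<beta>) (Poly_Mapping.lookup h \<beta>))"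

lemma lookup_push_eq_0: "\<alpha> \<notin> \<tau> ` Poly_Mapping.keys h \<Longrightarrow> Poly_Mapping.lookup (push \<tau> h) \<alpha> = 0"
  unfolding push_def lookup_sum by (intro sum.neutral) (auto simp: lookup_single when_def)

lemma lookup_push:
  assumes "inj_on \<tau> (Poly_Mapping.keys h)" "\<beta> \<in> Poly_Mapping.keys h"
  shows "Poly_Mapping.lookup (push \<tau> h) (\<tau> \<beta>) = Poly_Mapping.lookup h \<beta>"
proof -
  have "Poly_Mapping.lookup (push \<tau> h) (\<tau> \<beta>)
      = (\<Sum>\<gamma>\<in>Poly_Mapping.keys h. if \<gamma> = \<beta> then Poly_Mapping.lookup h \<gamma> else 0)"
    unfolding push_def lookup_sum
    by (intro sum.cong refl) (use assms in \<open>auto simp: lookup_single when_def inj_on_def\<close>)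
  then show ?thesis
    using assms by simp
qed

lemma push_laurent:
  "(\<And>\<beta>. \<beta> \<in> Poly_Mapping.keys h \<Longrightarrow> \<tau> \<beta> \<in> vars_below m) \<Longrightarrow> push \<tau> h \<in> laurent m"
  unfolding push_def by (intro laurent_sum laurent_single)

lemma leval_push:
  "field_hom c \<Longrightarrow> leval c (push \<tau> h) x
    = (\<Sum>\<beta>\<in>Poly_Mapping.keys h. c (Poly_Mapping.lookup h \<beta>) * monom_eval x (\<tau> \<beta>))"
  by (simp add: push_def leval_sum leval_single)

lemma frag_extend_vars_below:
  assumes "\<beta> \<in> vars_below d" "\<And>j. j < d \<Longrightarrow> a j \<in> vars_below n"
  shows "frag_extend a \<beta> \<in> vars_below n"
  using assms keys_frag_extend[of a \<beta>] unfolding vars_below_def by blast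

lemma lookup_frag_extend:
  assumes "\<beta> \<in> vars_below d"
  shows "Poly_Mapping.lookup (frag_extend a \<beta>) i
    = (\<Sum>j<d. Poly_Mapping.lookup \<beta> j * Poly_Mapping.lookup (a j) i)"
  unfolding frag_extend_def lookup_sum
  using assms by (auto simp: in_keys_iff vars_below_def intro!: sum.mono_neutral_left)

lemma monom_eval_frag_extend:
  assumes x: "\<And>i. i < n \<Longrightarrow> x i \<noteq> 0" and \<beta>: "\<beta> \<in> vars_below d" and a: "\<And>j. j < d \<Longrightarrow> a j \<in> vars_below n"
  shows "monom_eval x (frag_extend a \<beta>) = monom_eval (\<lambda>j. monom_eval x (a j)) \<beta>"
proof -
  have sum: "y powi (sum f I) = (\<Prod>j\<in>I. y powi f j)" if "y \<noteq> 0" for y :: 'a and f and I :: "nat set"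
    using that by (induction I rule: infinite_finite_induct) (auto simp: power_int_add)
  have prod: "(prod f I) powi k = (\<Prod>i\<in>I. f i powi k)" for f :: "nat \<Rightarrow> 'a" and I k
    by (induction I rule: infinite_finite_induct) (auto simp: power_int_mult_distrib)
  have "frag_extend a \<beta> \<in> vars_below n"
    using \<beta> a by (rule frag_extend_vars_below)
  then have "monom_eval x (frag_extend a \<beta>)
      = (\<Prod>i<n. \<Prod>j<d. x i powi (Poly_Mapping.lookup \<beta> j * Poly_Mapping.lookup (a j) i))"
    using x by (simp add: monom_eval_below lookup_frag_extend[OF \<beta>] sum)
  also have "\<dots> = (\<Prod>j<d. monom_eval x (a j) powi Poly_Mapping.lookup \<beta> j)"
  proof (subst prod.swap, intro prod.cong refl)
    fix j assume "j \<in> {..<d}"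
    then have "a j \<in> vars_below n"
      using a by simp
    then show "(\<Prod>i<n. x i powi (Poly_Mapping.lookup \<beta> j * Poly_Mapping.lookup (a j) i))
        = monom_eval x (a j) powi Poly_Mapping.lookup \<beta> j"
      by (simp add: monom_eval_below[of _ n] prod mult.commute[of "Poly_Mapping.lookup \<beta> j"] power_int_mult)
  qed
  finally show ?thesis
    using \<beta> by (simp add: monom_eval_below)
qed

lemma leval_push_frag_extend:
  assumes "field_hom c" "\<And>i. i < n \<Longrightarrow> x i \<noteq> 0" "h \<in> laurent d" "\<And>j. j < d \<Longrightarrow> a j \<in> vars_below n"
  shows "leval c (push (frag_extend a) h) x = leval c h (\<lambda>j. monom_eval x (a j))"
proof -
  have "monom_eval x (frag_extend a \<beta>) = monom_eval (\<lambda>j. monom_eval x (a j)) \<beta>"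
    if "\<beta> \<in> Poly_Mapping.keys h" for \<beta>
    using that assms by (intro monom_eval_frag_extend[where n=n and d=d]) (auto simp: laurent_iff)
  then show ?thesis
    using assms(1) by (simp add: leval_push) (simp add: leval_def)
qed

section \<open>Rational functions and their values\<close>

definition const_fun :: "'k::field \<Rightarrow> 'k rational_fun" where
  "const_fun a = Fract (Poly_Mapping.single 0 a) 1"

definition coord_fun :: "nat \<Rightarrow> 'k::field rational_fun" where
  "coord_fun i = Fract (Poly_Mapping.single (Poly_Mapping.single i 1) 1) 1"

lemma single_eq_0_iff [simp]: "Poly_Mapping.single \<alpha> a = 0 \<longleftrightarrow> a = 0"
  by (metis lookup_single_eq lookup_zero single_zero)

lemma field_hom_const_fun: "field_hom const_fun"
  by (simp add: field_hom_def const_fun_def One_fract_def Zero_fract_def single_add mult_single)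

lemma const_fun_0 [simp]: "const_fun 0 = 0"
  and const_fun_1 [simp]: "const_fun 1 = 1"
  and const_fun_uminus: "const_fun (- a) = - const_fun a"
  by (simp_all add: field_hom_uminus[OF field_hom_const_fun])
    (simp_all add: const_fun_def Zero_fract_def One_fract_def)

lemma rational_funs_laurent: "f \<in> laurent m \<Longrightarrow> Fract f 1 \<in> rational_funs m"
  unfolding rational_funs_def by force

lemma rational_funs_const [simp]: "const_fun a \<in> rational_funs m"
  unfolding const_fun_def by (intro rational_funs_laurent laurent_single) simp

lemma rational_funs_coord: "i < m \<Longrightarrow> coord_fun i \<in> rational_funs m"
  unfolding coord_fun_def
  by (intro rational_funs_laurent laurent_single) (simp add: vars_below_def)

lemma coord_fun_nonzero [simp]: "coord_fun i \<noteq> 0"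
  by (simp add: coord_fun_def Zero_fract_def eq_fract)

lemma rational_funsE:
  assumes "q \<in> rational_funs m"
  obtains f h where "f \<in> laurent m" "h \<in> laurent m" "h \<noteq> 0" "q = Fract f h"
  using assms unfolding rational_funs_def by blast

lemma rational_funsI: "f \<in> laurent m \<Longrightarrow> h \<in> laurent m \<Longrightarrow> h \<noteq> 0 \<Longrightarrow> Fract f h \<in> rational_funs m"
  unfolding rational_funs_def by blast

lemma rational_funs_0 [simp]: "0 \<in> rational_funs m"
  using rational_funs_laurent[of 0 m] by (simp add: Zero_fract_def)

lemma rational_funs_1 [simp]: "1 \<in> rational_funs m"
  using rational_funs_laurent[of 1 m] by (simp add: One_fract_def)

lemma rational_funs_mono: "q \<in> rational_funs m \<Longrightarrow> m \<le> m' \<Longrightarrow> q \<in> rational_funs m'"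
  unfolding rational_funs_def using laurent_mono by blast

lemma rational_funs_add:
  assumes "q \<in> rational_funs m" "r \<in> rational_funs m"
  shows "q + r \<in> rational_funs m"
proof -
  obtain f h f' h' where "f \<in> laurent m" "h \<in> laurent m" "h \<noteq> 0" "q = Fract f h"
      "f' \<in> laurent m" "h' \<in> laurent m" "h' \<noteq> 0" "r = Fract f' h'"
    using assms by (elim rational_funsE)
  then show ?thesis
    by (auto intro!: rational_funsI laurent_add laurent_mult)
qed

lemma rational_funs_mult:
  assumes "q \<in> rational_funs m" "r \<in> rational_funs m"
  shows "q * r \<in> rational_funs m"
proof -
  obtain f h f' h' where "f \<in> laurent m" "h \<in> laurent m" "h \<noteq> 0" "q = Fract f h"
      "f' \<in> laurent m" "h' \<in> laurent m" "h' \<noteq> 0" "r = Fract f' h'"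
    using assms by (elim rational_funsE)
  then show ?thesis
    by (auto intro!: rational_funsI laurent_mult)
qed

lemma rational_funs_inverse:
  assumes "q \<in> rational_funs m"
  shows "inverse q \<in> rational_funs m"
proof -
  obtain f h where fh: "f \<in> laurent m" "h \<in> laurent m" "h \<noteq> 0" "q = Fract f h"
    using assms by (elim rational_funsE)
  show ?thesis
  proof (cases "f = 0")
    case True
    then show ?thesis
      using fh by (simp add: fract_collapse)
  next
    case False
    then show ?thesis
      using fh by (auto intro: rational_funsI)
  qed
qed

lemma rational_funs_divide:
  "q \<in> rational_funs m \<Longrightarrow> r \<in> rational_funs m \<Longrightarrow> q / r \<in> rational_funs m"
  by (simp add: divide_inverse rational_funs_mult rational_funs_inverse)

lemma rational_funs_uminus: "q \<in> rational_funs m \<Longrightarrow> - q \<in> rational_funs m"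
  using rational_funs_mult[OF rational_funs_const[of "- 1"], of q m]
  by (simp add: const_fun_uminus)

lemma rational_funs_diff:
  "q \<in> rational_funs m \<Longrightarrow> r \<in> rational_funs m \<Longrightarrow> q - r \<in> rational_funs m"
  using rational_funs_add[of q m "- r"] by (simp add: rational_funs_uminus)

lemma rational_funs_sum: "(\<And>i. i \<in> I \<Longrightarrow> q i \<in> rational_funs m) \<Longrightarrow> sum q I \<in> rational_funs m"
  by (induction I rule: infinite_finite_induct) (auto intro: rational_funs_add)

lemma rational_funs_prod: "(\<And>i. i \<in> I \<Longrightarrow> q i \<in> rational_funs m) \<Longrightarrow> prod q I \<in> rational_funs m"
  by (induction I rule: infinite_finite_induct) (auto intro: rational_funs_mult)

lemma rational_funs_powi:
  assumes "q \<in> rational_funs m"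
  shows "q powi k \<in> rational_funs m"
proof -
  have "r ^ j \<in> rational_funs m" if "r \<in> rational_funs m" for r :: "'a rational_fun" and j
    using that by (induction j) (auto intro: rational_funs_mult)
  then show ?thesis
    using assms by (simp add: power_int_def rational_funs_inverse)
qed

lemma rational_funs_monom_eval:
  "\<alpha> \<in> vars_below n \<Longrightarrow> (\<And>i. i < n \<Longrightarrow> \<phi> i \<in> rational_funs m) \<Longrightarrow> monom_eval \<phi> \<alpha> \<in> rational_funs m"
  by (auto simp: monom_eval_below intro!: rational_funs_prod rational_funs_powi)

lemma rational_funs_leval:
  assumes "f \<in> laurent n" "\<And>i. i < n \<Longrightarrow> \<phi> i \<in> rational_funs m"
  shows "leval const_fun f \<phi> \<in> rational_funs m"
  unfolding leval_def
  by (intro rational_funs_sum rational_funs_mult rational_funs_monom_eval[where n=n] rational_funs_const)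
    (use assms in \<open>auto simp: laurent_iff\<close>)

text \<open>
  \<open>place c m x\<close> is the partial ring homomorphism from the rational functions in \<open>m\<close> variables
  that extends evaluation at \<open>x\<close>. Working with it as a relation avoids any choice of fractions.
\<close>

definition place ::
    "('k::field \<Rightarrow> 'l::field) \<Rightarrow> nat \<Rightarrow> (nat \<Rightarrow> 'l) \<Rightarrow> 'k rational_fun \<Rightarrow> 'l \<Rightarrow> bool" where
  "place c m x q y \<longleftrightarrow> (\<exists>f h. f \<in> laurent m \<and> h \<in> laurent m \<and> q = Fract f h \<and>
     leval c h x \<noteq> 0 \<and> y = leval c f x / leval c h x)"

context
  fixes c :: "'k::field \<Rightarrow> 'l::field" and m :: nat and x :: "nat \<Rightarrow> 'l"
  assumes c: "field_hom c" and x: "\<And>i. i < m \<Longrightarrow> x i \<noteq> 0"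
begin

lemma place_unique:
  assumes "place c m x q y" "place c m x q y'"
  shows "y = y'"
proof -
  obtain f h where fh: "f \<in> laurent m" "h \<in> laurent m" "q = Fract f h" "leval c h x \<noteq> 0"
      "y = leval c f x / leval c h x"
    using assms(1) unfolding place_def by blast
  obtain f' h' where fh': "f' \<in> laurent m" "h' \<in> laurent m" "q = Fract f' h'" "leval c h' x \<noteq> 0"
      "y' = leval c f' x / leval c h' x"
    using assms(2) unfolding place_def by blast
  have "h \<noteq> 0" "h' \<noteq> 0"
    using fh(4) fh'(4) by auto
  then have "f * h' = f' * h"
    using fh fh' by (simp add: eq_fract)
  then have "leval c (f * h') x = leval c (f' * h) x"
    by simp
  then have "leval c f x * leval c h' x = leval c f' x * leval c h x"
    using fh fh' by (simp add: leval_mult[OF c x])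
  then show ?thesis
    using fh fh' by (simp add: frac_eq_eq)
qed

lemma place_laurent: "f \<in> laurent m \<Longrightarrow> place c m x (Fract f 1) (leval c f x)"
  unfolding place_def using c by (intro exI[of _ f] exI[of _ 1]) simp

lemma place_const: "place c m x (const_fun a) (c a)"
  using place_laurent[of "Poly_Mapping.single 0 a"] c
  by (simp add: const_fun_def leval_single laurent_single)

lemma place_0: "place c m x 0 0"
  using place_const[of 0] c by (simp add: field_hom_def)

lemma place_1: "place c m x 1 1"
  using place_const[of 1] c by (simp add: field_hom_def)

lemma place_add:
  assumes "place c m x q y" "place c m x r z"
  shows "place c m x (q + r) (y + z)"
proof -
  obtain f h where fh: "f \<in> laurent m" "h \<in> laurent m" "q = Fract f h" "leval c h x \<noteq> 0"
      "y = leval c f x / leval c h x"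
    using assms(1) unfolding place_def by blast
  obtain f' h' where fh': "f' \<in> laurent m" "h' \<in> laurent m" "r = Fract f' h'" "leval c h' x \<noteq> 0"
      "z = leval c f' x / leval c h' x"
    using assms(2) unfolding place_def by blast
  have "h \<noteq> 0" "h' \<noteq> 0"
    using fh(4) fh'(4) by auto
  with fh fh' show ?thesis
    unfolding place_def
    by (intro exI[of _ "f * h' + f' * h"] exI[of _ "h * h'"])
      (auto simp: leval_mult[OF c x] leval_add[OF c] laurent_mult add_frac_eq intro!: laurent_add)
qed

lemma place_mult:
  assumes "place c m x q y" "place c m x r z"
  shows "place c m x (q * r) (y * z)"
proof -
  obtain f h where fh: "f \<in> laurent m" "h \<in> laurent m" "q = Fract f h" "leval c h x \<noteq> 0"
      "y = leval c f x / leval c h x"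
    using assms(1) unfolding place_def by blast
  obtain f' h' where fh': "f' \<in> laurent m" "h' \<in> laurent m" "r = Fract f' h'" "leval c h' x \<noteq> 0"
      "z = leval c f' x / leval c h' x"
    using assms(2) unfolding place_def by blast
  from fh fh' show ?thesis
    unfolding place_def
    by (intro exI[of _ "f * f'"] exI[of _ "h * h'"]) (auto simp: leval_mult[OF c x] laurent_mult)
qed

lemma place_inverse:
  assumes "place c m x q y" "y \<noteq> 0"
  shows "place c m x (inverse q) (inverse y)"
proof -
  obtain f h where "f \<in> laurent m" "h \<in> laurent m" "q = Fract f h" "leval c h x \<noteq> 0"
      "y = leval c f x / leval c h x"
    using assms(1) unfolding place_def by blast
  with assms(2) show ?thesis
    unfolding place_def by (intro exI[of _ h] exI[of _ f]) auto
qed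

lemma place_uminus: "place c m x q y \<Longrightarrow> place c m x (- q) (- y)"
  using place_mult[OF place_const[of "- 1"], of q y] c field_hom_uminus[OF c, of 1]
  by (simp add: const_fun_uminus field_hom_def)

lemma place_diff: "place c m x q y \<Longrightarrow> place c m x r z \<Longrightarrow> place c m x (q - r) (y - z)"
  using place_add[of q y "- r" "- z"] place_uminus[of r z] by simp

lemma place_sum:
  "(\<And>i. i \<in> I \<Longrightarrow> place c m x (q i) (y i)) \<Longrightarrow> place c m x (sum q I) (sum y I)"
  by (induction I rule: infinite_finite_induct) (auto intro: place_add place_0)

lemma place_prod:
  "(\<And>i. i \<in> I \<Longrightarrow> place c m x (q i) (y i)) \<Longrightarrow> place c m x (prod q I) (prod y I)"
  by (induction I rule: infinite_finite_induct) (auto intro: place_mult place_1)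

lemma place_powi:
  assumes "place c m x q y" "y \<noteq> 0"
  shows "place c m x (q powi k) (y powi k)"
proof -
  have "place c m x (r ^ j) (z ^ j)" if "place c m x r z" for r z j
    using that by (induction j) (auto intro: place_mult place_1)
  then show ?thesis
    using assms by (simp add: power_int_def place_inverse)
qed

lemma place_monom_eval:
  assumes "\<alpha> \<in> vars_below n" "\<And>i. i < n \<Longrightarrow> place c m x (\<phi> i) (y i)" "\<And>i. i < n \<Longrightarrow> y i \<noteq> 0"
  shows "place c m x (monom_eval \<phi> \<alpha>) (monom_eval y \<alpha>)"
  using assms by (auto simp: monom_eval_below intro!: place_prod place_powi)

lemma place_leval:
  assumes "f \<in> laurent n" "\<And>i. i < n \<Longrightarrow> place c m x (\<phi> i) (y i)" "\<And>i. i < n \<Longrightarrow> y i \<noteq> 0"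
  shows "place c m x (leval const_fun f \<phi>) (leval c f y)"
  unfolding leval_def
  by (intro place_sum place_mult place_const place_monom_eval[where n=n])
    (use assms in \<open>auto simp: laurent_iff\<close>)

end

text \<open>The tuple \<open>coord_fun\<close> is the generic point of the torus: a polynomial
  relation that holds there is an identity of polynomials.\<close>

lemma leval_coord_fun:
  assumes "f \<in> laurent m"
  shows "leval const_fun f coord_fun = Fract f 1"
proof -
  have pow: "Fract (Poly_Mapping.single (Poly_Mapping.single i 1) (1::'a)) 1 ^ k
      = Fract (Poly_Mapping.single (Poly_Mapping.single i (int k)) 1) 1" for i k
    by (induction k) (simp_all add: One_fract_def mult_single single_add[symmetric])
  have powi: "coord_fun i powi k = Fract (Poly_Mapping.single (Poly_Mapping.single i k) (1::'a)) 1" for i k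
  proof (cases k rule: int_cases2)
    case (nonneg j)
    then show ?thesis
      by (simp add: coord_fun_def pow)
  next
    case (nonpos j)
    then show ?thesis
      by (simp add: coord_fun_def power_int_minus pow eq_fract mult_single flip: single_add)
  qed
  have "monom_eval coord_fun \<alpha> = Fract (Poly_Mapping.single \<alpha> (1::'a)) 1" for \<alpha>
  proof -
    have "(\<Prod>i\<in>I. coord_fun i powi Poly_Mapping.lookup \<alpha> i)
        = Fract (Poly_Mapping.single (\<Sum>i\<in>I. Poly_Mapping.single i (Poly_Mapping.lookup \<alpha> i)) (1::'a)) 1"
      if "finite I" for I
      using that by induction (simp_all add: powi One_fract_def mult_single)
    from this[of "Poly_Mapping.keys \<alpha>"] show ?thesis
      unfolding monom_eval_def by (subst (3) poly_mapping_sum_single[of \<alpha>]) simp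
  qed
  then have "leval const_fun f coord_fun
      = (\<Sum>\<alpha>\<in>Poly_Mapping.keys f. Fract (Poly_Mapping.single \<alpha> (Poly_Mapping.lookup f \<alpha>)) 1)"
    by (simp add: leval_def const_fun_def mult_single)
  also have "\<dots> = Fract (\<Sum>\<alpha>\<in>Poly_Mapping.keys f. Poly_Mapping.single \<alpha> (Poly_Mapping.lookup f \<alpha>)) 1"
  proof -
    have "(\<Sum>\<alpha>\<in>I. Fract (g \<alpha>) 1) = Fract (sum g I) 1" if "finite I" for I and g :: "(nat \<Rightarrow>\<^sub>0 int) \<Rightarrow> 'a laurent_poly"
      using that by induction (simp_all add: Zero_fract_def)
    then show ?thesis
      by simp
  qed
  also have "\<dots> = Fract f 1"
    by (subst (2) poly_mapping_sum_single[of f]) simp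
  finally show ?thesis .
qed

section \<open>Laurent polynomials have non-zeros on the torus\<close>

text \<open>In a finite field, the product of all \<open>X - a\<close>, plus 1, would have positive
  degree and no root.\<close>

lemma infinite_alg_closed: "infinite (UNIV :: 'k::alg_closed_field set)"
proof
  assume fin: "finite (UNIV :: 'k set)"
  define p where "p = (\<Prod>a\<in>(UNIV :: 'k set). [:- a, 1:]) + 1"
  have "degree (\<Prod>a\<in>(UNIV :: 'k set). [:- a, 1:]) = card (UNIV :: 'k set)"
    by (subst degree_prod_eq_sum_degree) auto
  moreover have "card (UNIV :: 'k set) > 0"
    using fin by (simp add: card_gt_0_iff)
  ultimately have "degree p > 0"
    unfolding p_def by (subst degree_add_eq_left) auto
  then obtain z where "poly p z = 0"
    using alg_closed_imp_poly_has_root by blast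
  moreover have "(\<Prod>a\<in>(UNIV :: 'k set). z - a) = 0"
    using fin by (subst prod_zero_iff) auto
  ultimately show False
    by (simp add: p_def poly_prod)
qed

text \<open>The Kronecker substitution \<open>x\<^sub>i = z ^ (N ^ i)\<close> separates finitely many exponents.\<close>

lemma ex_separating_base:
  assumes "finite E" "E \<subseteq> vars_below m"
  shows "\<exists>N::nat. inj_on (\<lambda>\<alpha>. \<Sum>i<m. Poly_Mapping.lookup \<alpha> i * int N ^ i) E"
proof -
  define P where "P \<alpha> = (\<Sum>i<m. monom (Poly_Mapping.lookup \<alpha> i) i)" for \<alpha> :: "nat \<Rightarrow>\<^sub>0 int"
  have poly_P: "poly (P \<alpha>) z = (\<Sum>i<m. Poly_Mapping.lookup \<alpha> i * z ^ i)" for \<alpha> z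
    by (simp add: P_def poly_sum poly_monom)
  have inj_P: "\<alpha> = \<beta>" if "P \<alpha> = P \<beta>" "\<alpha> \<in> vars_below m" "\<beta> \<in> vars_below m" for \<alpha> \<beta>
  proof (rule poly_mapping_eqI)
    fix i
    show "Poly_Mapping.lookup \<alpha> i = Poly_Mapping.lookup \<beta> i"
    proof (cases "i < m")
      case True
      have "coeff (P \<gamma>) i = Poly_Mapping.lookup \<gamma> i" for \<gamma>
        using True by (simp add: P_def coeff_sum)
      then show ?thesis
        using that(1) by metis
    next
      case False
      then show ?thesis
        using that unfolding vars_below_def by (metis in_keys_iff lessThan_iff mem_Collect_eq subset_iff)
    qed
  qed
  \<comment> \<open>Read as a polynomial in the base, the exponent sum has the coordinates of
    \<alpha> as coefficients, so two distinct exponents collide for finitely many bases only;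
    \<open>B\<close> collects these.\<close>
  define B where "B = (\<Union>\<alpha>\<in>E. \<Union>\<beta>\<in>E - {\<alpha>}. {z. poly (P \<alpha> - P \<beta>) z = 0})"
  have "finite B"
    unfolding B_def
  proof (intro finite_UN_I poly_roots_finite)
    fix \<alpha> \<beta> assume "\<alpha> \<in> E" "\<beta> \<in> E - {\<alpha>}"
    then show "P \<alpha> - P \<beta> \<noteq> 0"
      using inj_P[of \<alpha> \<beta>] assms(2) by auto
  qed (use assms in auto)
  then have "finite (int -` B)"
    by (intro finite_vimageI) auto
  then obtain N where "int N \<notin> B"
    using ex_new_if_finite[of "int -` B"] by auto
  then show ?thesis
    by (intro exI[of _ N]) (auto simp: inj_on_def B_def poly_P)
qed

text \<open>The Kronecker substitution keeps every coefficient of \<open>f\<close> and puts them in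
  distinct degrees. What remains is a non-zero polynomial in one variable, up to a power of that
  variable, and an infinite field contains a non-root of it other than 0.\<close>

lemma ex_torus_leval_nonzero:
  fixes f :: "'k::alg_closed_field laurent_poly"
  assumes "f \<in> laurent m" "f \<noteq> 0"
  shows "\<exists>x\<in>torus m. leval (\<lambda>a. a) f x \<noteq> 0"
proof -
  let ?E = "Poly_Mapping.keys f"
  obtain N :: nat where inj: "inj_on (\<lambda>\<alpha>. \<Sum>i<m. Poly_Mapping.lookup \<alpha> i * int N ^ i) ?E"
    using ex_separating_base[of ?E m] assms by (auto simp: laurent_iff)
  define e where "e \<alpha> = (\<Sum>i<m. Poly_Mapping.lookup \<alpha> i * int N ^ i)" for \<alpha>
  \<comment> \<open>A common shift that makes all degrees non-negative; the sum of the absolute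
    values bounds each single one.\<close>
  define M where "M = (\<Sum>\<alpha>\<in>?E. \<bar>e \<alpha>\<bar>)"
  have eM: "e \<alpha> + M \<ge> 0" if "\<alpha> \<in> ?E" for \<alpha>
  proof -
    have "\<bar>e \<alpha>\<bar> \<le> M"
      unfolding M_def using that by (intro member_le_sum) auto
    then show ?thesis
      by linarith
  qed
  define p where "p = (\<Sum>\<alpha>\<in>?E. monom (Poly_Mapping.lookup f \<alpha>) (nat (e \<alpha> + M)))"
  obtain \<alpha>0 where \<alpha>0: "\<alpha>0 \<in> ?E"
    using assms(2) poly_mapping_eqI[of f 0] by (auto simp: in_keys_iff)
  have "coeff p (nat (e \<alpha>0 + M)) = (\<Sum>\<alpha>\<in>?E. if \<alpha> = \<alpha>0 then Poly_Mapping.lookup f \<alpha> else 0)"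
    unfolding p_def coeff_sum
  proof (intro sum.cong refl)
    fix \<alpha> assume \<alpha>: "\<alpha> \<in> ?E"
    have "nat (e \<alpha> + M) = nat (e \<alpha>0 + M) \<longleftrightarrow> \<alpha> = \<alpha>0"
      using eM[OF \<alpha>] eM[OF \<alpha>0] inj \<alpha> \<alpha>0 by (auto simp: inj_on_def e_def)
    then show "coeff (monom (Poly_Mapping.lookup f \<alpha>) (nat (e \<alpha> + M))) (nat (e \<alpha>0 + M))
        = (if \<alpha> = \<alpha>0 then Poly_Mapping.lookup f \<alpha> else 0)"
      by auto
  qed
  then have "p \<noteq> 0"
    using \<alpha>0 by (auto simp: in_keys_iff)
  then have "finite (insert 0 {z. poly p z = 0})"
    by (simp add: poly_roots_finite)
  then obtain z where z: "z \<noteq> 0" "poly p z \<noteq> 0"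
    using ex_new_if_finite[OF infinite_alg_closed] by blast
  define x where "x = (\<lambda>i\<in>{..<m}. z ^ (N ^ i))"
  have "poly p z = (\<Sum>\<alpha>\<in>?E. Poly_Mapping.lookup f \<alpha> * monom_eval x \<alpha> * z powi M)"
    unfolding p_def poly_sum poly_monom
  proof (intro sum.cong refl)
    fix \<alpha> assume \<alpha>: "\<alpha> \<in> ?E"
    have psum: "z powi (sum g I) = (\<Prod>i\<in>I. z powi g i)" for g and I :: "nat set"
      using z(1) by (induction I rule: infinite_finite_induct) (auto simp: power_int_add)
    have "monom_eval x \<alpha> = (\<Prod>i<m. (z ^ (N ^ i)) powi Poly_Mapping.lookup \<alpha> i)"
      using assms(1) \<alpha> by (subst monom_eval_below[of _ m]) (auto simp: laurent_iff x_def)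
    also have "\<dots> = z powi e \<alpha>"
      unfolding e_def psum by (intro prod.cong refl) (simp add: power_int_power mult.commute)
    finally have "monom_eval x \<alpha> * z powi M = z ^ nat (e \<alpha> + M)"
      using z(1) eM[OF \<alpha>] by (simp add: power_int_add[symmetric] power_int_nonneg_exp)
    then show "Poly_Mapping.lookup f \<alpha> * z ^ nat (e \<alpha> + M) = Poly_Mapping.lookup f \<alpha> * monom_eval x \<alpha> * z powi M"
      by (simp add: mult.assoc)
  qed
  then have "leval (\<lambda>a. a) f x \<noteq> 0"
    using z(2) by (auto simp: leval_def simp flip: sum_distrib_right)
  moreover have "x \<in> torus m"
    using z(1) by (simp add: x_def torus_def)
  ultimately show ?thesis
    by blast
qed

section \<open>Dominance in terms of vanishing ideals\<close>

lemma torus_nonzero: "x \<in> torus m \<Longrightarrow> i < m \<Longrightarrow> x i \<noteq> 0"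
  by (auto simp: torus_def)

lemma rational_eval_eq: "rational_eval m q x = (THE y. place (\<lambda>a. a) m x q y)"
  by (simp add: rational_eval_def place_def laurent_eval_eq_leval)

lemma place_imp_rational_eval:
  assumes "x \<in> torus m" "place (\<lambda>a. a) m x q y"
  shows "regular_at m q x" "rational_eval m q x = y"
proof -
  show "regular_at m q x"
    using assms(2) by (auto simp: place_def regular_at_def laurent_eval_eq_leval)
  show "rational_eval m q x = y"
    unfolding rational_eval_eq
    using assms place_unique[OF field_hom_id torus_nonzero[OF assms(1)]] by (intro the_equality) blast+
qed

lemma regular_at_imp_place:
  assumes "x \<in> torus m" "regular_at m q x"
  shows "place (\<lambda>a. a) m x q (rational_eval m q x)"
proof -
  obtain y where "place (\<lambda>a. a) m x q y"
    using assms(2) unfolding regular_at_def place_def laurent_eval_eq_leval by blast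
  then show ?thesis
    using place_imp_rational_eval[OF assms(1)] by metis
qed

lemma rat_domain_subset: "rat_domain m n \<phi> \<subseteq> torus m"
  by (auto simp: rat_domain_def)

lemma rat_apply_torus: "x \<in> rat_domain m n \<phi> \<Longrightarrow> rat_apply m n \<phi> x \<in> torus n"
  by (auto simp: rat_domain_def rat_apply_def torus_def)

lemma place_rat_apply:
  "x \<in> rat_domain m n \<phi> \<Longrightarrow> i < n \<Longrightarrow> place (\<lambda>a. a) m x (\<phi> i) (rat_apply m n \<phi> x i)"
  using regular_at_imp_place by (auto simp: rat_domain_def rat_apply_def)

lemma place_monom_eval_rat_apply:
  assumes "x \<in> rat_domain m n \<phi>" "\<alpha> \<in> vars_below n"
  shows "place (\<lambda>a. a) m x (monom_eval \<phi> \<alpha>) (monom_eval (rat_apply m n \<phi> x) \<alpha>)"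
  by (rule place_monom_eval[where n=n])
    (use assms torus_nonzero rat_domain_subset rat_apply_torus place_rat_apply field_hom_id in blast)+

lemma place_leval_rat_apply:
  assumes "x \<in> rat_domain m n \<phi>" "g \<in> laurent n"
  shows "place (\<lambda>a. a) m x (leval const_fun g \<phi>) (leval (\<lambda>a. a) g (rat_apply m n \<phi> x))"
  by (rule place_leval[where n=n])
    (use assms torus_nonzero rat_domain_subset rat_apply_torus place_rat_apply field_hom_id in blast)+

text \<open>The product of all numerators and denominators involved is a non-zero Laurent
  polynomial, since the ring is a domain; a point where it does not vanish is good for all the
  functions at once.\<close>

lemma ex_rat_domain_nonzero:
  fixes \<phi> :: "nat \<Rightarrow> 'k::alg_closed_field rational_fun"
  assumes \<phi>: "\<And>i. i < n \<Longrightarrow> \<phi> i \<in> rational_funs m" "\<And>i. i < n \<Longrightarrow> \<phi> i \<noteq> 0"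
    and q: "q \<in> rational_funs m" "q \<noteq> 0"
  shows "\<exists>x\<in>rat_domain m n \<phi>. \<exists>y. y \<noteq> 0 \<and> place (\<lambda>a. a) m x q y"
proof -
  have "\<exists>f h. f \<in> laurent m \<and> h \<in> laurent m \<and> r = Fract f h \<and> h \<noteq> 0 \<and> f \<noteq> 0"
    if "r \<in> rational_funs m" "r \<noteq> 0" for r :: "'k rational_fun"
    using that by (metis rational_funsE fract_collapse(1))
  then obtain f h where fh: "\<And>r :: 'k rational_fun. r \<in> rational_funs m \<Longrightarrow> r \<noteq> 0 \<Longrightarrow>
      f r \<in> laurent m \<and> h r \<in> laurent m \<and> r = Fract (f r) (h r) \<and> h r \<noteq> 0 \<and> f r \<noteq> 0"
    by metis
  define p where "p = (\<Prod>r\<in>insert q (\<phi> ` {..<n}). f r * h r)"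
  have "p \<in> laurent m" "p \<noteq> 0"
    unfolding p_def using \<phi> q fh by (auto intro!: laurent_prod laurent_mult)
  then obtain x where x: "x \<in> torus m" "leval (\<lambda>a. a) p x \<noteq> 0"
    using ex_torus_leval_nonzero by blast
  have "leval (\<lambda>a. a) p x = (\<Prod>r\<in>insert q (\<phi> ` {..<n}). leval (\<lambda>a. a) (f r * h r) x)"
    unfolding p_def using \<phi> q fh
    by (intro leval_prod[where m=m] laurent_mult) (auto simp: field_hom_id torus_nonzero[OF x(1)])
  then have "leval (\<lambda>a. a) (f r * h r) x \<noteq> 0" if "r \<in> insert q (\<phi> ` {..<n})" for r
    using x(2) that by auto
  then have nz: "leval (\<lambda>a. a) (f r) x \<noteq> 0 \<and> leval (\<lambda>a. a) (h r) x \<noteq> 0" if "r \<in> insert q (\<phi> ` {..<n})" for r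
    using leval_mult[OF field_hom_id, of m x "f r" "h r"] torus_nonzero[OF x(1)] fh \<phi> q that
    by fastforce
  have pl: "\<exists>y. y \<noteq> 0 \<and> place (\<lambda>a. a) m x r y" if "r \<in> insert q (\<phi> ` {..<n})" for r
  proof -
    have "r \<in> rational_funs m" "r \<noteq> 0"
      using that \<phi> q by auto
    then have "place (\<lambda>a. a) m x r (leval (\<lambda>a. a) (f r) x / leval (\<lambda>a. a) (h r) x)"
      unfolding place_def using fh nz[OF that] by blast
    then show ?thesis
      using nz[OF that] divide_eq_0_iff by blast
  qed
  have "x \<in> rat_domain m n \<phi>"
    unfolding rat_domain_def
  proof (intro CollectI conjI allI impI x(1))
    fix i assume "i < n"
    then obtain y where "y \<noteq> 0" "place (\<lambda>a. a) m x (\<phi> i) y"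
      using pl by blast
    then show "regular_at m (\<phi> i) x" "rational_eval m (\<phi> i) x \<noteq> 0"
      using place_imp_rational_eval[OF x(1)] by metis+
  qed
  moreover have "\<exists>y. y \<noteq> 0 \<and> place (\<lambda>a. a) m x q y"
    by (rule pl) simp
  ultimately show ?thesis by (intro bexI[of _ x])
qed

lemma rational_fun_eq_0I:
  fixes \<phi> :: "nat \<Rightarrow> 'k::alg_closed_field rational_fun"
  assumes "\<And>i. i < n \<Longrightarrow> \<phi> i \<in> rational_funs m" "\<And>i. i < n \<Longrightarrow> \<phi> i \<noteq> 0"
    and "q \<in> rational_funs m"
    and "\<And>x. x \<in> rat_domain m n \<phi> \<Longrightarrow> place (\<lambda>a. a) m x q 0"
  shows "q = 0"
proof (rule ccontr)
  assume "q \<noteq> 0"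
  then obtain x y where "x \<in> rat_domain m n \<phi>" "y \<noteq> 0" "place (\<lambda>a. a) m x q y"
    using ex_rat_domain_nonzero[of n \<phi> m q] assms by blast
  then show False
    using place_unique[OF field_hom_id, of m x q y 0] assms(4) torus_nonzero rat_domain_subset by blast
qed

text \<open>A non-zero rational function takes a non-zero value somewhere on the domain of \<phi>,
  so relations that hold pointwise on the image already hold between the rational functions
  themselves.\<close>

lemma leval_eq_0_iff_rat_apply:
  fixes \<phi> :: "nat \<Rightarrow> 'k::alg_closed_field rational_fun"
  assumes \<phi>: "\<And>i. i < n \<Longrightarrow> \<phi> i \<in> rational_funs m" "\<And>i. i < n \<Longrightarrow> \<phi> i \<noteq> 0"
    and g: "g \<in> laurent n"
  shows "leval const_fun g \<phi> = 0 \<longleftrightarrow>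
    (\<forall>x\<in>rat_domain m n \<phi>. leval (\<lambda>a. a) g (rat_apply m n \<phi> x) = 0)"
proof
  assume 0: "leval const_fun g \<phi> = 0"
  show "\<forall>x\<in>rat_domain m n \<phi>. leval (\<lambda>a. a) g (rat_apply m n \<phi> x) = 0"
  proof
    fix x assume x: "x \<in> rat_domain m n \<phi>"
    then have nz: "x i \<noteq> 0" if "i < m" for i
      using that torus_nonzero rat_domain_subset by blast
    have "place (\<lambda>a. a) m x 0 (leval (\<lambda>a. a) g (rat_apply m n \<phi> x))"
      using place_leval_rat_apply[OF x g] 0 by simp
    then show "leval (\<lambda>a. a) g (rat_apply m n \<phi> x) = 0"
      using nz by (intro place_unique[OF field_hom_id _ _ place_0[OF field_hom_id]])
  qed
next
  assume 0: "\<forall>x\<in>rat_domain m n \<phi>. leval (\<lambda>a. a) g (rat_apply m n \<phi> x) = 0"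
  show "leval const_fun g \<phi> = 0"
  proof (rule rational_fun_eq_0I[of n \<phi> m])
    show "leval const_fun g \<phi> \<in> rational_funs m"
      using g \<phi>(1) by (rule rational_funs_leval)
    show "place (\<lambda>a. a) m x (leval const_fun g \<phi>) 0" if "x \<in> rat_domain m n \<phi>" for x
      using place_leval_rat_apply[OF that g] 0 that by simp
  qed (use \<phi> in auto)
qed

text \<open>Turns dominance, a statement about the closure of an image, into the kernel of a
  substitution. In this form all dominant maps into X, from whatever torus, satisfy the same
  relations, which allows relations to be carried from one section to another.\<close>

lemma dominant_imp_vanishing_ideal:
  fixes \<phi> :: "nat \<Rightarrow> 'k::alg_closed_field rational_fun"
  assumes dom: "dominant_rational_map m (torus m) n X \<phi>" and g: "g \<in> laurent n"
  shows "leval const_fun g \<phi> = 0 \<longleftrightarrow> g \<in> vanishing_ideal n X"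
proof -
  let ?I = "rat_apply m n \<phi> ` rat_domain m n \<phi>"
  have "torus m \<inter> rat_domain m n \<phi> = rat_domain m n \<phi>"
    using rat_domain_subset by blast
  then have \<phi>: "\<And>i. i < n \<Longrightarrow> \<phi> i \<in> rational_funs m" "\<And>i. i < n \<Longrightarrow> \<phi> i \<noteq> 0"
    and im: "?I \<subseteq> X" "X \<subseteq> zariski_closure n ?I"
    using dom by (auto simp: dominant_rational_map_def rational_map_def)
  show ?thesis
  proof (subst leval_eq_0_iff_rat_apply[of n \<phi> m g]; (intro iffI)?)
    assume "\<forall>x\<in>rat_domain m n \<phi>. leval (\<lambda>a. a) g (rat_apply m n \<phi> x) = 0"
    then have "?I \<subseteq> zero_locus n {g}"
      using rat_apply_torus by (fastforce simp: zero_locus_def laurent_eval_eq_leval)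
    moreover have "zariski_closed n (zero_locus n {g})"
      using g by (auto simp: zariski_closed_def)
    ultimately have "X \<subseteq> zero_locus n {g}"
      using im(2) by (auto simp: zariski_closure_def)
    then show "g \<in> vanishing_ideal n X"
      using g by (auto simp: vanishing_ideal_def zero_locus_def)
  next
    assume "g \<in> vanishing_ideal n X"
    then show "\<forall>x\<in>rat_domain m n \<phi>. leval (\<lambda>a. a) g (rat_apply m n \<phi> x) = 0"
      using im(1) by (auto simp: vanishing_ideal_def laurent_eval_eq_leval)
  qed (use \<phi> g in auto)
qed

text \<open>The converse of \<open>dominant_imp_vanishing_ideal\<close>: a map built by substitution
  is shown dominant from its relations alone, without describing its image.\<close>

lemma dominantI:
  fixes \<phi> :: "nat \<Rightarrow> 'k::alg_closed_field rational_fun"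
  assumes X: "zariski_closed n X"
    and \<phi>: "\<And>i. i < n \<Longrightarrow> \<phi> i \<in> rational_funs m" "\<And>i. i < n \<Longrightarrow> \<phi> i \<noteq> 0"
    and ker: "\<And>g. g \<in> laurent n \<Longrightarrow> leval const_fun g \<phi> = 0 \<longleftrightarrow> g \<in> vanishing_ideal n X"
  shows "dominant_rational_map m (torus m) n X \<phi>"
proof -
  let ?I = "rat_apply m n \<phi> ` rat_domain m n \<phi>"
  have int: "torus m \<inter> rat_domain m n \<phi> = rat_domain m n \<phi>"
    using rat_domain_subset by blast
  have "rat_domain m n \<phi> \<noteq> {}"
    using ex_rat_domain_nonzero[of n \<phi> m 1] \<phi> by auto
  moreover have "?I \<subseteq> X"
  proof -
    obtain F where F: "F \<subseteq> laurent n" "X = zero_locus n F"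
      using X by (auto simp: zariski_closed_def)
    have "laurent_eval g y = 0" if "g \<in> F" "y \<in> ?I" for g y
    proof -
      have "g \<in> vanishing_ideal n X" "g \<in> laurent n"
        using F that(1) by (auto simp: vanishing_ideal_def zero_locus_def)
      then show ?thesis
        using that(2) ker leval_eq_0_iff_rat_apply[of n \<phi> m g] \<phi> by (auto simp: laurent_eval_eq_leval)
    qed
    then show ?thesis
      using F(2) rat_apply_torus by (auto simp: zero_locus_def)
  qed
  moreover have "X \<subseteq> zariski_closure n ?I"
    unfolding zariski_closure_def
  proof (intro Inter_greatest, clarify)
    fix C x assume C: "zariski_closed n C" "?I \<subseteq> C" and x: "x \<in> X"
    obtain F where F: "F \<subseteq> laurent n" "C = zero_locus n F"
      using C(1) by (auto simp: zariski_closed_def)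
    have "laurent_eval g x = 0" if "g \<in> F" for g
    proof -
      have "g \<in> laurent n" "leval const_fun g \<phi> = 0"
        using leval_eq_0_iff_rat_apply[of n \<phi> m g] \<phi> F C(2) that
        by (auto simp: zero_locus_def laurent_eval_eq_leval image_subset_iff)
      then show ?thesis
        using ker x by (auto simp: vanishing_ideal_def)
    qed
    moreover have "x \<in> torus n"
      using X x by (auto simp: zariski_closed_def zero_locus_def)
    ultimately show "x \<in> C"
      using F(2) by (simp add: zero_locus_def)
  qed
  ultimately show ?thesis
    unfolding dominant_rational_map_def rational_map_def int using \<phi> by auto
qed

section \<open>Sections of birational torus homomorphisms\<close>

text \<open>Monomials are regular and non-zero on the whole torus, so \<pi> after \<psi> is defined
  wherever \<psi> is, and the identity of points there becomes an identity of rational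
  functions.\<close>

lemma birational_torus_hom_section:
  fixes X :: "'k::alg_closed_field point set"
  assumes hom: "torus_hom n d \<pi>" and bir: "birational_map n X d (torus d) \<pi>"
  obtains a \<psi> where "\<And>j. j < d \<Longrightarrow> a j \<in> vars_below n"
    "\<And>j. j < d \<Longrightarrow> \<pi> j = Fract (Poly_Mapping.single (a j) 1) 1"
    "dominant_rational_map d (torus d) n X \<psi>"
    "\<And>j. j < d \<Longrightarrow> monom_eval \<psi> (a j) = coord_fun j"
proof -
  obtain a where a: "\<And>j. j < d \<Longrightarrow> a j \<in> vars_below n"
      "\<And>j. j < d \<Longrightarrow> \<pi> j = Fract (Poly_Mapping.single (a j) 1) 1"
    using hom unfolding torus_hom_def vars_below_def mem_Collect_eq by metis
  obtain \<psi> where dom: "dominant_rational_map d (torus d) n X \<psi>"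
    and inv: "\<And>y. y \<in> torus d \<inter> rat_domain d n \<psi> \<Longrightarrow> rat_apply d n \<psi> y \<in> rat_domain n d \<pi> \<Longrightarrow>
      rat_apply n d \<pi> (rat_apply d n \<psi> y) = y"
    using bir unfolding birational_map_def by blast
  have \<psi>: "\<And>i. i < n \<Longrightarrow> \<psi> i \<in> rational_funs d" "\<And>i. i < n \<Longrightarrow> \<psi> i \<noteq> 0"
    using dom by (auto simp: dominant_rational_map_def rational_map_def)
  have "monom_eval \<psi> (a j) - coord_fun j = 0" if j: "j < d" for j
  proof (rule rational_fun_eq_0I[of n \<psi> d])
    show "monom_eval \<psi> (a j) - coord_fun j \<in> rational_funs d"
      using j a(1) \<psi>(1) by (intro rational_funs_diff rational_funs_monom_eval[where n=n] rational_funs_coord)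
    fix y assume y: "y \<in> rat_domain d n \<psi>"
    define x where "x = rat_apply d n \<psi> y"
    have x: "x \<in> torus n" and yt: "y \<in> torus d"
      using y rat_apply_torus rat_domain_subset unfolding x_def by blast+
    have \<pi>: "place (\<lambda>a. a) n x (\<pi> i) (monom_eval x (a i))" if "i < d" for i
      using place_laurent[OF field_hom_id torus_nonzero[OF x], where f="Poly_Mapping.single (a i) 1"] a that
      by (simp add: laurent_single leval_single[OF field_hom_id])
    have "x \<in> rat_domain n d \<pi>"
      unfolding rat_domain_def
      using x \<pi> a(1) place_imp_rational_eval[OF x \<pi>] monom_eval_nonzero[of n x] torus_nonzero[OF x] by auto
    then have "rat_apply n d \<pi> x = y"
      using inv y yt by (auto simp: x_def)
    then have "monom_eval x (a j) = y j"
      using place_imp_rational_eval(2)[OF x \<pi>] j by (auto simp: rat_apply_def)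
    moreover have "place (\<lambda>a. a) d y (monom_eval \<psi> (a j)) (monom_eval x (a j))"
      unfolding x_def using y a(1) j by (intro place_monom_eval_rat_apply)
    moreover have "place (\<lambda>a. a) d y (coord_fun j) (y j)"
      using place_laurent[OF field_hom_id, of d y "Poly_Mapping.single (Poly_Mapping.single j 1) 1"] j torus_nonzero[OF yt]
      by (simp add: coord_fun_def laurent_single leval_single[OF field_hom_id] vars_below_def del: One_nat_def)
    ultimately show "place (\<lambda>a. a) d y (monom_eval \<psi> (a j) - coord_fun j) 0"
      using place_diff[OF field_hom_id, of d y "monom_eval \<psi> (a j)" "y j" "coord_fun j" "y j"] torus_nonzero[OF yt]
      by simp
  qed (use \<psi> in auto)
  then show thesis
    using that[OF a dom] by simp
qed

section \<open>Non-Archimedean valuations\<close>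

context
  fixes v :: "'f::field \<Rightarrow> ereal"
  assumes v: "nonarch_valuation v"
begin

lemma val_0 [simp]: "v 0 = \<infinity>"
  using v by (simp add: nonarch_valuation_def)

lemma val_mult: "v (a * b) = v a + v b"
  using v by (simp add: nonarch_valuation_def)

lemma val_add_ge: "min (v a) (v b) \<le> v (a + b)"
  using v by (simp add: nonarch_valuation_def)

lemma val_finite: "a \<noteq> 0 \<Longrightarrow> v a = ereal (real_of_ereal (v a))"
  using v unfolding nonarch_valuation_def by (cases "v a") auto

lemma val_1: "v 1 = 0"
proof -
  have "v 1 = v 1 + v 1"
    using val_mult[of 1 1] by simp
  then show ?thesis
    using val_finite[of 1] by (cases "v 1") auto
qed

lemma val_uminus: "v (- a) = v a"
proof -
  have "v (- 1) + v (- 1) = 0"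
    using val_mult[of "- 1" "- 1"] val_1 by simp
  then have "v (- 1) = 0"
    using val_finite[of "- 1"] by (cases "v (- 1)") auto
  then show ?thesis
    using val_mult[of "- 1" a] by simp
qed

lemma val_diff_ge: "min (v a) (v b) \<le> v (a - b)"
  using val_add_ge[of a "- b"] by (simp add: val_uminus)

lemma val_sum_ge: "(\<And>i. i \<in> I \<Longrightarrow> B \<le> v (f i)) \<Longrightarrow> B \<le> v (sum f I)"
proof (induction I rule: infinite_finite_induct)
  case (insert i I)
  then have "B \<le> min (v (f i)) (v (sum f I))"
    by simp
  also have "\<dots> \<le> v (f i + sum f I)"
    by (rule val_add_ge)
  finally show ?case
    using insert by simp
qed auto

text \<open>The bound is real so that the empty sum, of valuation \<infinity>, satisfies the strict
  inequality too.\<close>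

lemma val_sum_gt: "(\<And>i. i \<in> I \<Longrightarrow> ereal B < v (f i)) \<Longrightarrow> ereal B < v (sum f I)"
proof (induction I rule: infinite_finite_induct)
  case (insert i I)
  then have "ereal B < min (v (f i)) (v (sum f I))"
    by simp
  also have "\<dots> \<le> v (f i + sum f I)"
    by (rule val_add_ge)
  finally show ?case
    using insert by simp
qed auto

text \<open>Otherwise \<open>a = (a + b) - b\<close> would have a valuation above
  \<open>v a\<close>.\<close>

lemma val_add_eq: "v a < v b \<Longrightarrow> v (a + b) = v a"
  using val_add_ge[of a b] val_diff_ge[of "a + b" b] by (auto simp: min_def not_le split: if_splits)

lemma val_inverse: "v a = ereal r \<Longrightarrow> v (inverse a) = ereal (- r)"
proof -
  assume r: "v a = ereal r"
  then have "a \<noteq> 0"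
    by auto
  then have "v a + v (inverse a) = 0"
    using val_1 val_mult[of a "inverse a"] by simp
  then show ?thesis
    using r by (cases "v (inverse a)") auto
qed

lemma val_powi:
  assumes "v a = ereal r"
  shows "v (a powi k) = ereal (of_int k * r)"
proof -
  have "v (b ^ j) = ereal (of_nat j * s)" if "v b = ereal s" for b s j
    using that by (induction j) (auto simp: val_1 val_mult algebra_simps)
  from this[of a r "nat k"] this[of "inverse a" "- r" "nat (- k)"] show ?thesis
    using assms val_inverse[OF assms] by (auto simp: power_int_def)
qed

lemma val_prod:
  "(\<And>i. i \<in> I \<Longrightarrow> v (f i) = ereal (r i)) \<Longrightarrow> v (prod f I) = ereal (sum r I)"
  by (induction I rule: infinite_finite_induct) (auto simp: val_1 val_mult)

end

section \<open>The Gauss valuation on rational functions\<close>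

definition pairing :: "(nat \<Rightarrow>\<^sub>0 real) \<Rightarrow> (nat \<Rightarrow>\<^sub>0 int) \<Rightarrow> real" where
  "pairing \<xi> \<alpha> = (\<Sum>i\<in>Poly_Mapping.keys \<alpha>. Poly_Mapping.lookup \<xi> i * of_int (Poly_Mapping.lookup \<alpha> i))"

lemma trop_term_eq:
  "trop_term v f \<xi> \<alpha> = real_of_ereal (v (Poly_Mapping.lookup f \<alpha>)) + pairing \<xi> \<alpha>"
  by (simp add: trop_term_def pairing_def)

lemma pairing_superset:
  "finite S \<Longrightarrow> Poly_Mapping.keys \<alpha> \<subseteq> S \<Longrightarrow>
    pairing \<xi> \<alpha> = (\<Sum>i\<in>S. Poly_Mapping.lookup \<xi> i * of_int (Poly_Mapping.lookup \<alpha> i))"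
  unfolding pairing_def by (rule sum.mono_neutral_left) (auto simp: in_keys_iff)

lemma pairing_below:
  "\<alpha> \<in> vars_below m \<Longrightarrow>
    pairing \<xi> \<alpha> = (\<Sum>i<m. Poly_Mapping.lookup \<xi> i * of_int (Poly_Mapping.lookup \<alpha> i))"
  by (rule pairing_superset) (auto simp: vars_below_def)

lemma pairing_add: "pairing \<xi> (\<alpha> + \<beta>) = pairing \<xi> \<alpha> + pairing \<xi> \<beta>"
proof -
  let ?S = "Poly_Mapping.keys \<alpha> \<union> Poly_Mapping.keys \<beta>"
  have "pairing \<xi> \<gamma> = (\<Sum>i\<in>?S. Poly_Mapping.lookup \<xi> i * of_int (Poly_Mapping.lookup \<gamma> i))"
    if "\<gamma> \<in> {\<alpha>, \<beta>, \<alpha> + \<beta>}" for \<gamma>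
    using that Poly_Mapping.keys_add[of \<alpha> \<beta>] by (intro pairing_superset) auto
  then show ?thesis
    by (simp add: lookup_add distrib_left sum.distrib)
qed

lemma pairing_0 [simp]: "pairing \<xi> 0 = 0"
  by (simp add: pairing_def)

lemma Fract_eq_0_iff: "h \<noteq> 0 \<Longrightarrow> Fract f h = 0 \<longleftrightarrow> f = 0"
  for f :: "'k::field laurent_poly"
  by (simp add: Zero_fract_def eq_fract)

text \<open>Convolution as one finite sum over pairs, from which the proof of Gauss's lemma can
  split off a single pair.\<close>

lemma lookup_mult_sum:
  "Poly_Mapping.lookup (f * g) \<gamma> = (\<Sum>p\<in>Poly_Mapping.keys f \<times> Poly_Mapping.keys g.
     if fst p + snd p = \<gamma> then Poly_Mapping.lookup f (fst p) * Poly_Mapping.lookup g (snd p) else 0)"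
  for f g :: "'k::field laurent_poly"
proof -
  let ?l = "\<lambda>f \<alpha>. Poly_Mapping.single \<alpha> (Poly_Mapping.lookup f \<alpha>)"
  have "f * g = (\<Sum>\<alpha>\<in>Poly_Mapping.keys f. \<Sum>\<beta>\<in>Poly_Mapping.keys g. ?l f \<alpha> * ?l g \<beta>)"
    by (subst (1) poly_mapping_sum_single[of f], subst (1) poly_mapping_sum_single[of g])
      (simp add: sum_product)
  then show ?thesis
    by (simp add: sum.cartesian_product case_prod_unfold lookup_sum mult_single lookup_single when_def)
qed

text \<open>For fixed \<xi>, tropicalization as a function of the polynomial becomes a valuation
  once it is given the value \<infinity> at 0.\<close>

definition gauss_poly :: "('k::field \<Rightarrow> ereal) \<Rightarrow> (nat \<Rightarrow>\<^sub>0 real) \<Rightarrow> 'k laurent_poly \<Rightarrow> ereal" where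
  "gauss_poly v \<xi> f = (if f = 0 then \<infinity> else ereal (trop_poly v f \<xi>))"

definition gauss :: "('k::field \<Rightarrow> ereal) \<Rightarrow> (nat \<Rightarrow>\<^sub>0 real) \<Rightarrow> 'k rational_fun \<Rightarrow> ereal" where
  "gauss v \<xi> q = (if q = 0 then \<infinity> else ereal (trop_rational v q \<xi>))"

lemma keys_empty_iff: "Poly_Mapping.keys f = {} \<longleftrightarrow> f = 0"
  using poly_mapping_eqI[of f 0] by (auto simp: in_keys_iff)

lemma trop_poly_le: "\<alpha> \<in> Poly_Mapping.keys f \<Longrightarrow> trop_poly v f \<xi> \<le> trop_term v f \<xi> \<alpha>"
  by (simp add: trop_poly_def)

lemma trop_poly_attained:
  assumes "f \<noteq> 0"
  obtains \<alpha> where "\<alpha> \<in> Poly_Mapping.keys f" "trop_term v f \<xi> \<alpha> = trop_poly v f \<xi>"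
proof -
  have "trop_poly v f \<xi> \<in> trop_term v f \<xi> ` Poly_Mapping.keys f"
    unfolding trop_poly_def using assms by (intro Min_in) (auto simp: keys_empty_iff)
  then show thesis
    using that by auto
qed

context
  fixes v :: "'k::field \<Rightarrow> ereal" and \<xi> :: "nat \<Rightarrow>\<^sub>0 real"
  assumes v: "nonarch_valuation v"
begin

lemma trop_term_ereal:
  "\<alpha> \<in> Poly_Mapping.keys f \<Longrightarrow> ereal (trop_term v f \<xi> \<alpha>) = v (Poly_Mapping.lookup f \<alpha>) + ereal (pairing \<xi> \<alpha>)"
  using val_finite[OF v, of "Poly_Mapping.lookup f \<alpha>"]
  by (simp add: trop_term_eq in_keys_iff flip: plus_ereal.simps(1))

text \<open>Exponents outside the support are included because their terms are \<infinity>. Lower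
  bounds for sums and products can then be checked coefficientwise, whichever exponents survive
  cancellation.\<close>

lemma gauss_poly_ge_iff:
  "B \<le> gauss_poly v \<xi> f \<longleftrightarrow> (\<forall>\<alpha>. B \<le> v (Poly_Mapping.lookup f \<alpha>) + ereal (pairing \<xi> \<alpha>))"
proof (cases "f = 0")
  case True
  then show ?thesis
    by (simp add: gauss_poly_def val_0[OF v])
next
  case False
  show ?thesis
  proof
    assume B: "B \<le> gauss_poly v \<xi> f"
    show "\<forall>\<alpha>. B \<le> v (Poly_Mapping.lookup f \<alpha>) + ereal (pairing \<xi> \<alpha>)"
    proof
      fix \<alpha>
      show "B \<le> v (Poly_Mapping.lookup f \<alpha>) + ereal (pairing \<xi> \<alpha>)"
      proof (cases "\<alpha> \<in> Poly_Mapping.keys f")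
        case True
        then show ?thesis
          using B trop_poly_le[OF True, of v \<xi>] False trop_term_ereal[OF True]
          by (metis gauss_poly_def ereal_less_eq(3) order_trans)
      next
        case False
        then show ?thesis
          by (simp add: in_keys_iff val_0[OF v])
      qed
    qed
  next
    assume B: "\<forall>\<alpha>. B \<le> v (Poly_Mapping.lookup f \<alpha>) + ereal (pairing \<xi> \<alpha>)"
    obtain \<alpha> where "\<alpha> \<in> Poly_Mapping.keys f" "trop_term v f \<xi> \<alpha> = trop_poly v f \<xi>"
      using trop_poly_attained[OF False] by blast
    then show "B \<le> gauss_poly v \<xi> f"
      using B False trop_term_ereal by (metis gauss_poly_def)
  qed
qed

lemma gauss_poly_add: "min (gauss_poly v \<xi> f) (gauss_poly v \<xi> g) \<le> gauss_poly v \<xi> (f + g)"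
  unfolding gauss_poly_ge_iff
proof
  fix \<alpha>
  let ?p = "ereal (pairing \<xi> \<alpha>)"
  have "min (gauss_poly v \<xi> f) (gauss_poly v \<xi> g)
      \<le> min (v (Poly_Mapping.lookup f \<alpha>) + ?p) (v (Poly_Mapping.lookup g \<alpha>) + ?p)"
    using gauss_poly_ge_iff[of "gauss_poly v \<xi> f" f] gauss_poly_ge_iff[of "gauss_poly v \<xi> g" g]
    by (intro min.mono) auto
  also have "\<dots> = min (v (Poly_Mapping.lookup f \<alpha>)) (v (Poly_Mapping.lookup g \<alpha>)) + ?p"
    by (simp add: min_def ereal_add_le_add_iff2)
  also have "\<dots> \<le> v (Poly_Mapping.lookup (f + g) \<alpha>) + ?p"
    unfolding lookup_add by (intro add_right_mono val_add_ge[OF v])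
  finally show "min (gauss_poly v \<xi> f) (gauss_poly v \<xi> g) \<le> v (Poly_Mapping.lookup (f + g) \<alpha>) + ?p" .
qed

text \<open>
  Gauss's lemma: take the largest exponent among those attaining the minimum in each factor; at
  their sum only one product contributes with minimal valuation.
\<close>

lemma trop_poly_mult:
  assumes "f \<noteq> 0" "g \<noteq> 0"
  shows "trop_poly v (f * g) \<xi> = trop_poly v f \<xi> + trop_poly v g \<xi>"
proof -
  define M where "M f = {\<alpha> \<in> Poly_Mapping.keys f. trop_term v f \<xi> \<alpha> = trop_poly v f \<xi>}" for f
  define \<alpha>0 where "\<alpha>0 = Max (M f)"
  define \<beta>0 where "\<beta>0 = Max (M g)"
  define \<gamma> where "\<gamma> = \<alpha>0 + \<beta>0"
  let ?K = "Poly_Mapping.keys f \<times> Poly_Mapping.keys g"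
  define c where "c = (\<lambda>p. Poly_Mapping.lookup f (fst p) * Poly_Mapping.lookup g (snd p))"
  have fin: "finite (M h)" for h
    by (simp add: M_def)
  have "M h \<noteq> {}" if "h \<noteq> 0" for h
    using trop_poly_attained[OF that, of v \<xi>] by (auto simp: M_def)
  then have \<alpha>\<beta>0: "\<alpha>0 \<in> M f" "\<beta>0 \<in> M g"
    using assms fin by (simp_all add: \<alpha>0_def \<beta>0_def)
  have vc: "v (c (\<alpha>, \<beta>)) = ereal (trop_term v f \<xi> \<alpha> + trop_term v g \<xi> \<beta> - pairing \<xi> (\<alpha> + \<beta>))"
    if "(\<alpha>, \<beta>) \<in> ?K" for \<alpha> \<beta>
    using that val_finite[OF v, of "Poly_Mapping.lookup f \<alpha>"] val_finite[OF v, of "Poly_Mapping.lookup g \<beta>"]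
    by (simp add: c_def val_mult[OF v] trop_term_eq pairing_add in_keys_iff algebra_simps
        flip: plus_ereal.simps(1))
  let ?t = "trop_poly v f \<xi> + trop_poly v g \<xi>"
  have fg: "f * g \<noteq> 0"
    using assms by simp
  have lk: "Poly_Mapping.lookup (f * g) \<delta> = (\<Sum>p\<in>?K. if fst p + snd p = \<delta> then c p else 0)" for \<delta>
    unfolding c_def by (rule lookup_mult_sum)
  have ge: "?t \<le> trop_poly v (f * g) \<xi>"
  proof -
    have "ereal ?t \<le> gauss_poly v \<xi> (f * g)"
      unfolding gauss_poly_ge_iff
    proof
      fix \<delta>
      have "ereal (?t - pairing \<xi> \<delta>) \<le> v (Poly_Mapping.lookup (f * g) \<delta>)"
        unfolding lk
      proof (rule val_sum_ge[OF v])
        fix p assume p: "p \<in> ?K"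
        obtain \<alpha> \<beta> where "p = (\<alpha>, \<beta>)"
          by (cases p)
        then show "ereal (?t - pairing \<xi> \<delta>) \<le> v (if fst p + snd p = \<delta> then c p else 0)"
          using p vc[of \<alpha> \<beta>] trop_poly_le[of \<alpha> f v \<xi>] trop_poly_le[of \<beta> g v \<xi>]
          by (auto simp: val_0[OF v])
      qed
      then show "ereal ?t \<le> v (Poly_Mapping.lookup (f * g) \<delta>) + ereal (pairing \<xi> \<delta>)"
        by (cases "v (Poly_Mapping.lookup (f * g) \<delta>)") auto
    qed
    then show ?thesis
      using fg by (simp add: gauss_poly_def)
  qed
  have p0: "(\<alpha>0, \<beta>0) \<in> ?K"
    using \<alpha>\<beta>0 by (simp add: M_def)
  have v0: "v (c (\<alpha>0, \<beta>0)) = ereal (?t - pairing \<xi> \<gamma>)"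
    using vc[OF p0] \<alpha>\<beta>0 by (simp add: M_def \<gamma>_def)
  have "Poly_Mapping.lookup (f * g) \<gamma>
      = c (\<alpha>0, \<beta>0) + (\<Sum>p\<in>?K - {(\<alpha>0, \<beta>0)}. if fst p + snd p = \<gamma> then c p else 0)"
    unfolding lk by (subst sum.remove[OF _ p0]) (auto simp: \<gamma>_def)
  moreover have "ereal (?t - pairing \<xi> \<gamma>)
      < v (\<Sum>p\<in>?K - {(\<alpha>0, \<beta>0)}. if fst p + snd p = \<gamma> then c p else 0)"
  proof (rule val_sum_gt[OF v])
    fix p assume p: "p \<in> ?K - {(\<alpha>0, \<beta>0)}"
    obtain \<alpha> \<beta> where \<alpha>\<beta>: "p = (\<alpha>, \<beta>)"
      by (cases p)
    show "ereal (?t - pairing \<xi> \<gamma>) < v (if fst p + snd p = \<gamma> then c p else 0)"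
    proof (cases "\<alpha> + \<beta> = \<gamma>")
      case True
      \<comment> \<open>Addition of exponents is strictly monotone, so among the pairs with sum
        \<gamma> only \<open>(\<alpha>0, \<beta>0)\<close> consists of two minimising
        exponents.\<close>
      have "\<not> (\<alpha> \<in> M f \<and> \<beta> \<in> M g)"
      proof
        assume "\<alpha> \<in> M f \<and> \<beta> \<in> M g"
        then have "\<alpha> \<le> \<alpha>0" "\<beta> \<le> \<beta>0"
          using fin by (simp_all add: \<alpha>0_def \<beta>0_def)
        then have "\<alpha> = \<alpha>0 \<and> \<beta> = \<beta>0"
          using True unfolding \<gamma>_def
          by (metis add_le_less_mono add_less_le_mono order_le_imp_less_or_eq less_irrefl)
        then show False
          using p \<alpha>\<beta> by simp
      qed
      then have "?t < trop_term v f \<xi> \<alpha> + trop_term v g \<xi> \<beta>"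
        using p \<alpha>\<beta> trop_poly_le[of \<alpha> f v \<xi>] trop_poly_le[of \<beta> g v \<xi>] by (auto simp: M_def)
      then show ?thesis
        using True p \<alpha>\<beta> vc[of \<alpha> \<beta>] by simp
    next
      case False
      then show ?thesis
        using \<alpha>\<beta> by (simp add: val_0[OF v])
    qed
  qed
  ultimately have vl: "v (Poly_Mapping.lookup (f * g) \<gamma>) = ereal (?t - pairing \<xi> \<gamma>)"
    using val_add_eq[OF v] v0 by simp
  then have "\<gamma> \<in> Poly_Mapping.keys (f * g)"
    using val_0[OF v] by (auto simp: in_keys_iff)
  then have "trop_poly v (f * g) \<xi> \<le> trop_term v (f * g) \<xi> \<gamma>"
    by (rule trop_poly_le)
  also have "\<dots> = ?t"
    using vl by (simp add: trop_term_eq)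
  finally show ?thesis
    using ge by simp
qed

lemma gauss_poly_mult: "gauss_poly v \<xi> (f * g) = gauss_poly v \<xi> f + gauss_poly v \<xi> g"
  by (simp add: gauss_poly_def trop_poly_mult)

text \<open>Equal fractions satisfy \<open>f * h' = f' * h\<close>, and by Gauss's lemma the
  tropicalizations of the two products are sums; hence the description in
  \<open>trop_rational\<close> picks out a unique number.\<close>

lemma trop_rational_Fract:
  assumes "f \<noteq> 0" "h \<noteq> 0"
  shows "trop_rational v (Fract f h) \<xi> = trop_poly v f \<xi> - trop_poly v h \<xi>"
  unfolding trop_rational_def
proof (rule the_equality)
  show "\<exists>f' h'. f' \<noteq> 0 \<and> h' \<noteq> 0 \<and> Fract f h = Fract f' h'
      \<and> trop_poly v f \<xi> - trop_poly v h \<xi> = trop_poly v f' \<xi> - trop_poly v h' \<xi>"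
    using assms by blast
next
  fix t assume "\<exists>f' h'. f' \<noteq> 0 \<and> h' \<noteq> 0 \<and> Fract f h = Fract f' h' \<and> t = trop_poly v f' \<xi> - trop_poly v h' \<xi>"
  then obtain f' h' where fh': "f' \<noteq> 0" "h' \<noteq> 0" "Fract f h = Fract f' h'"
      "t = trop_poly v f' \<xi> - trop_poly v h' \<xi>"
    by blast
  then have "f * h' = f' * h"
    using assms by (simp add: eq_fract)
  then have "trop_poly v f \<xi> + trop_poly v h' \<xi> = trop_poly v f' \<xi> + trop_poly v h \<xi>"
    using assms fh' trop_poly_mult by metis
  then show "t = trop_poly v f \<xi> - trop_poly v h \<xi>"
    using fh' by simp
qed

lemma gauss_Fract: "h \<noteq> 0 \<Longrightarrow> gauss v \<xi> (Fract f h) = gauss_poly v \<xi> f - gauss_poly v \<xi> h"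
  by (cases "f = 0") (simp_all add: gauss_def gauss_poly_def trop_rational_Fract fract_collapse Fract_eq_0_iff)

lemma nonarch_valuation_gauss: "nonarch_valuation (gauss v \<xi>)"
  unfolding nonarch_valuation_def
proof (intro conjI allI)
  fix q r :: "'k rational_fun"
  show "gauss v \<xi> q \<noteq> - \<infinity>" "gauss v \<xi> q = \<infinity> \<longleftrightarrow> q = 0"
    by (auto simp: gauss_def)
  obtain f h where fh: "q = Fract f h" "h \<noteq> 0"
    by (cases q) auto
  obtain f' h' where fh': "r = Fract f' h'" "h' \<noteq> 0"
    by (cases r) auto
  obtain t t' where t: "gauss_poly v \<xi> h = ereal t" "gauss_poly v \<xi> h' = ereal t'"
    using fh fh' by (simp add: gauss_poly_def)
  have hh: "h * h' \<noteq> 0"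
    using fh fh' by simp
  have pinf: "gauss_poly v \<xi> p \<noteq> - \<infinity>" for p
    by (simp add: gauss_poly_def)
  have gF: "gauss v \<xi> q = gauss_poly v \<xi> f - ereal t" "gauss v \<xi> r = gauss_poly v \<xi> f' - ereal t'"
    using fh fh' t by (simp_all add: gauss_Fract)
  have "gauss v \<xi> (q * r) = gauss_poly v \<xi> f + gauss_poly v \<xi> f' - ereal (t + t')"
    using fh fh' t gauss_Fract[OF hh, of "f * f'"] by (simp add: gauss_poly_mult)
  then show "gauss v \<xi> (q * r) = gauss v \<xi> q + gauss v \<xi> r"
    unfolding gF using pinf[of f] pinf[of f']
    by (cases "gauss_poly v \<xi> f"; cases "gauss_poly v \<xi> f'") simp_all
  have "gauss v \<xi> (q + r) = gauss_poly v \<xi> (f * h' + f' * h) - ereal (t + t')"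
    using fh fh' t gauss_Fract[OF hh, of "f * h' + f' * h"] by (simp add: gauss_poly_mult)
  moreover have "min (gauss_poly v \<xi> f + ereal t') (gauss_poly v \<xi> f' + ereal t) \<le> gauss_poly v \<xi> (f * h' + f' * h)"
    using gauss_poly_add[of "f * h'" "f' * h"] t by (simp add: gauss_poly_mult)
  moreover have "min (x - ereal t) (y - ereal t') \<le> z - ereal (t + t')"
    if "min (x + ereal t') (y + ereal t) \<le> z" for x y z
    using that by (cases x; cases y; cases z) (auto simp: min_def split: if_splits)
  ultimately show "min (gauss v \<xi> q) (gauss v \<xi> r) \<le> gauss v \<xi> (q + r)"
    unfolding gF by simp
qed

lemma trop_poly_single: "a \<noteq> 0 \<Longrightarrow> trop_poly v (Poly_Mapping.single \<alpha> a) \<xi> = real_of_ereal (v a) + pairing \<xi> \<alpha>"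
  by (simp add: trop_poly_def trop_term_eq)

lemma trop_rational_monomial:
  "trop_rational v (Fract (Poly_Mapping.single \<alpha> 1) 1) \<xi> = pairing \<xi> \<alpha>"
  using trop_poly_single[of 1 0] trop_poly_single[of 1 \<alpha>] val_1[OF v]
  by (subst trop_rational_Fract) auto

lemma gauss_const_fun: "gauss v \<xi> (const_fun a) = v a"
proof (cases "a = 0")
  case True
  then show ?thesis
    by (simp add: gauss_def val_0[OF v])
next
  case False
  then show ?thesis
    using gauss_Fract[of 1 "Poly_Mapping.single 0 a"] trop_poly_single[of a 0] trop_poly_single[of 1 0]
      val_1[OF v] val_finite[OF v False]
    by (simp add: const_fun_def gauss_poly_def)
qed

lemma gauss_coord_fun: "gauss v \<xi> (coord_fun i) = ereal (Poly_Mapping.lookup \<xi> i)"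
  using trop_rational_monomial[of "Poly_Mapping.single i 1"]
  by (simp add: gauss_def) (simp add: coord_fun_def pairing_def)

end

text \<open>Only the weights of variables that occur matter. This keeps valuations on the first
  variables fixed while the weights of the additional ones move.\<close>

lemma gauss_cong:
  assumes v: "nonarch_valuation v" and q: "q \<in> rational_funs m"
    and eq: "\<And>i. i < m \<Longrightarrow> Poly_Mapping.lookup \<xi> i = Poly_Mapping.lookup \<eta> i"
  shows "gauss v \<xi> q = gauss v \<eta> q"
proof -
  obtain f h where fh: "f \<in> laurent m" "h \<in> laurent m" "h \<noteq> 0" "q = Fract f h"
    using q by (elim rational_funsE)
  have "gauss_poly v \<xi> p = gauss_poly v \<eta> p" if "p \<in> laurent m" for p
  proof -
    have "trop_term v p \<xi> \<alpha> = trop_term v p \<eta> \<alpha>" if "\<alpha> \<in> Poly_Mapping.keys p" for \<alpha>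
      using that \<open>p \<in> laurent m\<close> eq by (auto simp: trop_term_eq laurent_iff pairing_below[of _ m])
    then show ?thesis
      by (simp add: gauss_poly_def trop_poly_def)
  qed
  then show ?thesis
    using fh by (simp add: gauss_Fract[OF v])
qed

section \<open>Tropicalized points of a variety\<close>

text \<open>A vanishing sum in a valued field has no unique term of minimal valuation.\<close>

lemma val_zero_in_corner_locus:
  assumes v: "nonarch_valuation v" and w: "nonarch_valuation w"
    and c: "field_hom c" "\<And>a. w (c a) = v a"
    and g: "g \<in> laurent n" "g \<noteq> 0" "leval c g \<phi> = 0"
    and \<xi>: "\<xi> \<in> Rn n" "\<And>i. i < n \<Longrightarrow> w (\<phi> i) = ereal (Poly_Mapping.lookup \<xi> i)"
  shows "\<xi> \<in> corner_locus v n g"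
proof (rule ccontr)
  assume not: "\<xi> \<notin> corner_locus v n g"
  obtain \<alpha> where \<alpha>: "\<alpha> \<in> Poly_Mapping.keys g" "trop_term v g \<xi> \<alpha> = trop_poly v g \<xi>"
    using trop_poly_attained[OF g(2)] by blast
  let ?s = "\<lambda>\<beta>. c (Poly_Mapping.lookup g \<beta>) * monom_eval \<phi> \<beta>"
  have wt: "w (?s \<beta>) = ereal (trop_term v g \<xi> \<beta>)" if \<beta>: "\<beta> \<in> Poly_Mapping.keys g" for \<beta>
  proof -
    have "\<beta> \<in> vars_below n"
      using \<beta> g(1) by (auto simp: laurent_iff)
    then have "w (monom_eval \<phi> \<beta>) = ereal (pairing \<xi> \<beta>)"
      using \<xi>(2) by (simp add: monom_eval_below pairing_below)
        (intro val_prod[OF w] trans[OF val_powi[OF w \<xi>(2)]], auto simp: mult.commute)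
    then show ?thesis
      using trop_term_ereal[OF v \<beta>, of \<xi>] by (simp add: val_mult[OF w] c(2))
  qed
  have "trop_poly v g \<xi> < trop_term v g \<xi> \<beta>" if "\<beta> \<in> Poly_Mapping.keys g - {\<alpha>}" for \<beta>
    using that not \<alpha> \<xi>(1) trop_poly_le[of \<beta> g v \<xi>] by (auto simp: corner_locus_def less_le)
  then have "w (?s \<alpha>) < w (\<Sum>\<beta>\<in>Poly_Mapping.keys g - {\<alpha>}. ?s \<beta>)"
    using wt \<alpha> by (simp, intro val_sum_gt[OF w]) simp
  moreover have "leval c g \<phi> = ?s \<alpha> + (\<Sum>\<beta>\<in>Poly_Mapping.keys g - {\<alpha>}. ?s \<beta>)"
    unfolding leval_def by (rule sum.remove[OF finite_keys \<alpha>(1)])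
  ultimately have "w (leval c g \<phi>) = w (?s \<alpha>)"
    using val_add_eq[OF w] by simp
  then show False
    using g(3) wt[OF \<alpha>(1)] val_0[OF w] by simp
qed

lemma lookup_trop_map: "Poly_Mapping.lookup (trop_map v n \<phi> \<xi>) i = (if i < n then trop_rational v (\<phi> i) \<xi> else 0)"
  unfolding trop_map_def by (subst lookup_Abs_poly_mapping) (auto simp: when_def)

lemma trop_map_in_Rn: "trop_map v n \<phi> \<xi> \<in> Rn n"
  by (auto simp: Rn_def in_keys_iff lookup_trop_map split: if_splits)

lemma trop_map_subset_trop_variety:
  assumes v: "nonarch_valuation v" and \<phi>: "\<And>i. i < n \<Longrightarrow> \<phi> i \<noteq> 0"
    and ker: "\<And>g. g \<in> vanishing_ideal n X \<Longrightarrow> leval const_fun g \<phi> = 0"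
  shows "trop_map v n \<phi> \<xi> \<in> trop_variety v n X"
  unfolding trop_variety_def
proof (intro CollectI conjI ballI impI trop_map_in_Rn)
  fix g assume g: "g \<in> vanishing_ideal n X" "g \<noteq> 0"
  show "trop_map v n \<phi> \<xi> \<in> corner_locus v n g"
  proof (rule val_zero_in_corner_locus[OF v nonarch_valuation_gauss[OF v, of \<xi>] field_hom_const_fun])
    show "g \<in> laurent n"
      using g by (simp add: vanishing_ideal_def)
    show "gauss v \<xi> (\<phi> i) = ereal (Poly_Mapping.lookup (trop_map v n \<phi> \<xi>) i)" if "i < n" for i
      using that \<phi> by (simp add: gauss_def lookup_trop_map)
  qed (use g ker v gauss_const_fun trop_map_in_Rn in auto)
qed

section \<open>Horizontal polyhedra\<close>

lemma lookup_scaleR: "Poly_Mapping.lookup (r *\<^sub>R x) i = r *\<^sub>R Poly_Mapping.lookup x i"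
  unfolding scaleR_poly_mapping_def
  by (subst lookup_Abs_poly_mapping) (auto intro: finite_subset[OF _ finite_lookup[of x]])

lemma Rn_combination:
  assumes "x \<in> Rn n" "y \<in> Rn n"
  shows "r *\<^sub>R x + s *\<^sub>R y \<in> Rn n"
proof -
  have "Poly_Mapping.lookup (r *\<^sub>R x + s *\<^sub>R y) i = 0" if "\<not> i < n" for i
  proof -
    have "Poly_Mapping.lookup x i = 0" "Poly_Mapping.lookup y i = 0"
      using assms that by (auto simp: Rn_def in_keys_iff subset_iff)
    then show ?thesis
      by (simp add: lookup_add lookup_scaleR)
  qed
  then show ?thesis
    by (auto simp: Rn_def in_keys_iff)
qed

lemma convex_polyhedron_in:
  assumes "polyhedron_in n P"
  shows "convex P"
proof -
  obtain H where H: "P = {\<xi> \<in> Rn n. \<forall>(a, b)\<in>H. (\<Sum>i<n. a i * Poly_Mapping.lookup \<xi> i) \<le> b}"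
    using assms unfolding polyhedron_in_def by blast
  show ?thesis
    unfolding convex_def
  proof (intro ballI allI impI)
    fix x y and r s :: real
    assume xy: "x \<in> P" "y \<in> P" and rs: "0 \<le> r" "0 \<le> s" "r + s = 1"
    have "(\<Sum>i<n. a i * Poly_Mapping.lookup (r *\<^sub>R x + s *\<^sub>R y) i) \<le> b" if "(a, b) \<in> H" for a b
    proof -
      have "(\<Sum>i<n. a i * Poly_Mapping.lookup (r *\<^sub>R x + s *\<^sub>R y) i)
          = r * (\<Sum>i<n. a i * Poly_Mapping.lookup x i) + s * (\<Sum>i<n. a i * Poly_Mapping.lookup y i)"
        by (simp add: lookup_add lookup_scaleR sum_distrib_left sum.distrib algebra_simps)
      also have "\<dots> \<le> r * b + s * b"
        using xy rs that unfolding H by (intro add_mono mult_left_mono) auto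
      also have "\<dots> = b"
        using rs by (simp flip: distrib_right)
      finally show ?thesis .
    qed
    then show "r *\<^sub>R x + s *\<^sub>R y \<in> P"
      using xy unfolding H by (auto intro: Rn_combination)
  qed
qed

text \<open>If the form were constant on \<open>S\<close>, so it would be on the affine hull. An
  affine basis of d + 1 elements then gives d independent differences in the kernel of the form,
  which is spanned by at most d - 1 vectors.\<close>

lemma affine_dim_not_in_hyperplane:
  assumes S: "S \<subseteq> Rn d" "affine_dim S = int d" and k: "k < d" "w k \<noteq> (0::real)"
  shows "\<exists>x\<in>S. (\<Sum>j<d. w j * Poly_Mapping.lookup x j) \<noteq> c"
proof (rule ccontr)
  let ?l = "\<lambda>x. \<Sum>j<d. w j * Poly_Mapping.lookup x j"
  have l_lin: "?l (r *\<^sub>R x + s *\<^sub>R y) = r * ?l x + s * ?l y" for r s x y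
    by (simp add: lookup_add lookup_scaleR sum_distrib_left sum.distrib algebra_simps)
  assume "\<not> (\<exists>x\<in>S. ?l x \<noteq> c)"
  then have SH: "S \<subseteq> {x \<in> Rn d. ?l x = c}"
    using S(1) by auto
  have aff: "affine {x \<in> Rn d. ?l x = c}"
    unfolding affine_def using l_lin Rn_combination by (auto simp flip: distrib_right)
  \<comment> \<open>\<open>affine_dim\<close> is a choice; the existence of an affine basis
    guarantees that the chosen number is realised by some \<open>B\<close>.\<close>
  have "\<exists>B. affine hull B = affine hull S \<and> \<not> affine_dependent B \<and> of_nat (card B) = affine_dim S + 1"
    unfolding affine_dim_def
  proof (rule someI_ex)
    obtain B where "\<not> affine_dependent B" "affine hull S = affine hull B"
      using affine_basis_exists[of S] by blast
    then have "affine hull B = affine hull S \<and> \<not> affine_dependent B \<and> int (card B) = int (card B) - 1 + 1"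
      by simp
    then show "\<exists>(d::int) B. affine hull B = affine hull S \<and> \<not> affine_dependent B \<and> of_nat (card B) = d + 1"
      by blast
  qed
  then obtain B where B: "affine hull B = affine hull S" "\<not> affine_dependent B" "card B = d + 1"
    using S(2) by auto
  have "affine hull S \<subseteq> {x \<in> Rn d. ?l x = c}"
    using SH aff by (rule hull_minimal)
  then have BH: "B \<subseteq> {x \<in> Rn d. ?l x = c}"
    using hull_subset[of B affine] B(1) by blast
  obtain b where b: "b \<in> B"
    using B(3) by fastforce
  define V where "V = (\<lambda>x. - b + x) ` (B - {b})"
  have "independent V"
    using B(2) affine_dependent_iff_dependent2[OF b] by (simp add: V_def)
  have "card V = d"
    unfolding V_def using B(3) b by (subst card_image) auto
  \<comment> \<open>Spanning vectors of the kernel: the equation is solved for the coordinate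
    \<open>k\<close>, where \<open>w k\<close> is non-zero.\<close>
  define e where "e i = Poly_Mapping.single i (1::real) - (w i / w k) *\<^sub>R Poly_Mapping.single k 1" for i
  define T where "T = e ` ({..<d} - {k})"
  have "V \<subseteq> span T"
  proof
    fix x assume "x \<in> V"
    then obtain y where y: "y \<in> B" "x = - b + y"
      by (auto simp: V_def)
    then have x: "x = (- 1) *\<^sub>R b + 1 *\<^sub>R y"
      by simp
    have xR: "x \<in> Rn d"
      unfolding x using BH b y by (intro Rn_combination) auto
    have "?l x = 0"
      unfolding x l_lin using BH b y by auto
    then have xk: "(\<Sum>i\<in>{..<d} - {k}. w i * Poly_Mapping.lookup x i) = - w k * Poly_Mapping.lookup x k"
      using k(1) by (simp add: sum.remove[of "{..<d}" k])
    have "x = (\<Sum>i\<in>{..<d} - {k}. Poly_Mapping.lookup x i *\<^sub>R e i)"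
    proof (rule poly_mapping_eqI)
      fix j
      have "Poly_Mapping.lookup (\<Sum>i\<in>{..<d} - {k}. Poly_Mapping.lookup x i *\<^sub>R e i) j
          = (\<Sum>i\<in>{..<d} - {k}. (if i = j then Poly_Mapping.lookup x i else 0)
              - (if k = j then w i * Poly_Mapping.lookup x i / w k else 0))"
        unfolding lookup_sum
        by (intro sum.cong refl) (simp add: lookup_scaleR e_def lookup_minus lookup_single when_def)
      also have "\<dots> = (if j \<in> {..<d} - {k} then Poly_Mapping.lookup x j else 0)
              - (if k = j then (\<Sum>i\<in>{..<d} - {k}. w i * Poly_Mapping.lookup x i) / w k else 0)"
        by (simp add: sum_subtractf sum_divide_distrib)
      also have "\<dots> = Poly_Mapping.lookup x j"
        unfolding xk using xR k by (auto simp: Rn_def in_keys_iff)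
      finally show "Poly_Mapping.lookup x j
          = Poly_Mapping.lookup (\<Sum>i\<in>{..<d} - {k}. Poly_Mapping.lookup x i *\<^sub>R e i) j" ..
    qed
    also have "\<dots> \<in> span T"
      by (intro span_sum span_scale span_base) (simp add: T_def)
    finally show "x \<in> span T" .
  qed
  then have "card V \<le> card T"
    using independent_span_bound[of T V] \<open>independent V\<close> by (simp add: T_def)
  also have "\<dots> \<le> card ({..<d} - {k})"
    unfolding T_def by (rule card_image_le) simp
  also have "\<dots> < d"
    using k(1) by simp
  finally show False
    using \<open>card V = d\<close> by simp
qed

section \<open>Generic points of convex sets\<close>

lemma finite_zeros_on_segment:
  fixes a b :: real
  assumes "b \<noteq> 0"
  shows "finite {t. (1 - t) * a + t * b = 0}"
proof (rule finite_subset)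
  show "{t. (1 - t) * a + t * b = 0} \<subseteq> {a / (a - b)}"
  proof clarify
    fix t assume t: "(1 - t) * a + t * b = 0"
    then have "t * (a - b) = a"
      by (simp add: algebra_simps)
    moreover have "a - b \<noteq> 0"
      using t assms by (auto simp flip: distrib_right)
    ultimately show "t = a / (a - b)"
      by (simp add: nonzero_eq_divide_eq)
  qed
qed simp

text \<open>Induction on the family: on the segment from a point \<open>p\<close> good for the
  earlier functions to a point \<open>q\<close> where the new one is non-zero, each function
  vanishes at finitely many parameters only.\<close>

lemma convex_avoid_zeros:
  fixes P :: "'a::real_vector set"
  assumes "finite \<F>" and P: "convex P" "P \<noteq> {}"
    and aff: "\<And>F x y t. F \<in> \<F> \<Longrightarrow> F ((1 - t) *\<^sub>R x + t *\<^sub>R y) = (1 - t) * F x + t * (F y :: real)"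
    and nz: "\<And>F. F \<in> \<F> \<Longrightarrow> \<exists>x\<in>P. F x \<noteq> 0"
  shows "\<exists>p\<in>P. \<forall>F\<in>\<F>. F p \<noteq> 0"
  using assms(1) aff nz
proof (induction \<F>)
  case empty
  then show ?case
    using P by auto
next
  case (insert F \<F>)
  then obtain p where p: "p \<in> P" "\<forall>F\<in>\<F>. F p \<noteq> 0"
    by (metis insertCI)
  obtain q where q: "q \<in> P" "F q \<noteq> 0"
    using insert.prems(2) by blast
  \<comment> \<open>The earlier functions are non-zero at \<open>p\<close>, that is at t = 0,
    whereas \<open>finite_zeros_on_segment\<close> wants a non-zero value at parameter 1; hence the
    reversed parameter.\<close>
  define Z where "Z = {t. (1 - t) * F p + t * F q = 0} \<union> (\<Union>G\<in>\<F>. {t. (1 - (1 - t)) * G q + (1 - t) * G p = 0})"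
  have "finite {t. (1 - (1 - t)) * G q + (1 - t) * G p = 0}" if "G p \<noteq> 0" for G :: "'a \<Rightarrow> real"
    using finite_vimageI[OF finite_zeros_on_segment[OF that, of "G q"], of "\<lambda>t. 1 - t"]
    by (simp add: vimage_def inj_on_def)
  then have "finite Z"
    unfolding Z_def using p insert.hyps finite_zeros_on_segment[OF q(2)] by auto
  then obtain t where t: "t \<in> {0<..<1}" "t \<notin> Z"
    using infinite_Ioo[of "0::real" 1] by (metis finite_subset subsetI zero_less_one)
  have "(1 - t) *\<^sub>R p + t *\<^sub>R q \<in> P"
    using P(1) p q t by (auto simp: convex_alt)
  moreover have "G ((1 - t) *\<^sub>R p + t *\<^sub>R q) \<noteq> 0" if "G \<in> insert F \<F>" for G
    using insert.prems(1)[OF that, of t p q] that t(2) by (auto simp: Z_def algebra_simps)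
  ultimately show ?case
    by blast
qed

lemma pairing_combination:
  "pairing (r *\<^sub>R x + s *\<^sub>R y) \<alpha> = r * pairing x \<alpha> + s * pairing y \<alpha>"
  by (simp add: pairing_def lookup_add lookup_scaleR sum_distrib_left sum.distrib algebra_simps)

lemma pairing_single: "pairing \<xi> (Poly_Mapping.single i 1) = Poly_Mapping.lookup \<xi> i"
  by (simp add: pairing_def)

text \<open>Tropical counterpart of \<open>monom_eval_frag_extend\<close>:
  \<open>frag_extend a\<close> is the transpose of the linear map from \<xi> to \<eta>.\<close>

lemma pairing_frag_extend:
  assumes "\<beta> \<in> vars_below d" "\<And>j. j < d \<Longrightarrow> a j \<in> vars_below n"
    and "\<And>j. j < d \<Longrightarrow> Poly_Mapping.lookup \<eta> j = pairing \<xi> (a j)"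
  shows "pairing \<xi> (frag_extend a \<beta>) = pairing \<eta> \<beta>"
proof -
  have "frag_extend a \<beta> \<in> vars_below n"
    using assms(1,2) by (rule frag_extend_vars_below)
  then have "pairing \<xi> (frag_extend a \<beta>) = (\<Sum>i<n. \<Sum>j<d. Poly_Mapping.lookup \<xi> i *
      (of_int (Poly_Mapping.lookup \<beta> j) * of_int (Poly_Mapping.lookup (a j) i)))"
    by (simp add: pairing_below lookup_frag_extend[OF assms(1)] sum_distrib_left)
  also have "\<dots> = (\<Sum>j<d. \<Sum>i<n. Poly_Mapping.lookup \<xi> i *
      (of_int (Poly_Mapping.lookup \<beta> j) * of_int (Poly_Mapping.lookup (a j) i)))"
    by (rule sum.swap)
  also have "\<dots> = (\<Sum>j<d. Poly_Mapping.lookup \<eta> j * of_int (Poly_Mapping.lookup \<beta> j))"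
    using assms(2,3)
    by (intro sum.cong refl) (simp add: pairing_below[of _ n] sum_distrib_left mult_ac)
  finally show ?thesis
    using assms(1) by (simp add: pairing_below)
qed

section \<open>The tropical section over a horizontal polyhedron\<close>

text \<open>
  The relation \<open>x\<^sub>l h(\<pi>(x)) = f(\<pi>(x))\<close> on \<open>X\<close> puts a polynomial into the ideal of \<open>X\<close> whose
  initial forms, over a generic \<open>\<eta>\<close>, are binomials; these determine \<open>\<xi>\<^sub>l\<close>.
\<close>

lemma trop_section_generic:
  fixes v :: "'k::alg_closed_field \<Rightarrow> ereal"
  assumes v: "nonarch_valuation v"
    and dom: "dominant_rational_map d (torus d) n X \<psi>"
    and a: "\<And>j. j < d \<Longrightarrow> a j \<in> vars_below n"
    and sec: "\<And>j. j < d \<Longrightarrow> monom_eval \<psi> (a j) = coord_fun j"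
    and inj: "inj_on (frag_extend a) (vars_below d)"
    and \<xi>: "\<xi> \<in> trop_variety v n X"
    and \<eta>: "\<And>j. j < d \<Longrightarrow> Poly_Mapping.lookup \<eta> j = pairing \<xi> (a j)"
    and l: "l < n" "\<psi> l = Fract f h"
    and fh: "f \<in> laurent d" "h \<in> laurent d" "f \<noteq> 0" "h \<noteq> 0"
    and gen: "inj_on (trop_term v f \<eta>) (Poly_Mapping.keys f)" "inj_on (trop_term v h \<eta>) (Poly_Mapping.keys h)"
  shows "trop_rational v (\<psi> l) \<eta> = Poly_Mapping.lookup \<xi> l"
proof -
  let ?A = "frag_extend a" and ?e = "Poly_Mapping.single l (1::int)"
  have \<psi>: "\<And>i. i < n \<Longrightarrow> \<psi> i \<in> rational_funs d" "\<And>i. i < n \<Longrightarrow> \<psi> i \<noteq> 0"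
    using dom by (auto simp: dominant_rational_map_def rational_map_def)
  have e: "?e \<in> vars_below n"
    using l by (simp add: vars_below_def)
  have me: "monom_eval \<psi> (?A \<beta>) = monom_eval coord_fun \<beta>" if "\<beta> \<in> vars_below d" for \<beta>
    using monom_eval_frag_extend[of n \<psi> \<beta> d a] \<psi> a that sec by (simp add: monom_eval_below)
  have pe: "pairing \<xi> (?A \<beta>) = pairing \<eta> \<beta>" if "\<beta> \<in> vars_below d" for \<beta>
    using that a \<eta> by (rule pairing_frag_extend)
  have below: "Poly_Mapping.keys f \<subseteq> vars_below d" "Poly_Mapping.keys h \<subseteq> vars_below d"
    using fh by (auto simp: laurent_iff)
  show ?thesis
  \<comment> \<open>If \<open>?e\<close> is a combination of the \<open>a j\<close>, the two parts
    of the relation used below may share exponents and cancel. But then \<open>\<psi> l\<close> is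
    itself a monomial, whose tropicalization can be read off directly.\<close>
  proof (cases "?e \<in> ?A ` vars_below d")
    case True
    then obtain \<delta> where \<delta>: "\<delta> \<in> vars_below d" "?e = ?A \<delta>"
      by auto
    have "\<psi> l = monom_eval \<psi> ?e"
      by simp
    also have "\<dots> = monom_eval coord_fun \<delta>"
      using \<delta> me by simp
    also have "\<dots> = Fract (Poly_Mapping.single \<delta> 1) 1"
      using leval_coord_fun[of "Poly_Mapping.single \<delta> 1" d] \<delta>
      by (simp add: laurent_single leval_single[OF field_hom_const_fun])
    finally have "trop_rational v (\<psi> l) \<eta> = pairing \<eta> \<delta>"
      by (simp add: trop_rational_monomial[OF v])
    also have "\<dots> = pairing \<xi> ?e"
      using \<delta> pe by simp
    finally show ?thesis
      by (simp add: pairing_def)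
  next
    case False
    define g where "g = push (\<lambda>\<beta>. ?e + ?A \<beta>) h - push ?A f"
    have g_laurent: "g \<in> laurent n"
      unfolding g_def using below a e
      by (intro laurent_diff push_laurent vars_below_add frag_extend_vars_below[where d=d]) auto
    have "leval const_fun g \<psi> = 0"
    proof -
      have "monom_eval \<psi> (?e + ?A \<beta>) = \<psi> l * monom_eval coord_fun \<beta>" if "\<beta> \<in> Poly_Mapping.keys h" for \<beta>
      proof -
        have "?A \<beta> \<in> vars_below n"
          using that below a by (intro frag_extend_vars_below[where d=d]) auto
        then have "monom_eval \<psi> (?e + ?A \<beta>) = monom_eval \<psi> ?e * monom_eval \<psi> (?A \<beta>)"
          using monom_eval_add[of n \<psi>] \<psi>(2) e by blast
        then show ?thesis
          using me that below by auto
      qed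
      moreover have "monom_eval \<psi> (?A \<beta>) = monom_eval coord_fun \<beta>" if "\<beta> \<in> Poly_Mapping.keys f" for \<beta>
        using me that below by auto
      ultimately have "leval const_fun g \<psi> = \<psi> l * leval const_fun h coord_fun - leval const_fun f coord_fun"
        unfolding g_def leval_diff[OF field_hom_const_fun] leval_push[OF field_hom_const_fun]
        by (simp add: leval_def sum_distrib_left mult_ac)
      also have "\<dots> = 0"
        using l(2) fh by (simp add: leval_coord_fun[of _ d] Fract_eq_0_iff)
      finally show ?thesis .
    qed
    then have gI: "g \<in> vanishing_ideal n X"
      using dominant_imp_vanishing_ideal[OF dom g_laurent] by simp
    \<comment> \<open>A common exponent of the two parts would exhibit \<open>?e\<close> as the
      image of \<open>\<alpha> - \<beta>\<close>, so nothing cancels in this case.\<close>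
    have disj: "?e + ?A \<beta> \<noteq> ?A \<alpha>" if "\<alpha> \<in> vars_below d" "\<beta> \<in> vars_below d" for \<alpha> \<beta>
    proof
      assume "?e + ?A \<beta> = ?A \<alpha>"
      then have "?e = ?A (\<alpha> - \<beta>)"
        by (simp add: frag_extend_diff algebra_simps)
      moreover have "\<alpha> - \<beta> \<in> vars_below d"
        using that keys_diff[of \<alpha> \<beta>] by (auto simp: vars_below_def)
      ultimately show False
        using False by blast
    qed
    have inj_f: "inj_on ?A (Poly_Mapping.keys f)" and inj_h: "inj_on (\<lambda>\<beta>. ?e + ?A \<beta>) (Poly_Mapping.keys h)"
      using inj below by (auto simp: inj_on_def)
    have g_h: "Poly_Mapping.lookup g (?e + ?A \<beta>) = Poly_Mapping.lookup h \<beta>"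
      if "\<beta> \<in> Poly_Mapping.keys h" for \<beta>
    proof -
      have "?e + ?A \<beta> \<notin> ?A ` Poly_Mapping.keys f"
        using disj that below by blast
      then show ?thesis
        using lookup_push[OF inj_h that] by (simp add: g_def lookup_minus lookup_push_eq_0)
    qed
    have g_f: "Poly_Mapping.lookup g (?A \<alpha>) = - Poly_Mapping.lookup f \<alpha>"
      if "\<alpha> \<in> Poly_Mapping.keys f" for \<alpha>
    proof -
      have "?A \<alpha> \<notin> (\<lambda>\<beta>. ?e + ?A \<beta>) ` Poly_Mapping.keys h"
      proof
        assume "?A \<alpha> \<in> (\<lambda>\<beta>. ?e + ?A \<beta>) ` Poly_Mapping.keys h"
        then obtain \<beta> where "\<beta> \<in> Poly_Mapping.keys h" "?e + ?A \<beta> = ?A \<alpha>"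
          by force
        then show False
          using disj[of \<alpha> \<beta>] that below by blast
      qed
      then show ?thesis
        using lookup_push[OF inj_f that] by (simp add: g_def lookup_minus lookup_push_eq_0)
    qed
    have keys_g: "Poly_Mapping.keys g = (\<lambda>\<beta>. ?e + ?A \<beta>) ` Poly_Mapping.keys h \<union> ?A ` Poly_Mapping.keys f"
    proof (intro equalityI subsetI)
      fix \<gamma> assume "\<gamma> \<in> Poly_Mapping.keys g"
      then have "Poly_Mapping.lookup (push (\<lambda>\<beta>. ?e + ?A \<beta>) h) \<gamma> \<noteq> 0 \<or> Poly_Mapping.lookup (push ?A f) \<gamma> \<noteq> 0"
        by (auto simp: in_keys_iff g_def lookup_minus)
      then show "\<gamma> \<in> (\<lambda>\<beta>. ?e + ?A \<beta>) ` Poly_Mapping.keys h \<union> ?A ` Poly_Mapping.keys f"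
        using lookup_push_eq_0[of \<gamma> ?A f] lookup_push_eq_0[of \<gamma> "\<lambda>\<beta>. ?e + ?A \<beta>" h] by auto
    next
      fix \<gamma> assume "\<gamma> \<in> (\<lambda>\<beta>. ?e + ?A \<beta>) ` Poly_Mapping.keys h \<union> ?A ` Poly_Mapping.keys f"
      then show "\<gamma> \<in> Poly_Mapping.keys g"
        using g_h g_f by (auto simp: in_keys_iff)
    qed
    let ?x = "Poly_Mapping.lookup \<xi> l"
    have tt_h: "trop_term v g \<xi> (?e + ?A \<beta>) = ?x + trop_term v h \<eta> \<beta>" if "\<beta> \<in> Poly_Mapping.keys h" for \<beta>
    proof -
      have "pairing \<xi> (?e + ?A \<beta>) = ?x + pairing \<eta> \<beta>"
        using pe[of \<beta>] that below by (auto simp: pairing_add pairing_single)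
      then show ?thesis
        by (simp add: trop_term_eq g_h[OF that])
    qed
    have tt_f: "trop_term v g \<xi> (?A \<alpha>) = trop_term v f \<eta> \<alpha>" if "\<alpha> \<in> Poly_Mapping.keys f" for \<alpha>
      using pe[of \<alpha>] that below by (auto simp: trop_term_eq g_f[OF that] val_uminus[OF v])
    have "g \<noteq> 0"
      using keys_g fh(3) keys_empty_iff[of f] keys_empty_iff[of g] by blast
    then have "\<xi> \<in> corner_locus v n g"
      using \<xi> gI by (auto simp: trop_variety_def)
    then obtain \<gamma> \<gamma>' where \<gamma>: "\<gamma> \<in> Poly_Mapping.keys g" "\<gamma>' \<in> Poly_Mapping.keys g" "\<gamma> \<noteq> \<gamma>'"
        "trop_term v g \<xi> \<gamma> = trop_poly v g \<xi>" "trop_term v g \<xi> \<gamma>' = trop_poly v g \<xi>"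
      by (auto simp: corner_locus_def)
    \<comment> \<open>Two minimal terms inside one part would be equal values of two terms of
      \<open>f\<close>, or of \<open>h\<close>, at \<eta>, against genericity; so each part supplies
      one.\<close>
    have "\<exists>\<beta>\<in>Poly_Mapping.keys h. \<exists>\<alpha>\<in>Poly_Mapping.keys f.
        ?x + trop_term v h \<eta> \<beta> = trop_poly v g \<xi> \<and> trop_term v f \<eta> \<alpha> = trop_poly v g \<xi>"
    proof -
      have "\<not> (\<gamma> \<in> ?A ` Poly_Mapping.keys f \<and> \<gamma>' \<in> ?A ` Poly_Mapping.keys f)"
      proof
        assume "\<gamma> \<in> ?A ` Poly_Mapping.keys f \<and> \<gamma>' \<in> ?A ` Poly_Mapping.keys f"
        then obtain \<alpha> \<alpha>' where \<alpha>: "\<alpha> \<in> Poly_Mapping.keys f" "\<gamma> = ?A \<alpha>" "\<alpha>' \<in> Poly_Mapping.keys f" "\<gamma>' = ?A \<alpha>'"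
          by blast
        then have "trop_term v f \<eta> \<alpha> = trop_term v f \<eta> \<alpha>'"
          using \<gamma>(4,5) tt_f[of \<alpha>] tt_f[of \<alpha>'] by simp
        then show False
          using \<alpha> \<gamma>(3) inj_onD[OF gen(1)] by blast
      qed
      moreover have "\<not> (\<gamma> \<in> (\<lambda>\<beta>. ?e + ?A \<beta>) ` Poly_Mapping.keys h \<and> \<gamma>' \<in> (\<lambda>\<beta>. ?e + ?A \<beta>) ` Poly_Mapping.keys h)"
      proof
        assume "\<gamma> \<in> (\<lambda>\<beta>. ?e + ?A \<beta>) ` Poly_Mapping.keys h \<and> \<gamma>' \<in> (\<lambda>\<beta>. ?e + ?A \<beta>) ` Poly_Mapping.keys h"
        then obtain \<beta> \<beta>' where \<beta>: "\<beta> \<in> Poly_Mapping.keys h" "\<gamma> = ?e + ?A \<beta>" "\<beta>' \<in> Poly_Mapping.keys h" "\<gamma>' = ?e + ?A \<beta>'"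
          by blast
        then have "trop_term v h \<eta> \<beta> = trop_term v h \<eta> \<beta>'"
          using \<gamma>(4,5) tt_h[of \<beta>] tt_h[of \<beta>'] by simp
        then show False
          using \<beta> \<gamma>(3) inj_onD[OF gen(2)] by blast
      qed
      ultimately consider
          \<beta> \<alpha> where "\<beta> \<in> Poly_Mapping.keys h" "\<gamma> = ?e + ?A \<beta>" "\<alpha> \<in> Poly_Mapping.keys f" "\<gamma>' = ?A \<alpha>"
        | \<beta> \<alpha> where "\<beta> \<in> Poly_Mapping.keys h" "\<gamma>' = ?e + ?A \<beta>" "\<alpha> \<in> Poly_Mapping.keys f" "\<gamma> = ?A \<alpha>"
        using \<gamma>(1,2) unfolding keys_g by blast
      then show ?thesis
      proof cases
        case 1
        then show ?thesis
          using \<gamma>(4,5) tt_h[of \<beta>] tt_f[of \<alpha>] by (intro bexI[of _ \<beta>] bexI[of _ \<alpha>]) simp_all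
      next
        case 2
        then show ?thesis
          using \<gamma>(4,5) tt_h[of \<beta>] tt_f[of \<alpha>] by (intro bexI[of _ \<beta>] bexI[of _ \<alpha>]) simp_all
      qed
    qed
    then obtain \<beta> \<alpha> where \<alpha>\<beta>: "\<beta> \<in> Poly_Mapping.keys h" "\<alpha> \<in> Poly_Mapping.keys f"
        "?x + trop_term v h \<eta> \<beta> = trop_poly v g \<xi>" "trop_term v f \<eta> \<alpha> = trop_poly v g \<xi>"
      by blast
    \<comment> \<open>Both parts attain the minimum of \<open>g\<close>. It is therefore the
      tropicalization of \<open>f\<close> at \<eta>, and also that of \<open>h\<close> plus
      \<open>?x\<close>, which gives the claim by subtraction.\<close>
    have "trop_poly v g \<xi> \<le> ?x + trop_term v h \<eta> \<beta>'" if "\<beta>' \<in> Poly_Mapping.keys h" for \<beta>'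
      using trop_poly_le[of "?e + ?A \<beta>'" g v \<xi>] tt_h[OF that] that keys_g by simp
    then have "trop_poly v h \<eta> = trop_poly v g \<xi> - ?x"
      unfolding trop_poly_def[of v h] using \<alpha>\<beta>
      by (intro Min_eqI) (auto simp: algebra_simps image_iff intro!: bexI[of _ \<beta>])
    moreover have "trop_poly v g \<xi> \<le> trop_term v f \<eta> \<alpha>'" if "\<alpha>' \<in> Poly_Mapping.keys f" for \<alpha>'
      using trop_poly_le[of "?A \<alpha>'" g v \<xi>] tt_f[OF that] that keys_g by simp
    then have "trop_poly v f \<eta> = trop_poly v g \<xi>"
      unfolding trop_poly_def[of v f] using \<alpha>\<beta>
      by (intro Min_eqI) (auto simp: image_iff intro!: bexI[of _ \<alpha>])
    ultimately show ?thesis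
      unfolding l(2) by (simp add: trop_rational_Fract[OF v fh(3,4)])
  qed
qed

lemma tendsto_trop_poly:
  assumes "f \<noteq> 0" "\<And>\<alpha>. \<alpha> \<in> Poly_Mapping.keys f \<Longrightarrow> ((\<lambda>t. trop_term v f (\<eta> t) \<alpha>) \<longlongrightarrow> trop_term v f \<eta>0 \<alpha>) F"
  shows "((\<lambda>t. trop_poly v f (\<eta> t)) \<longlongrightarrow> trop_poly v f \<eta>0) F"
proof -
  have "((\<lambda>t. Min (G t ` K)) \<longlongrightarrow> Min (G0 ` K)) F"
    if "finite K" "K \<noteq> {}" "\<And>\<alpha>. \<alpha> \<in> K \<Longrightarrow> ((\<lambda>t. G t \<alpha>) \<longlongrightarrow> G0 \<alpha>) F"
    for K and G :: "'b \<Rightarrow> (nat \<Rightarrow>\<^sub>0 int) \<Rightarrow> real" and G0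
    using that by (induction K rule: finite_ne_induct) (auto intro: tendsto_min)
  from this[of "Poly_Mapping.keys f" "\<lambda>t. trop_term v f (\<eta> t)" "trop_term v f \<eta>0"]
  show ?thesis
    unfolding trop_poly_def using assms by (simp add: keys_empty_iff)
qed

text \<open>Horizontality says that the image of P lies in no hyperplane. This yields both the
  injectivity of the exponent map and a point of P with generic image; on the segment from \<xi> to
  it, points close to \<xi> but different from it are generic as well, and the equation passes to
  the limit.\<close>

lemma trop_section:
  fixes v :: "'k::alg_closed_field \<Rightarrow> ereal"
  assumes v: "nonarch_valuation v"
    and dom: "dominant_rational_map d (torus d) n X \<psi>"
    and a: "\<And>j. j < d \<Longrightarrow> a j \<in> vars_below n"
    and \<pi>: "\<And>j. j < d \<Longrightarrow> \<pi> j = Fract (Poly_Mapping.single (a j) 1) 1"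
    and sec: "\<And>j. j < d \<Longrightarrow> monom_eval \<psi> (a j) = coord_fun j"
    and P: "polyhedron_in n P" "P \<subseteq> trop_variety v n X" "horizontal d (trop_map v d \<pi>) P"
    and \<xi>: "\<xi> \<in> P" and l: "l < n"
  shows "trop_rational v (\<psi> l) (trop_map v d \<pi> \<xi>) = Poly_Mapping.lookup \<xi> l"
proof -
  let ?A = "trop_map v d \<pi>"
  have A: "Poly_Mapping.lookup (?A x) j = pairing x (a j)" if "j < d" for x j
    using that by (simp add: lookup_trop_map \<pi> trop_rational_monomial[OF v])
  \<comment> \<open>Taken with \<open>c = 0\<close> for the injectivity of
    \<open>frag_extend a\<close>, and with a difference of coefficient valuations for
    genericity.\<close>
  have hyper: "\<exists>x\<in>P. pairing (?A x) \<alpha> - pairing (?A x) \<beta> \<noteq> c"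
    if \<alpha>\<beta>: "\<alpha> \<in> vars_below d" "\<beta> \<in> vars_below d" "\<alpha> \<noteq> \<beta>" for \<alpha> \<beta> c
  proof -
    obtain k where k: "Poly_Mapping.lookup \<alpha> k \<noteq> Poly_Mapping.lookup \<beta> k"
      using \<alpha>\<beta>(3) poly_mapping_eqI[of \<alpha> \<beta>] by blast
    moreover have "k \<in> Poly_Mapping.keys \<alpha> \<or> k \<in> Poly_Mapping.keys \<beta>"
      using k by (auto simp: in_keys_iff)
    ultimately have k: "k < d" "Poly_Mapping.lookup \<alpha> k - Poly_Mapping.lookup \<beta> k \<noteq> 0"
      using \<alpha>\<beta> by (auto simp: vars_below_def)
    then have "\<exists>y\<in>?A ` P. (\<Sum>j<d. real_of_int (Poly_Mapping.lookup \<alpha> j - Poly_Mapping.lookup \<beta> j) * Poly_Mapping.lookup y j) \<noteq> c"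
      using P(3) trop_map_in_Rn
      by (intro affine_dim_not_in_hyperplane[of _ d k]) (auto simp: horizontal_def simp flip: of_int_diff)
    then show ?thesis
      using \<alpha>\<beta> by (simp add: pairing_below[of _ d] sum_subtractf algebra_simps)
  qed
  have inj: "inj_on (frag_extend a) (vars_below d)"
  proof (rule inj_onI, rule ccontr)
    fix \<alpha> \<beta> assume *: "\<alpha> \<in> vars_below d" "\<beta> \<in> vars_below d" "frag_extend a \<alpha> = frag_extend a \<beta>" "\<alpha> \<noteq> \<beta>"
    have "pairing (?A x) \<gamma> = pairing x (frag_extend a \<gamma>)" if "\<gamma> \<in> vars_below d" for x \<gamma>
      using that a A by (intro pairing_frag_extend[symmetric])
    then show False
      using hyper[of \<alpha> \<beta> 0] * by auto
  qed
  have "\<psi> l \<in> rational_funs d" "\<psi> l \<noteq> 0"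
    using dom l by (auto simp: dominant_rational_map_def rational_map_def)
  then obtain f h where fh: "\<psi> l = Fract f h" "f \<in> laurent d" "h \<in> laurent d" "f \<noteq> 0" "h \<noteq> 0"
    by (elim rational_funsE) (auto simp: Fract_eq_0_iff)
  \<comment> \<open>Genericity expressed through finitely many affine functions on P: none of them
    vanishes where the terms of \<open>f\<close>, and those of \<open>h\<close>, have pairwise
    distinct values.\<close>
  define D where "D = (\<lambda>(p, \<alpha>, \<beta>) x. trop_term v p (?A x) \<alpha> - trop_term v p (?A x) \<beta>)"
  define \<F> where "\<F> = D ` (\<Union>p\<in>{f, h}. {(p, \<alpha>, \<beta>) | \<alpha> \<beta>. \<alpha> \<in> Poly_Mapping.keys p \<and> \<beta> \<in> Poly_Mapping.keys p \<and> \<alpha> \<noteq> \<beta>})"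
  have keys_below: "\<alpha> \<in> vars_below d" if "p \<in> {f, h}" "\<alpha> \<in> Poly_Mapping.keys p" for p \<alpha>
    using that fh by (auto simp: laurent_iff)
  have fin: "finite \<F>"
  proof -
    have "{(p, \<alpha>, \<beta>) | \<alpha> \<beta>. \<alpha> \<in> Poly_Mapping.keys p \<and> \<beta> \<in> Poly_Mapping.keys p \<and> \<alpha> \<noteq> \<beta>}
        \<subseteq> {p} \<times> Poly_Mapping.keys p \<times> Poly_Mapping.keys p" for p :: "'k laurent_poly"
      by auto
    then have "finite {(p, \<alpha>, \<beta>) | \<alpha> \<beta>. \<alpha> \<in> Poly_Mapping.keys p \<and> \<beta> \<in> Poly_Mapping.keys p \<and> \<alpha> \<noteq> \<beta>}"
      for p :: "'k laurent_poly"
      by (rule finite_subset) simp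
    then show ?thesis
      unfolding \<F>_def by (intro finite_imageI finite_UN_I) auto
  qed
  have tt_aff: "trop_term v p (?A ((1 - t) *\<^sub>R x + t *\<^sub>R y)) \<alpha>
      = (1 - t) * trop_term v p (?A x) \<alpha> + t * trop_term v p (?A y) \<alpha>"
    for p \<alpha> x y t
  proof -
    have "?A ((1 - t) *\<^sub>R x + t *\<^sub>R y) = (1 - t) *\<^sub>R ?A x + t *\<^sub>R ?A y"
      by (rule poly_mapping_eqI)
        (simp add: lookup_add lookup_scaleR lookup_trop_map \<pi> trop_rational_monomial[OF v] pairing_combination)
    then show ?thesis
      by (simp only: trop_term_eq pairing_combination) (simp add: algebra_simps)
  qed
  have aff: "F ((1 - t) *\<^sub>R x + t *\<^sub>R y) = (1 - t) * F x + t * F y" if "F \<in> \<F>" for F x y t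
  proof -
    obtain q \<alpha> \<beta> where "F = D (q, \<alpha>, \<beta>)"
      using \<open>F \<in> \<F>\<close> unfolding \<F>_def by blast
    then show ?thesis
      by (simp only: D_def prod.case tt_aff) (simp add: algebra_simps)
  qed
  have nz: "\<exists>x\<in>P. F x \<noteq> 0" if F: "F \<in> \<F>" for F
  proof -
    obtain p \<alpha> \<beta> where p: "p \<in> {f, h}" "\<alpha> \<in> Poly_Mapping.keys p" "\<beta> \<in> Poly_Mapping.keys p" "\<alpha> \<noteq> \<beta>" "F = D (p, \<alpha>, \<beta>)"
      using F unfolding \<F>_def by blast
    let ?r = "\<lambda>\<gamma>. real_of_ereal (v (Poly_Mapping.lookup p \<gamma>))"
    obtain x where "x \<in> P" "pairing (?A x) \<alpha> - pairing (?A x) \<beta> \<noteq> ?r \<beta> - ?r \<alpha>"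
      using hyper[of \<alpha> \<beta>] keys_below p by blast
    then show ?thesis
      unfolding p(5) D_def by (intro bexI[of _ x]) (auto simp: trop_term_eq)
  qed
  obtain p where p: "p \<in> P" "\<forall>F\<in>\<F>. F p \<noteq> 0"
    using convex_avoid_zeros[OF fin convex_polyhedron_in[OF P(1)] _ aff nz] \<xi> by blast
  \<comment> \<open>Each function is non-zero at \<open>p\<close>, so it has finitely many zeros on
    the line through \<xi> and \<open>p\<close>, although \<xi> itself may be one of them.\<close>
  define x where "x t = (1 - t) *\<^sub>R \<xi> + t *\<^sub>R p" for t :: real
  have "finite (\<Union>F\<in>\<F>. {t. F (x t) = 0})"
  proof (rule finite_UN_I[OF fin])
    fix F assume F: "F \<in> \<F>"
    have "F (x t) = (1 - t) * F \<xi> + t * F p" for t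
      unfolding x_def by (rule aff[OF F])
    then show "finite {t. F (x t) = 0}"
      using F p(2) finite_zeros_on_segment[of "F p" "F \<xi>"] by simp
  qed
  from finite_set_avoid[OF this, of 0]
  obtain b where b: "b > 0" "\<And>t. t \<in> (\<Union>F\<in>\<F>. {t. F (x t) = 0}) \<Longrightarrow> t \<noteq> 0 \<Longrightarrow> b \<le> dist 0 t"
    by metis
  \<comment> \<open>Staying below \<open>b\<close> avoids the zeros; staying below 1 keeps the point
    on the segment and thus in P.\<close>
  have gen: "trop_rational v (\<psi> l) (?A (x t)) - Poly_Mapping.lookup (x t) l = 0" if t: "0 < t" "t < min b 1" for t
  proof -
    have nzt: "F (x t) \<noteq> 0" if "F \<in> \<F>" for F
      using b(2)[of t] that t by auto
    have "x t \<in> P"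
      unfolding x_def using convex_polyhedron_in[OF P(1)] \<xi> p(1) t by (auto simp: convex_alt)
    moreover have "inj_on (trop_term v q (?A (x t))) (Poly_Mapping.keys q)" if q: "q \<in> {f, h}" for q
    proof (rule inj_onI, rule ccontr)
      fix \<alpha> \<beta> assume *: "\<alpha> \<in> Poly_Mapping.keys q" "\<beta> \<in> Poly_Mapping.keys q" "\<alpha> \<noteq> \<beta>"
        "trop_term v q (?A (x t)) \<alpha> = trop_term v q (?A (x t)) \<beta>"
      then have "D (q, \<alpha>, \<beta>) \<in> \<F>"
        unfolding \<F>_def using q by blast
      then show False
        using nzt[of "D (q, \<alpha>, \<beta>)"] * by (simp add: D_def)
    qed
    ultimately show ?thesis
      using trop_section_generic[OF v dom a sec inj, of "x t" "?A (x t)" l f h] A l fh P(2) by auto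
  qed
  have "\<forall>\<^sub>F t in at_right 0. trop_rational v (\<psi> l) (?A (x t)) - Poly_Mapping.lookup (x t) l = 0"
    using b(1) gen by (auto simp: eventually_at_right_field intro!: exI[of _ "min b 1"])
  then have "((\<lambda>t. trop_rational v (\<psi> l) (?A (x t)) - Poly_Mapping.lookup (x t) l) \<longlongrightarrow> 0) (at_right 0)"
    by (rule tendsto_eventually)
  moreover have "((\<lambda>t. trop_rational v (\<psi> l) (?A (x t)) - Poly_Mapping.lookup (x t) l) \<longlongrightarrow>
      trop_rational v (\<psi> l) (?A \<xi>) - Poly_Mapping.lookup \<xi> l) (at_right 0)"
  proof -
    have tp: "((\<lambda>t. trop_poly v q (?A (x t))) \<longlongrightarrow> trop_poly v q (?A \<xi>)) (at_right 0)" if q: "q \<in> {f, h}" for q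
    proof (rule tendsto_trop_poly)
      fix \<alpha> assume "\<alpha> \<in> Poly_Mapping.keys q"
      then show "((\<lambda>t. trop_term v q (?A (x t)) \<alpha>) \<longlongrightarrow> trop_term v q (?A \<xi>) \<alpha>) (at_right 0)"
        unfolding x_def by (auto simp: tt_aff intro!: tendsto_eq_intros)
    qed (use q fh in auto)
    have "((\<lambda>t. Poly_Mapping.lookup (x t) l) \<longlongrightarrow> Poly_Mapping.lookup \<xi> l) (at_right 0)"
      unfolding x_def by (auto simp: lookup_add lookup_scaleR intro!: tendsto_eq_intros)
    then show ?thesis
      unfolding fh(1) trop_rational_Fract[OF v fh(4,5)] using tp by (intro tendsto_diff) auto
  qed
  ultimately show ?thesis
    using tendsto_unique[of "at_right (0::real)"] by fastforce
qed

section \<open>Degenerating families of Gauss valuations\<close>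

text \<open>Here \<open>q\<close> and \<open>r\<close> are fixed and the valuation moves:
  convergence is with respect to a family of valuations instead of a single one.\<close>

definition val_tendsto ::
    "('k::field \<Rightarrow> ereal) \<Rightarrow> (real \<Rightarrow> (nat \<Rightarrow>\<^sub>0 real)) \<Rightarrow> 'k rational_fun \<Rightarrow> 'k rational_fun \<Rightarrow> bool" where
  "val_tendsto v \<xi> q r \<longleftrightarrow> (\<forall>B::real. \<forall>\<^sub>F S in at_top. ereal B \<le> gauss v (\<xi> S) (q - r))"

context
  fixes v :: "'k::field \<Rightarrow> ereal" and \<xi> :: "real \<Rightarrow> (nat \<Rightarrow>\<^sub>0 real)" and d :: nat and \<eta> :: "nat \<Rightarrow>\<^sub>0 real"
  assumes v: "nonarch_valuation v"
    and agree: "\<And>S i. i < d \<Longrightarrow> Poly_Mapping.lookup (\<xi> S) i = Poly_Mapping.lookup \<eta> i"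
begin

lemma gauss_family: "nonarch_valuation (gauss v (\<xi> S))"
  using v by (rule nonarch_valuation_gauss)

text \<open>Limits are taken among the functions of the first \<open>d\<close> variables, where the
  whole family agrees. So a limit has one well-defined valuation, with which the moving ones can be
  compared.\<close>

lemma gauss_family_const: "r \<in> rational_funs d \<Longrightarrow> gauss v (\<xi> S) r = gauss v \<eta> r"
  using v agree by (intro gauss_cong[where m=d])

lemma val_tendsto_refl: "val_tendsto v \<xi> q q"
  by (simp add: val_tendsto_def gauss_def)

lemma val_tendsto_add:
  assumes "val_tendsto v \<xi> q r" "val_tendsto v \<xi> q' r'"
  shows "val_tendsto v \<xi> (q + q') (r + r')"
  unfolding val_tendsto_def
proof
  fix B :: real
  have "\<forall>\<^sub>F S in at_top. ereal B \<le> gauss v (\<xi> S) (q - r)" "\<forall>\<^sub>F S in at_top. ereal B \<le> gauss v (\<xi> S) (q' - r')"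
    using assms by (auto simp: val_tendsto_def)
  then show "\<forall>\<^sub>F S in at_top. ereal B \<le> gauss v (\<xi> S) (q + q' - (r + r'))"
  proof eventually_elim
    case (elim S)
    then have "ereal B \<le> min (gauss v (\<xi> S) (q - r)) (gauss v (\<xi> S) (q' - r'))"
      by simp
    also have "\<dots> \<le> gauss v (\<xi> S) ((q - r) + (q' - r'))"
      using gauss_family by (rule val_add_ge)
    finally show ?case
      by (simp add: algebra_simps)
  qed
qed

lemma val_tendsto_sum:
  "(\<And>i. i \<in> I \<Longrightarrow> val_tendsto v \<xi> (q i) (r i)) \<Longrightarrow> val_tendsto v \<xi> (sum q I) (sum r I)"
  by (induction I rule: infinite_finite_induct) (auto intro: val_tendsto_add val_tendsto_refl)

lemma gauss_lower_bound: "\<exists>C::real. ereal C \<le> gauss v \<eta> r"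
  by (cases "r = 0") (auto simp: gauss_def intro: exI[of _ "trop_rational v r \<eta>"])

lemma val_tendsto_bounded_below:
  assumes "val_tendsto v \<xi> q r" "r \<in> rational_funs d"
  shows "\<exists>C::real. \<forall>\<^sub>F S in at_top. ereal C \<le> gauss v (\<xi> S) q"
proof -
  obtain C :: real where C: "ereal C \<le> gauss v \<eta> r"
    using gauss_lower_bound by blast
  have "\<forall>\<^sub>F S in at_top. ereal C \<le> gauss v (\<xi> S) (q - r)"
    using assms(1) by (simp add: val_tendsto_def)
  then have "\<forall>\<^sub>F S in at_top. ereal C \<le> gauss v (\<xi> S) q"
  proof eventually_elim
    case (elim S)
    then have "ereal C \<le> min (gauss v (\<xi> S) (q - r)) (gauss v (\<xi> S) r)"
      using C gauss_family_const[OF assms(2)] by simp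
    also have "\<dots> \<le> gauss v (\<xi> S) ((q - r) + r)"
      using gauss_family by (rule val_add_ge)
    finally show ?case
      by simp
  qed
  then show ?thesis ..
qed

text \<open>The difference is \<open>(q - r) * q' + r * (q' - r')\<close>. The factors
  \<open>q'\<close> and \<open>r\<close> are bounded below by \<open>C\<close> and \<open>E\<close>,
  which is what the other factors have to make up for.\<close>

lemma val_tendsto_mult:
  assumes "val_tendsto v \<xi> q r" "val_tendsto v \<xi> q' r'" "r \<in> rational_funs d" "r' \<in> rational_funs d"
  shows "val_tendsto v \<xi> (q * q') (r * r')"
  unfolding val_tendsto_def
proof
  fix B :: real
  obtain C :: real where C: "\<forall>\<^sub>F S in at_top. ereal C \<le> gauss v (\<xi> S) q'"
    using val_tendsto_bounded_below[OF assms(2,4)] by blast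
  obtain E :: real where E: "ereal E \<le> gauss v \<eta> r"
    using gauss_lower_bound by blast
  have "\<forall>\<^sub>F S in at_top. ereal (B - C) \<le> gauss v (\<xi> S) (q - r)" "\<forall>\<^sub>F S in at_top. ereal (B - E) \<le> gauss v (\<xi> S) (q' - r')"
    using assms(1,2) by (auto simp: val_tendsto_def)
  then show "\<forall>\<^sub>F S in at_top. ereal B \<le> gauss v (\<xi> S) (q * q' - r * r')"
    using C
  proof eventually_elim
    case (elim S)
    have "ereal (B - C) + ereal C \<le> gauss v (\<xi> S) (q - r) + gauss v (\<xi> S) q'"
      using elim by (intro add_mono)
    then have 1: "ereal B \<le> gauss v (\<xi> S) ((q - r) * q')"
      by (simp add: val_mult[OF gauss_family])
    have "ereal E + ereal (B - E) \<le> gauss v (\<xi> S) r + gauss v (\<xi> S) (q' - r')"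
      using elim E gauss_family_const[OF assms(3)] by (intro add_mono) auto
    then have "ereal B \<le> gauss v (\<xi> S) (r * (q' - r'))"
      by (simp add: val_mult[OF gauss_family])
    with 1 have "ereal B \<le> min (gauss v (\<xi> S) ((q - r) * q')) (gauss v (\<xi> S) (r * (q' - r')))"
      by simp
    also have "\<dots> \<le> gauss v (\<xi> S) ((q - r) * q' + r * (q' - r'))"
      using gauss_family by (rule val_add_ge)
    finally show ?case
      by (simp add: algebra_simps)
  qed
qed

text \<open>As soon as \<open>q - r\<close> has larger valuation than \<open>r\<close>, the
  valuations of \<open>q\<close> and \<open>r\<close> coincide. This is why a degeneration reaches
  the tropical limit at a finite parameter.\<close>

lemma val_tendsto_imp_eventually_eq:
  assumes "val_tendsto v \<xi> q r" "r \<in> rational_funs d" "r \<noteq> 0"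
  shows "\<forall>\<^sub>F S in at_top. gauss v (\<xi> S) q = gauss v \<eta> r"
proof -
  let ?c = "trop_rational v r \<eta>"
  have c: "gauss v (\<xi> S) r = ereal ?c" for S
    using gauss_family_const[OF assms(2)] assms(3) by (simp add: gauss_def[of v \<eta>])
  have "\<forall>\<^sub>F S in at_top. ereal (?c + 1) \<le> gauss v (\<xi> S) (q - r)"
    using assms(1) unfolding val_tendsto_def by blast
  then show ?thesis
  proof eventually_elim
    case (elim S)
    have "ereal ?c < ereal (?c + 1)"
      by simp
    also note elim
    finally have "gauss v (\<xi> S) r < gauss v (\<xi> S) (q - r)"
      by (simp add: c)
    then have "gauss v (\<xi> S) (r + (q - r)) = gauss v (\<xi> S) r"
      by (rule val_add_eq[OF gauss_family])
    then show ?case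
      using gauss_family_const[OF assms(2)] by simp
  qed
qed

lemma val_tendsto_nonzero:
  assumes "val_tendsto v \<xi> q r" "r \<in> rational_funs d" "r \<noteq> 0"
  shows "q \<noteq> 0"
proof
  assume "q = 0"
  obtain S where "gauss v (\<xi> S) q = gauss v \<eta> r"
    using eventually_happens[OF val_tendsto_imp_eventually_eq[OF assms]] by auto
  then show False
    using \<open>q = 0\<close> assms(3) by (simp add: gauss_def)
qed

lemma val_tendsto_inverse:
  assumes "val_tendsto v \<xi> q r" "r \<in> rational_funs d" "r \<noteq> 0"
  shows "val_tendsto v \<xi> (inverse q) (inverse r)"
  unfolding val_tendsto_def
proof
  fix B :: real
  let ?c = "trop_rational v r \<eta>"
  have c: "gauss v (\<xi> S) r = ereal ?c" for S
    using gauss_family_const[OF assms(2)] assms(3) by (simp add: gauss_def[of v \<eta>])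
  have q: "q \<noteq> 0"
    using assms by (rule val_tendsto_nonzero)
  \<comment> \<open>The difference of the inverses is \<open>- (q - r) / (q * r)\<close>, and
    eventually \<open>q\<close> and \<open>r\<close> both have valuation \<open>?c\<close>; hence
    the surplus \<open>2 * ?c\<close>.\<close>
  have "\<forall>\<^sub>F S in at_top. ereal (B + 2 * ?c) \<le> gauss v (\<xi> S) (q - r)"
    using assms(1) unfolding val_tendsto_def by blast
  then show "\<forall>\<^sub>F S in at_top. ereal B \<le> gauss v (\<xi> S) (inverse q - inverse r)"
    using val_tendsto_imp_eventually_eq[OF assms]
  proof eventually_elim
    case (elim S)
    let ?w = "gauss v (\<xi> S)"
    have "?w q = ereal ?c"
      using elim c[of S] gauss_family_const[OF assms(2), of S] by simp
    then have inv: "?w (inverse q) = ereal (- ?c)" "?w (inverse r) = ereal (- ?c)"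
      using val_inverse[OF gauss_family] c by blast+
    have "ereal B = ereal (B + 2 * ?c) + ereal (- ?c) + ereal (- ?c)"
      by simp
    also have "\<dots> \<le> ?w (q - r) + ereal (- ?c) + ereal (- ?c)"
      using elim by (intro add_right_mono)
    also have "\<dots> = ?w ((q - r) * inverse q * inverse r)"
      by (simp add: val_mult[OF gauss_family] inv)
    also have "\<dots> = ?w (- ((q - r) * inverse q * inverse r))"
      by (simp only: val_uminus[OF gauss_family])
    also have "- ((q - r) * inverse q * inverse r) = inverse q - inverse r"
      using q assms(3) by (simp add: field_simps)
    finally show ?case .
  qed
qed

lemma val_tendsto_powi:
  assumes "val_tendsto v \<xi> q r" "r \<in> rational_funs d" "r \<noteq> 0"
  shows "val_tendsto v \<xi> (q powi k) (r powi k)"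
proof -
  have pow: "val_tendsto v \<xi> (p ^ j) (s ^ j)" if "val_tendsto v \<xi> p s" "s \<in> rational_funs d" for p s j
  proof (induction j)
    case (Suc j)
    have "s ^ j \<in> rational_funs d"
      using rational_funs_powi[OF that(2), of "int j"] by simp
    then show ?case
      using val_tendsto_mult[OF that(1) Suc that(2)] by simp
  qed (simp add: val_tendsto_refl)
  then show ?thesis
    using assms by (auto simp: power_int_def val_tendsto_inverse rational_funs_inverse)
qed

lemma val_tendsto_prod:
  assumes "\<And>i. i \<in> I \<Longrightarrow> val_tendsto v \<xi> (q i) (r i)" "\<And>i. i \<in> I \<Longrightarrow> r i \<in> rational_funs d"
  shows "val_tendsto v \<xi> (prod q I) (prod r I)"
  using assms
  by (induction I rule: infinite_finite_induct)
    (auto intro!: val_tendsto_mult val_tendsto_refl rational_funs_prod)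

lemma val_tendsto_leval:
  assumes f: "f \<in> laurent m"
    and lim: "\<And>i. i < m \<Longrightarrow> val_tendsto v \<xi> (\<phi> i) (\<psi> i)"
    and \<psi>: "\<And>i. i < m \<Longrightarrow> \<psi> i \<in> rational_funs d" "\<And>i. i < m \<Longrightarrow> \<psi> i \<noteq> 0"
  shows "val_tendsto v \<xi> (leval const_fun f \<phi>) (leval const_fun f \<psi>)"
  unfolding leval_def
proof (intro val_tendsto_sum)
  fix \<alpha> assume "\<alpha> \<in> Poly_Mapping.keys f"
  then have \<alpha>: "\<alpha> \<in> vars_below m"
    using f by (auto simp: laurent_iff)
  have "val_tendsto v \<xi> (monom_eval \<phi> \<alpha>) (monom_eval \<psi> \<alpha>)"
    unfolding monom_eval_below[OF \<alpha>] using lim \<psi>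
    by (intro val_tendsto_prod val_tendsto_powi rational_funs_powi) auto
  moreover have "monom_eval \<psi> \<alpha> \<in> rational_funs d"
    using \<alpha> \<psi>(1) by (rule rational_funs_monom_eval)
  ultimately show "val_tendsto v \<xi> (const_fun (Poly_Mapping.lookup f \<alpha>) * monom_eval \<phi> \<alpha>)
      (const_fun (Poly_Mapping.lookup f \<alpha>) * monom_eval \<psi> \<alpha>)"
    by (intro val_tendsto_mult val_tendsto_refl) simp_all
qed

text \<open>The mean minus \<open>\<alpha> i0\<close> is the sum over the other indices of weight
  times \<open>\<alpha> i - \<alpha> i0\<close>, divided by the total weight. The total has
  valuation 0, coming from the weight \<open>i0\<close> alone, while each summand of the numerator
  has valuation \<open>S\<close> plus a term independent of \<open>S\<close>.\<close>

lemma val_tendsto_barycentre: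
  assumes i0: "i0 < k" and \<alpha>: "\<And>i. i < k \<Longrightarrow> \<alpha> i \<in> rational_funs d"
    and \<xi>0: "\<And>S. Poly_Mapping.lookup (\<xi> S) (d + i0) = 0"
    and \<xi>S: "\<And>i S. i < k \<Longrightarrow> i \<noteq> i0 \<Longrightarrow> Poly_Mapping.lookup (\<xi> S) (d + i) = S"
  shows "val_tendsto v \<xi> ((\<Sum>i<k. coord_fun (d + i) * \<alpha> i) / (\<Sum>i<k. coord_fun (d + i))) (\<alpha> i0)"
proof -
  define I where "I = {..<k} - {i0}"
  define T :: "'k rational_fun" where "T = (\<Sum>i<k. coord_fun (d + i))"
  define N where "N = (\<Sum>i\<in>I. coord_fun (d + i) * (\<alpha> i - \<alpha> i0))"
  have T: "gauss v (\<xi> S) T = ereal 0" if "S > 0" for S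
  proof -
    have "T = coord_fun (d + i0) + (\<Sum>i\<in>I. coord_fun (d + i))"
      unfolding T_def I_def using i0 by (simp add: sum.remove)
    moreover have "ereal 0 < gauss v (\<xi> S) (\<Sum>i\<in>I. coord_fun (d + i))"
      using that \<xi>S by (intro val_sum_gt[OF gauss_family]) (auto simp: gauss_coord_fun[OF v] I_def)
    moreover have "gauss v (\<xi> S) (coord_fun (d + i0)) = ereal 0"
      by (simp add: gauss_coord_fun[OF v] \<xi>0)
    ultimately show ?thesis
      using val_add_eq[OF gauss_family, of S "coord_fun (d + i0)"] by simp
  qed
  from this[of 1] have "T \<noteq> 0"
    by (auto simp: gauss_def)
  have "(\<Sum>i<k. coord_fun (d + i) * \<alpha> i) - \<alpha> i0 * T = (\<Sum>i<k. coord_fun (d + i) * (\<alpha> i - \<alpha> i0))"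
    unfolding T_def sum_distrib_left sum_subtractf[symmetric] by (simp add: algebra_simps)
  also have "\<dots> = N"
    unfolding N_def I_def using i0 by (simp add: sum.remove)
  finally have N: "(\<Sum>i<k. coord_fun (d + i) * \<alpha> i) / T - \<alpha> i0 = N * inverse T"
    using \<open>T \<noteq> 0\<close> by (simp add: field_simps)
  have "\<forall>\<^sub>F S in at_top. ereal B \<le> gauss v (\<xi> S) (N * inverse T)" for B
  proof -
    have "\<forall>\<^sub>F S in at_top. ereal B \<le> gauss v (\<xi> S) (coord_fun (d + i) * (\<alpha> i - \<alpha> i0))" if "i \<in> I" for i
    proof -
      have i: "i < k" "i \<noteq> i0"
        using that by (auto simp: I_def)
      then have D: "\<alpha> i - \<alpha> i0 \<in> rational_funs d"
        using \<alpha> i0 by (intro rational_funs_diff) auto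
      obtain C :: real where C: "ereal C \<le> gauss v \<eta> (\<alpha> i - \<alpha> i0)"
        using gauss_lower_bound by blast
      show ?thesis
        using eventually_ge_at_top[of "B - C"]
      proof eventually_elim
        case (elim S)
        have "ereal B \<le> ereal S + ereal C"
          using elim by simp
        also have "\<dots> \<le> ereal S + gauss v \<eta> (\<alpha> i - \<alpha> i0)"
          using C by (rule add_left_mono)
        also have "\<dots> = gauss v (\<xi> S) (coord_fun (d + i) * (\<alpha> i - \<alpha> i0))"
          using \<xi>S[OF i] gauss_family_const[OF D] by (simp add: val_mult[OF gauss_family] gauss_coord_fun[OF v])
        finally show ?case .
      qed
    qed
    then have "\<forall>\<^sub>F S in at_top. \<forall>i\<in>I. ereal B \<le> gauss v (\<xi> S) (coord_fun (d + i) * (\<alpha> i - \<alpha> i0))"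
      by (intro eventually_ball_finite) (auto simp: I_def)
    then show ?thesis
      using eventually_gt_at_top[of 0]
    proof eventually_elim
      case (elim S)
      have "ereal B \<le> gauss v (\<xi> S) N"
        unfolding N_def using elim by (intro val_sum_ge[OF gauss_family]) auto
      then show ?case
        using val_inverse[OF gauss_family T[OF elim(2)]] by (simp add: val_mult[OF gauss_family])
    qed
  qed
  then show ?thesis
    unfolding val_tendsto_def T_def[symmetric] N by blast
qed

end

section \<open>Combining sections of torus homomorphisms\<close>

lemma ex_poly_mapping_below:
  fixes c :: "nat \<Rightarrow> real"
  obtains \<xi> where "\<xi> \<in> Rn m" "\<And>i. i < m \<Longrightarrow> Poly_Mapping.lookup \<xi> i = c i"
proof
  let ?\<xi> = "Abs_poly_mapping (\<lambda>i. c i when i < m)"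
  have lk: "Poly_Mapping.lookup ?\<xi> i = (c i when i < m)" for i
    by (subst lookup_Abs_poly_mapping) auto
  show "?\<xi> \<in> Rn m"
    by (auto simp: Rn_def in_keys_iff lk)
  show "Poly_Mapping.lookup ?\<xi> i = c i" if "i < m" for i
    using that by (simp add: lk)
qed

text \<open>
  Reparametrise the section \<open>\<psi> 0\<close> by a weighted mean of the maps \<open>\<alpha> i = \<pi> 0 \<circ> \<psi> i\<close>, the weights
  being new variables. When the valuations of all weights but the \<open>i\<close>-th tend to infinity, the
  mean degenerates to \<open>\<alpha> i\<close>, and \<open>\<psi> 0 \<circ> \<alpha> i = \<psi> i\<close>.
\<close>

lemma combine_sections:
  fixes v :: "'k::alg_closed_field \<Rightarrow> ereal"
  assumes v: "nonarch_valuation v" and X: "zariski_closed n X" and k: "0 < k"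
    and dom: "\<And>i. i < k \<Longrightarrow> dominant_rational_map d (torus d) n X (\<psi> i)"
    and a: "\<And>j. j < d \<Longrightarrow> a j \<in> vars_below n"
    and sec: "\<And>j. j < d \<Longrightarrow> monom_eval (\<psi> 0) (a j) = coord_fun j"
  shows "\<exists>\<Phi>. dominant_rational_map (d + k) (torus (d + k)) n X \<Phi> \<and>
    (\<forall>i<k. \<forall>\<eta>. trop_map v n (\<psi> i) \<eta> \<in> trop_map v n \<Phi> ` Rn (d + k))"
proof -
  have \<psi>: "\<psi> i l \<in> rational_funs d" "\<psi> i l \<noteq> 0" if "i < k" "l < n" for i l
    using dom[OF that(1)] that(2) by (auto simp: dominant_rational_map_def rational_map_def)
  have transfer: "leval const_fun g (\<psi> i) = 0 \<longleftrightarrow> leval const_fun g (\<psi> 0) = 0"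
    if "i < k" "g \<in> laurent n" for i g
    using dominant_imp_vanishing_ideal[OF dom[OF that(1)] that(2)]
      dominant_imp_vanishing_ideal[OF dom[OF k] that(2)] by simp
  define \<alpha> where "\<alpha> i j = monom_eval (\<psi> i) (a j)" for i j
  have \<alpha>: "\<alpha> i j \<in> rational_funs d" "\<alpha> i j \<noteq> 0" if "i < k" "j < d" for i j
    unfolding \<alpha>_def using a[OF that(2)] \<psi>[OF that(1)] monom_eval_nonzero[of n "\<psi> i"]
    by (blast intro: rational_funs_monom_eval)+
  define pull :: "'k laurent_poly \<Rightarrow> 'k laurent_poly" where "pull = push (frag_extend a)"
  have pull: "pull p \<in> laurent n" if "p \<in> laurent d" for p
    unfolding pull_def using that a
    by (intro push_laurent frag_extend_vars_below[where d=d]) (auto simp: laurent_iff)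
  have leval_pull: "leval const_fun (pull p) (\<psi> i) = leval const_fun p (\<alpha> i)" if "p \<in> laurent d" "i < k" for p i
    unfolding pull_def \<alpha>_def
    by (rule leval_push_frag_extend[OF field_hom_const_fun _ that(1) a]) (use \<psi> that in auto)
  have leval_\<alpha>0: "leval const_fun p (\<alpha> 0) = Fract p 1" if "p \<in> laurent d" for p
    using leval_cong_below[OF that, of "\<alpha> 0" coord_fun const_fun] sec leval_coord_fun[OF that]
    by (simp add: \<alpha>_def)
  \<comment> \<open>A relation among the \<open>\<alpha> i\<close> pulls back to one for
    \<open>\<psi> i\<close>, hence for \<open>\<psi> 0\<close>, hence among the
    \<open>\<alpha> 0\<close>; but these are the coordinates.\<close>
  have leval_\<alpha>: "leval const_fun p (\<alpha> i) \<noteq> 0" if "p \<in> laurent d" "p \<noteq> 0" "i < k" for p i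
    using transfer[OF that(3) pull[OF that(1)]] leval_pull that k leval_\<alpha>0 by (simp add: Fract_eq_0_iff)
  define rep where "rep l f h \<longleftrightarrow> f \<in> laurent d \<and> h \<in> laurent d \<and> f \<noteq> 0 \<and> h \<noteq> 0 \<and> \<psi> 0 l = Fract f h" for l f h
  have "\<exists>f h. rep l f h" if "l < n" for l
  proof -
    obtain f h where "f \<in> laurent d" "h \<in> laurent d" "h \<noteq> 0" "\<psi> 0 l = Fract f h"
      using \<psi>(1)[OF k \<open>l < n\<close>] by (elim rational_funsE)
    moreover have "f \<noteq> 0"
      using calculation \<psi>(2)[OF k \<open>l < n\<close>] by (simp add: Fract_eq_0_iff)
    ultimately show ?thesis
      unfolding rep_def by blast
  qed
  then obtain f h where "\<And>l. l < n \<Longrightarrow> rep l (f l) (h l)"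
    by metis
  then have fh: "\<And>l. l < n \<Longrightarrow> f l \<in> laurent d" "\<And>l. l < n \<Longrightarrow> h l \<in> laurent d"
      "\<And>l. l < n \<Longrightarrow> f l \<noteq> 0" "\<And>l. l < n \<Longrightarrow> h l \<noteq> 0" "\<And>l. l < n \<Longrightarrow> \<psi> 0 l = Fract (f l) (h l)"
    by (simp_all add: rep_def)
  \<comment> \<open>Clearing denominators in \<open>\<psi> 0 l = f l / h l\<close> and replacing the
    coordinates by monomials gives a Laurent polynomial that vanishes at \<open>\<psi> 0\<close>. It
    then vanishes at \<open>\<psi> i\<close>, which says that \<open>\<psi> i\<close> is
    \<open>\<psi> 0\<close> after \<open>\<alpha> i\<close>.\<close>
  have \<psi>_\<alpha>: "\<psi> i l = leval const_fun (f l) (\<alpha> i) / leval const_fun (h l) (\<alpha> i)" if i: "i < k" and l: "l < n" for i l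
  proof -
    let ?e = "Poly_Mapping.single (Poly_Mapping.single l 1) (1::'k)"
    define g where "g = ?e * pull (h l) - pull (f l)"
    have e: "?e \<in> laurent n"
      using l by (intro laurent_single) (simp add: vars_below_def)
    have g: "g \<in> laurent n"
      unfolding g_def using e fh l by (intro laurent_diff laurent_mult pull)
    have leval_g: "leval const_fun g (\<psi> j) = \<psi> j l * leval const_fun (h l) (\<alpha> j) - leval const_fun (f l) (\<alpha> j)"
      if j: "j < k" for j
    proof -
      have "leval const_fun (?e * pull (h l)) (\<psi> j) = leval const_fun ?e (\<psi> j) * leval const_fun (pull (h l)) (\<psi> j)"
        by (rule leval_mult[OF field_hom_const_fun _ e pull]) (use \<psi> j fh l in auto)
      then show ?thesis
        using j fh l by (simp add: g_def leval_diff[OF field_hom_const_fun] leval_pull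
            leval_single[OF field_hom_const_fun] monom_eval_single del: One_nat_def)
    qed
    have "leval const_fun g (\<psi> 0) = 0"
      unfolding leval_g[OF k] using fh l by (simp add: leval_\<alpha>0 Fract_eq_0_iff)
    then have "leval const_fun g (\<psi> i) = 0"
      using transfer[OF i g] by simp
    then show ?thesis
      using leval_g[OF i] leval_\<alpha>[of "h l" i] fh i l by (simp add: field_simps)
  qed
  define \<Gamma> where "\<Gamma> j = (\<Sum>i<k. coord_fun (d + i) * \<alpha> i j) / (\<Sum>i<k. coord_fun (d + i))" for j
  have \<Gamma>_rat: "\<Gamma> j \<in> rational_funs (d + k)" if "j < d" for j
    unfolding \<Gamma>_def using \<alpha>(1) that
    by (intro rational_funs_divide rational_funs_sum rational_funs_mult rational_funs_coord)
      (auto intro: rational_funs_mono[of _ d])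
  define \<Phi> where "\<Phi> l = leval const_fun (f l) \<Gamma> / leval const_fun (h l) \<Gamma>" for l
  define good where "good i \<eta> \<xi> \<longleftrightarrow> (\<forall>S. \<xi> S \<in> Rn (d + k)) \<and>
      (\<forall>S j. j < d \<longrightarrow> Poly_Mapping.lookup (\<xi> S) j = Poly_Mapping.lookup \<eta> j) \<and>
      (\<forall>S. Poly_Mapping.lookup (\<xi> S) (d + i) = 0) \<and>
      (\<forall>S j. j < k \<longrightarrow> j \<noteq> i \<longrightarrow> Poly_Mapping.lookup (\<xi> S) (d + j) = S)"
    for i and \<eta> :: "nat \<Rightarrow>\<^sub>0 real" and \<xi> :: "real \<Rightarrow> (nat \<Rightarrow>\<^sub>0 real)"
  have ex_good: "\<exists>\<xi>. good i \<eta> \<xi>" if "i < k" for i \<eta>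
  proof -
    have "\<exists>\<xi>\<in>Rn (d + k). \<forall>j<d + k. Poly_Mapping.lookup \<xi> j
        = (if j < d then Poly_Mapping.lookup \<eta> j else if j = d + i then 0 else S)" for S
      using ex_poly_mapping_below[of "d + k" "\<lambda>j. if j < d then Poly_Mapping.lookup \<eta> j else if j = d + i then 0 else S"]
      by blast
    then obtain \<xi> where "\<And>S. \<xi> S \<in> Rn (d + k)" "\<And>S j. j < d + k \<Longrightarrow> Poly_Mapping.lookup (\<xi> S) j
        = (if j < d then Poly_Mapping.lookup \<eta> j else if j = d + i then 0 else S)"
      by metis
    then show ?thesis
      unfolding good_def using that by (intro exI[of _ \<xi>]) auto
  qed
  have lim_\<Gamma>: "val_tendsto v \<xi> (\<Gamma> j) (\<alpha> i j)" if "good i \<eta> \<xi>" "i < k" "j < d" for i \<eta> \<xi> j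
    unfolding \<Gamma>_def
    by (rule val_tendsto_barycentre[where d=d and \<eta>=\<eta>, OF v]) (use that \<alpha> in \<open>auto simp: good_def\<close>)
  have lim_leval: "val_tendsto v \<xi> (leval const_fun p \<Gamma>) (leval const_fun p (\<alpha> i))"
    if "good i \<eta> \<xi>" "i < k" "p \<in> laurent d" for i \<eta> \<xi> p
    by (rule val_tendsto_leval[where d=d and \<eta>=\<eta> and m=d, OF v])
      (use that \<alpha> lim_\<Gamma>[OF that(1,2)] in \<open>auto simp: good_def\<close>)
  \<comment> \<open>One fixed path certifies that expressions in \<open>\<Gamma>\<close> are
    non-zero: it suffices that their limits are.\<close>
  obtain \<xi>0 where \<xi>0: "good 0 0 \<xi>0"
    using ex_good[OF k] by blast
  have nonzero: "q \<noteq> 0" if "val_tendsto v \<xi>0 q r" "r \<in> rational_funs d" "r \<noteq> 0" for q r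
    by (rule val_tendsto_nonzero[where d=d and \<eta>=0, OF v _ that]) (use \<xi>0 in \<open>auto simp: good_def\<close>)
  have \<Gamma>_nz: "\<Gamma> j \<noteq> 0" if "j < d" for j
    using nonzero[OF lim_\<Gamma>[OF \<xi>0 k that]] \<alpha>[OF k that] by blast
  have leval_\<Gamma>: "leval const_fun p \<Gamma> \<noteq> 0" if "p \<in> laurent d" "p \<noteq> 0" for p
    using nonzero[OF lim_leval[OF \<xi>0 k that(1)]] leval_\<alpha>[OF that k] rational_funs_leval[OF that(1)] \<alpha>(1)[OF k]
    by blast
  have \<Phi>: "\<Phi> l \<in> rational_funs (d + k)" "\<Phi> l \<noteq> 0" if "l < n" for l
    unfolding \<Phi>_def using leval_\<Gamma> fh that \<Gamma>_rat
    by (auto intro!: rational_funs_divide rational_funs_leval[where n=d])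
  have lim_\<Phi>: "val_tendsto v \<xi> (\<Phi> l) (\<psi> i l)" if good: "good i \<eta> \<xi>" and i: "i < k" and l: "l < n" for i \<eta> \<xi> l
  proof -
    have agree: "\<And>S j. j < d \<Longrightarrow> Poly_Mapping.lookup (\<xi> S) j = Poly_Mapping.lookup \<eta> j"
      using good by (simp add: good_def)
    have rat: "leval const_fun p (\<alpha> i) \<in> rational_funs d" if "p \<in> laurent d" for p
      using that \<alpha>(1)[OF i] by (rule rational_funs_leval)
    show ?thesis
      unfolding \<Phi>_def \<psi>_\<alpha>[OF i l] divide_inverse
      using rat[OF fh(1)[OF l]] rat[OF fh(2)[OF l]] leval_\<alpha>[OF fh(2)[OF l] fh(4)[OF l] i]
        lim_leval[OF good i fh(1)[OF l]] lim_leval[OF good i fh(2)[OF l]]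
      by (intro val_tendsto_mult[OF v agree] val_tendsto_inverse[OF v agree] rational_funs_inverse)
  qed
  have "dominant_rational_map (d + k) (torus (d + k)) n X \<Phi>"
  proof (rule dominantI[OF X])
    fix g :: "'k laurent_poly" assume g: "g \<in> laurent n"
    have "leval const_fun g \<Phi> = 0 \<longleftrightarrow> leval const_fun g (\<psi> 0) = 0"
    proof
      \<comment> \<open>A relation for \<open>\<Phi>\<close> persists in the limit, and the limit of
        \<open>\<Phi>\<close> along this path is \<open>\<psi> 0\<close>.\<close>
      assume 0: "leval const_fun g \<Phi> = 0"
      have "val_tendsto v \<xi>0 (leval const_fun g \<Phi>) (leval const_fun g (\<psi> 0))"
        by (rule val_tendsto_leval[where d=d and \<eta>=0 and m=n, OF v])
          (use \<xi>0 g \<psi> k lim_\<Phi>[OF \<xi>0 k] in \<open>auto simp: good_def\<close>)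
      from nonzero[OF this rational_funs_leval[OF g \<psi>(1)[OF k]]] 0
      show "leval const_fun g (\<psi> 0) = 0"
        by auto
    next
      assume 0: "leval const_fun g (\<psi> 0) = 0"
      \<comment> \<open>Conversely \<open>\<Phi>\<close> is \<open>\<psi> 0\<close> with
        \<open>\<Gamma>\<close> substituted. Here \<open>place\<close> takes values in the function
        field, so that it describes substitution and carries relations along.\<close>
      have "place const_fun d \<Gamma> (\<psi> 0 l) (\<Phi> l)" if "l < n" for l
        unfolding place_def \<Phi>_def using fh[OF that] leval_\<Gamma> by blast
      then have "place const_fun d \<Gamma> (leval const_fun g (\<psi> 0)) (leval const_fun g \<Phi>)"
        using \<Phi>(2) \<Gamma>_nz g by (intro place_leval[OF field_hom_const_fun, where n=n])
      then show "leval const_fun g \<Phi> = 0"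
        unfolding 0 using \<Gamma>_nz
        by (intro place_unique[OF field_hom_const_fun _ _ place_0[OF field_hom_const_fun]])
    qed
    then show "leval const_fun g \<Phi> = 0 \<longleftrightarrow> g \<in> vanishing_ideal n X"
      using dominant_imp_vanishing_ideal[OF dom[OF k] g] by simp
  qed (use \<Phi> in auto)
  moreover have "trop_map v n (\<psi> i) \<eta> \<in> trop_map v n \<Phi> ` Rn (d + k)" if i: "i < k" for i \<eta>
  proof -
    obtain \<xi> where good: "good i \<eta> \<xi>"
      using ex_good[OF i] by blast
    then have agree: "\<And>S j. j < d \<Longrightarrow> Poly_Mapping.lookup (\<xi> S) j = Poly_Mapping.lookup \<eta> j"
      by (simp add: good_def)
    \<comment> \<open>The valuations are constant from some \<open>S\<close> on, simultaneously for
      the finitely many \<open>l\<close>, so one weight vector attains the whole point.\<close>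
    have "\<forall>\<^sub>F S in at_top. \<forall>l\<in>{..<n}. gauss v (\<xi> S) (\<Phi> l) = gauss v \<eta> (\<psi> i l)"
      using val_tendsto_imp_eventually_eq[OF v agree lim_\<Phi>[OF good i]] \<psi>[OF i]
      by (intro eventually_ball_finite) auto
    then obtain S where S: "\<And>l. l < n \<Longrightarrow> gauss v (\<xi> S) (\<Phi> l) = gauss v \<eta> (\<psi> i l)"
      using eventually_happens[of _ "at_top :: real filter"] by fastforce
    have "trop_map v n (\<psi> i) \<eta> = trop_map v n \<Phi> (\<xi> S)"
    proof (rule poly_mapping_eqI)
      fix l
      show "Poly_Mapping.lookup (trop_map v n (\<psi> i) \<eta>) l = Poly_Mapping.lookup (trop_map v n \<Phi> (\<xi> S)) l"
        using S[of l] \<Phi>(2)[of l] \<psi>(2)[OF i, of l] by (simp add: lookup_trop_map gauss_def)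
    qed
    moreover have "\<xi> S \<in> Rn (d + k)"
      using good by (simp add: good_def)
    ultimately show ?thesis
      by blast
  qed
  ultimately show ?thesis
    by blast
qed

theorem corollary4p4:
  fixes v :: "'k::alg_closed_field \<Rightarrow> ereal"
    and n d :: nat
    and X :: "(nat \<Rightarrow> 'k) set"
    and \<P> :: "(nat \<Rightarrow>\<^sub>0 real) set set"
  assumes "nonarch_valuation v"
    and "rational_variety n d X"
    and "finite \<P>"
    and "\<And>P. P \<in> \<P> \<Longrightarrow> polyhedron_in n P \<and> affine_dim P = int d"
    and "trop_variety v n X = \<Union> \<P>"
    and "\<And>P. P \<in> \<P> \<Longrightarrow>
           \<exists>\<pi>. torus_hom n d \<pi> \<and> birational_map n X d (torus d) \<pi> \<and>
                horizontal d (trop_map v d \<pi>) P"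
  shows "tropically_unirational v n X"
proof -
  note v = assms(1)
  have X: "zariski_closed n X"
    using assms(2) by (simp add: rational_variety_def)
  have trop_subset: "trop_map v n \<phi> \<xi> \<in> trop_variety v n X"
    if "dominant_rational_map m (torus m) n X \<phi>" for \<phi> m \<xi>
  proof (rule trop_map_subset_trop_variety[OF v])
    show "\<phi> i \<noteq> 0" if "i < n" for i
      using that \<open>dominant_rational_map m (torus m) n X \<phi>\<close>
      by (simp add: dominant_rational_map_def rational_map_def)
    show "leval const_fun g \<phi> = 0" if "g \<in> vanishing_ideal n X" for g
      using dominant_imp_vanishing_ideal[OF \<open>dominant_rational_map m (torus m) n X \<phi>\<close>, of g] that
      by (simp add: vanishing_ideal_def)
  qed
  obtain \<phi> where "dominant_rational_map d (torus d) n X \<phi>"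
    using assms(2) unfolding rational_variety_def birational_map_def by blast
  \<comment> \<open>The image of Trop(\<open>\<phi>\<close>) makes Trop(X) non-empty, so there is at
    least one polyhedron; \<open>combine_sections\<close> needs a section with index 0.\<close>
  then have "trop_variety v n X \<noteq> {}"
    using trop_subset by blast
  then have "\<P> \<noteq> {}"
    using assms(5) by auto
  define k where "k = card \<P>"
  have k: "0 < k"
    unfolding k_def using \<open>\<P> \<noteq> {}\<close> assms(3) by (simp add: card_gt_0_iff)
  obtain P where P: "bij_betw P {0..<k} \<P>"
    using ex_bij_betw_nat_finite[OF assms(3)] unfolding k_def by blast
  have P_in: "P i \<in> \<P>" if "i < k" for i
    using P that by (auto simp: bij_betw_def)
  \<comment> \<open>Bundles the data belonging to one polyhedron, so that a single choice makes all
    of them functions of the index.\<close>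
  define section_at where "section_at i \<pi> a \<psi> \<longleftrightarrow> horizontal d (trop_map v d \<pi>) (P i) \<and>
      (\<forall>j<d. a j \<in> vars_below n) \<and> (\<forall>j<d. \<pi> j = Fract (Poly_Mapping.single (a j) 1) 1) \<and>
      dominant_rational_map d (torus d) n X \<psi> \<and> (\<forall>j<d. monom_eval \<psi> (a j) = coord_fun j)"
    for i \<pi> a \<psi>
  have "\<exists>\<pi> a \<psi>. section_at i \<pi> a \<psi>" if "i < k" for i
  proof -
    obtain \<pi> where \<pi>: "torus_hom n d \<pi>" "birational_map n X d (torus d) \<pi>" "horizontal d (trop_map v d \<pi>) (P i)"
      using assms(6)[OF P_in[OF \<open>i < k\<close>]] by blast
    then show ?thesis
      unfolding section_at_def by (metis birational_torus_hom_section[OF \<pi>(1,2)])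
  qed
  then obtain \<pi> a \<psi> where "\<And>i. i < k \<Longrightarrow> section_at i (\<pi> i) (a i) (\<psi> i)"
    by metis
  then have hor: "\<And>i. i < k \<Longrightarrow> horizontal d (trop_map v d (\<pi> i)) (P i)"
    and a: "\<And>i j. i < k \<Longrightarrow> j < d \<Longrightarrow> a i j \<in> vars_below n"
    and \<pi>: "\<And>i j. i < k \<Longrightarrow> j < d \<Longrightarrow> \<pi> i j = Fract (Poly_Mapping.single (a i j) 1) 1"
    and dom: "\<And>i. i < k \<Longrightarrow> dominant_rational_map d (torus d) n X (\<psi> i)"
    and sec: "\<And>i j. i < k \<Longrightarrow> j < d \<Longrightarrow> monom_eval (\<psi> i) (a i j) = coord_fun j"
    by (simp_all add: section_at_def)
  obtain \<Phi> where \<Phi>: "dominant_rational_map (d + k) (torus (d + k)) n X \<Phi>"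
    "\<And>i \<eta>. i < k \<Longrightarrow> trop_map v n (\<psi> i) \<eta> \<in> trop_map v n \<Phi> ` Rn (d + k)"
    using combine_sections[where \<psi>=\<psi> and a="a 0", OF v X k dom a[OF k] sec[OF k]] by blast
  have "trop_map v n \<Phi> ` Rn (d + k) = trop_variety v n X"
  proof
    show "trop_map v n \<Phi> ` Rn (d + k) \<subseteq> trop_variety v n X"
      using trop_subset[OF \<Phi>(1)] by blast
    show "trop_variety v n X \<subseteq> trop_map v n \<Phi> ` Rn (d + k)"
    proof
      fix \<xi> assume \<xi>: "\<xi> \<in> trop_variety v n X"
      then obtain i where i: "i < k" "\<xi> \<in> P i"
        using P assms(5) unfolding bij_betw_def by auto
      \<comment> \<open>By horizontality Trop(\<open>\<psi> i\<close>) inverts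
        Trop(\<open>\<pi> i\<close>) on \<open>P i\<close>; coordinates from \<open>n\<close> on are
        zero on both sides.\<close>
      have "trop_map v n (\<psi> i) (trop_map v d (\<pi> i) \<xi>) = \<xi>"
      proof (rule poly_mapping_eqI)
        fix l
        have "trop_rational v (\<psi> i l) (trop_map v d (\<pi> i) \<xi>) = Poly_Mapping.lookup \<xi> l" if "l < n"
          using assms(4,5) P_in[OF i(1)] hor i that
          by (intro trop_section[OF v dom[OF i(1)] a[OF i(1)] \<pi>[OF i(1)] sec[OF i(1)], where P="P i"]) auto
        moreover have "Poly_Mapping.lookup \<xi> l = 0" if "\<not> l < n"
          using that \<xi> by (auto simp: trop_variety_def Rn_def in_keys_iff subset_iff)
        ultimately show "Poly_Mapping.lookup (trop_map v n (\<psi> i) (trop_map v d (\<pi> i) \<xi>)) l = Poly_Mapping.lookup \<xi> l"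
          by (auto simp: lookup_trop_map)
      qed
      then show "\<xi> \<in> trop_map v n \<Phi> ` Rn (d + k)"
        using \<Phi>(2)[OF i(1)] by metis
    qed
  qed
  then show ?thesis
    unfolding tropically_unirational_def using \<Phi>(1) by blast
qed

end
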